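(* Let $d=2$, $\sigma\in\mathcal A_2$, $V>0$, $\rho(v)=\sigma(|v+Ve_2|)$, and for $h>0$ consider the problem $$\mathrm R(h)=\inf\{\mathcal R_+(f_+)+\mathcal R_-(f_-):\ f_+\in\mathcal M(h_+),\ f_-\in\mathcal M(h_-),\ h_\pm\ge 0,\ h_++h_-=h\},$$ $$\mathcal R_\varepsilon(f)=\int_0^1 p_\varepsilon(f'(t))\,dt .$$ Let $\bar p_\varepsilon$ be the maximal convex function on $\mathbb R_+$ not exceeding $p_\varepsilon$, $B_\varepsilon=-\bar p_\varepsilon'(0)$, and $\mathcal O_\varepsilon=\{u\ge 0: p_\varepsilon(u)>\bar p_\varepsilon(u)\}$, $\varepsilon\in\{-,+\}$. Then: $\mathcal O_+=(0,u_+^0)$ for some $u_+^0>0$; $\mathcal O_-$ has a connected component of the form $(0,u_-^0)$ with $u_-^0>0$; $B_+>B_->0$; and there is a unique $u_*>u_+^0$ with $\bar p_+'(u_* )=p_+'(u_* )=-B_-$. For every $h>0$ the function $z\mapsto \inf_{f\in\mathcal M(z)}\mathcal R_+(f)+\inf_{f\in\mathcal M(h-z)}\mathcal R_-(f)=\bar p_+(z)+\bar p_-(h-z)$ on $[0,h]$ has a unique minimizer $z=h_+$; put $h_-=h-h_+$. Moreover the infimum $\mathrm R(h)$ is attained by the following pair $(f_+,f_-)$: 1) (trapezium) If $0<h<u_+^0$: $h_+=h$, $h_-=0$, $f_-\equiv 0$, and with $t_0=1-h/u_+^0$, $f_+(t)=-h$ on $[0,t_0]$, $f_+(t)=-h+u_+^0(t-t_0)$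 on $[t_0,1]$; $\mathrm R(h)=p_+(0)-B_+h+p_-(0)$. 2) (isosceles triangle) If $u_+^0\le h\le u_*$: $h_+=h$, $h_-=0$, $f_-\equiv 0$, $f_+(t)=-h+ht$; $\mathrm R(h)=p_+(h)+p_-(0)$. 3) (union of a triangle and a trapezium) If $u_*<h<u_*+u_-^0$: $h_+=u_*$, $h_-=h-u_*$, $f_+(t)=-u_*+u_*t$, and with $t_0=1-h_-/u_-^0$, $f_-(t)=-h_-$ on $[0,t_0]$, $f_-(t)=-h_-+u_-^0(t-t_0)$ on $[t_0,1]$; $\mathrm R(h)=p_+(u_* )+p_-(0)-B_-(h-u_* )$. 4) If $h\ge u_*+u_-^0$: the pair $(h_+,h_-)$ is determined by $h_++h_-=h$, $p_+'(h_+)=\bar p_-'(h_-)$, $h_+\ge u_+^0$, $h_-\ge u_-^0$; $f_+(t)=-h_++h_+t$; $\mathrm R(h)=p_+(h_+)+\bar p_-(h_-)$; and 4a) (union of two isosceles triangles) if $h_-\notin\mathcal O_-$, then $f_-(t)=-h_-+h_-t$; 4b) (union of two triangles and a trapezium) if $h_-$ belongs to a connected component $(u_i^-,u_i^+)$ of $\mathcal O_-$ (necessarily different from $(0,u_-^0)$), then with $t_i=\frac{u_i^+-h_-}{u_i^+-u_i^-}$, $f_-(t)=-h_-+u_i^-t$ for $t\le t_i$ and $f_-(t)=-h_-+u_i^-t_i+u_i^+(t-t_i)$ for $t\ge t_i$. The set of those $h$ for which case 4b) occurs is an open (possibly empty) subset of $(u_*+u_-^0,+\infty)$, and its complement in $(u_*+u_-^0,+\infty)$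 is non-empty. There exist $\sigma\in\mathcal A_2$ and $V>0$ for which the set of $h$ in case 4b) is non-empty.
   Context: $\mathbb R_+=[0,+\infty)$. "Monotone increasing/decreasing" is in the strict sense (as opposed to "non-decreasing/non-increasing"). $\mathcal A_2$ is the set of functions $\sigma\in C^1(\mathbb R_+)$ such that $r\mapsto\sigma'(r)/r$, $r>0$, is negative, bounded below and monotone increasing, and $\int_0^\infty r^2\sigma(r)\,d(r^2)<\infty$. $e_2$ is the second coordinate vector of $\mathbb R^2$, $z_-=\max\{-z,0\}$, and for $u\ge 0$, $\varepsilon\in\{-,+\}$ (read as $\pm1$ in formulas) $$p_\varepsilon(u)=\varepsilon\int_{\mathbb R^2}\frac{\big((v_1u+\varepsilon v_2)_-\big)^2}{1+u^2}\,\rho(v)\,dv .$$ For $h\ge0$, $\mathcal M(h)$ is the class of convex, non-positive, non-decreasing, continuous functions $f:[0,1]\to\mathbb R$ with $f(0)=-h$ (such $f$ is differentiable off an at most countable set). Physical meaning: the convex body $\{(x',x_2): |x'|\le 1,\ f_-(|x'|)\le x_2\le -f_+(|x'|)\}$ of length $h=-f_+(0)-f_-(0)$ is at rest in a flux of point particles with mass density $\rho(v)$ over velocities, colliding elastically with it; up to a positive constant factor the resistance force has magnitude $\mathcal R_+(f_+)+\mathcal R_-(f_-)$, and $\mathrm R(h)$ is the minimal resistance among bodies of length $h$. *)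

theory Defs
  imports "HOL-Analysis.Analysis"
begin

text \<open>
  Functions on the half-line or on the unit interval are total functions on the reals of which only the
  values on that set are used; derivatives at the end point 0 are one-sided.
  Finiteness of the moment integral means (absolute) integrability. For a decreasing function this
  forces it to be positive, as befits a density.
\<close>

definition class_A2 :: "(real \<Rightarrow> real) set" where
  "class_A2 = {\<sigma>. \<exists>\<sigma>'.
      continuous_on {0..} \<sigma>' \<and>
      (\<forall>r\<ge>0. (\<sigma> has_real_derivative \<sigma>' r) (at r within {0..})) \<and>
      (\<forall>r>0. \<sigma>' r / r < 0) \<and>
      bdd_below ((\<lambda>r. \<sigma>' r / r) ` {0<..}) \<and>
      strict_mono_on {0<..} (\<lambda>r. \<sigma>' r / r) \<and>
      set_integrable lborel {0..} (\<lambda>r. r\<^sup>2 * \<sigma> r * (2 * r))}"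

definition flux_density :: "(real \<Rightarrow> real) \<Rightarrow> real \<Rightarrow> real \<times> real \<Rightarrow> real" where
  "flux_density \<sigma> V v = \<sigma> (norm (v + V *\<^sub>R (0, 1)))"

text \<open>The sign \<open>\<epsilon>\<close> is a real number, used with the values \<open>1\<close> and \<open>- 1\<close> only.\<close>

definition pressure :: "(real \<times> real \<Rightarrow> real) \<Rightarrow> real \<Rightarrow> real \<Rightarrow> real" where
  "pressure \<rho> \<epsilon> u =
     \<epsilon> * (\<integral>v. (max (- (fst v * u + \<epsilon> * snd v)) 0)\<^sup>2 / (1 + u\<^sup>2) * \<rho> v \<partial>lborel)"

definition convex_minorant :: "(real \<Rightarrow> real) \<Rightarrow> (real \<Rightarrow> real) \<Rightarrow> bool" where
  "convex_minorant p g \<longleftrightarrow> convex_on {0..} g \<and> (\<forall>u\<ge>0. g u \<le> p u)"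

text \<open>
  The pointwise supremum of the convex minorants is the maximal one as soon as a minorant exists.
\<close>

definition convex_envelope :: "(real \<Rightarrow> real) \<Rightarrow> real \<Rightarrow> real" where
  "convex_envelope p u = (SUP g \<in> {g. convex_minorant p g}. g u)"

definition pbar :: "(real \<times> real \<Rightarrow> real) \<Rightarrow> real \<Rightarrow> real \<Rightarrow> real" where
  "pbar \<rho> \<epsilon> = convex_envelope (pressure \<rho> \<epsilon>)"

definition slope_B :: "(real \<times> real \<Rightarrow> real) \<Rightarrow> real \<Rightarrow> real" where
  "slope_B \<rho> \<epsilon> = - vector_derivative (pbar \<rho> \<epsilon>) (at 0 within {0..})"

definition gap_set :: "(real \<times> real \<Rightarrow> real) \<Rightarrow> real \<Rightarrow> real set" where
  "gap_set \<rho> \<epsilon> = {u. 0 \<le> u \<and> pressure \<rho> \<epsilon> u > pbar \<rho> \<epsilon> u}"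

definition u0_plus :: "(real \<times> real \<Rightarrow> real) \<Rightarrow> real" where
  "u0_plus \<rho> = (THE u. 0 < u \<and> gap_set \<rho> 1 = {0<..<u})"

definition u0_minus :: "(real \<times> real \<Rightarrow> real) \<Rightarrow> real" where
  "u0_minus \<rho> = (THE u. 0 < u \<and> {0<..<u} \<in> components (gap_set \<rho> (- 1)))"

definition is_u_star :: "(real \<times> real \<Rightarrow> real) \<Rightarrow> real \<Rightarrow> bool" where
  "is_u_star \<rho> u \<longleftrightarrow> u > u0_plus \<rho> \<and>
     (pbar \<rho> 1 has_real_derivative - slope_B \<rho> (- 1)) (at u) \<and>
     (pressure \<rho> 1 has_real_derivative - slope_B \<rho> (- 1)) (at u)"

definition u_star :: "(real \<times> real \<Rightarrow> real) \<Rightarrow> real" where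
  "u_star \<rho> = (THE u. is_u_star \<rho> u)"

definition profiles :: "real \<Rightarrow> (real \<Rightarrow> real) set" where
  "profiles h = {f. convex_on {0..1} f \<and> (\<forall>t\<in>{0..1}. f t \<le> 0) \<and> mono_on {0..1} f \<and>
                    continuous_on {0..1} f \<and> f 0 = - h}"

text \<open>
  \<^const>\<open>deriv\<close> is unspecified at the at most countably many points of non-differentiability,
  which do not influence the integral.
\<close>

definition resistance :: "(real \<times> real \<Rightarrow> real) \<Rightarrow> real \<Rightarrow> (real \<Rightarrow> real) \<Rightarrow> real" where
  "resistance \<rho> \<epsilon> f = integral {0..1} (\<lambda>t. pressure \<rho> \<epsilon> (deriv f t))"

definition inf_resistance :: "(real \<times> real \<Rightarrow> real) \<Rightarrow> real \<Rightarrow> real \<Rightarrow> real" where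
  "inf_resistance \<rho> \<epsilon> z = (INF f \<in> profiles z. resistance \<rho> \<epsilon> f)"

definition total_resistance ::
    "(real \<times> real \<Rightarrow> real) \<Rightarrow> (real \<Rightarrow> real) \<times> (real \<Rightarrow> real) \<Rightarrow> real" where
  "total_resistance \<rho> fg = resistance \<rho> 1 (fst fg) + resistance \<rho> (- 1) (snd fg)"

definition bodies :: "real \<Rightarrow> ((real \<Rightarrow> real) \<times> (real \<Rightarrow> real)) set" where
  "bodies h = {(f, g). \<exists>h1 h2. 0 \<le> h1 \<and> 0 \<le> h2 \<and> h1 + h2 = h \<and> f \<in> profiles h1 \<and> g \<in> profiles h2}"

definition minimal_resistance :: "(real \<times> real \<Rightarrow> real) \<Rightarrow> real \<Rightarrow> real" where
  "minimal_resistance \<rho> h = (INF fg \<in> bodies h. total_resistance \<rho> fg)"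

definition attains_minimum ::
    "(real \<times> real \<Rightarrow> real) \<Rightarrow> real \<Rightarrow> (real \<Rightarrow> real) \<Rightarrow> (real \<Rightarrow> real) \<Rightarrow> bool" where
  "attains_minimum \<rho> h f g \<longleftrightarrow>
     (f, g) \<in> bodies h \<and>
     total_resistance \<rho> (f, g) = minimal_resistance \<rho> h \<and>
     (\<forall>fg\<in>bodies h. minimal_resistance \<rho> h \<le> total_resistance \<rho> fg)"

definition split_resistance :: "(real \<times> real \<Rightarrow> real) \<Rightarrow> real \<Rightarrow> real \<Rightarrow> real" where
  "split_resistance \<rho> h z = inf_resistance \<rho> 1 z + inf_resistance \<rho> (- 1) (h - z)"

definition h_plus :: "(real \<times> real \<Rightarrow> real) \<Rightarrow> real \<Rightarrow> real" where
  "h_plus \<rho> h = arg_min_on (split_resistance \<rho> h) {0..h}"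

definition h_minus :: "(real \<times> real \<Rightarrow> real) \<Rightarrow> real \<Rightarrow> real" where
  "h_minus \<rho> h = h - h_plus \<rho> h"

definition balanced :: "(real \<times> real \<Rightarrow> real) \<Rightarrow> real \<Rightarrow> real \<Rightarrow> real \<Rightarrow> bool" where
  "balanced \<rho> h a b \<longleftrightarrow>
     a + b = h \<and>
     (\<exists>D. (pressure \<rho> 1 has_real_derivative D) (at a) \<and>
          (pbar \<rho> (- 1) has_real_derivative D) (at b)) \<and>
     u0_plus \<rho> \<le> a \<and> u0_minus \<rho> \<le> b"

definition case_4b :: "(real \<times> real \<Rightarrow> real) \<Rightarrow> real set" where
  "case_4b \<rho> = {h. h \<ge> u_star \<rho> + u0_minus \<rho> \<and> h_minus \<rho> h \<in> gap_set \<rho> (- 1)}"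

end

theory Submission
  imports Defs
begin

text \<open>
  Translating and rotating the velocity plane gives \<open>p\<^sub>\<epsilon>(u) = \<epsilon> A\<^sub>2(\<epsilon> V c)\<close> with \<open>c = (1 + u\<^sup>2)\<^sup>-\<^sup>1\<^sup>/\<^sup>2\<close>, where
  \<open>A\<^sub>2(s)\<close> is the integral of \<open>((s - y)\<^sub>+)\<^sup>2 \<sigma>(|(x, y)|)\<close> over the plane. Here \<open>A\<^sub>2' = 2 A\<^sub>1\<close> and \<open>A\<^sub>1' = A\<^sub>0\<close>, the mass of
  the half-plane \<open>y \<le> s\<close>. Stretching half-planes, which only uses that \<open>\<sigma>\<close> decreases, shows that \<open>A\<^sub>0(s) / s\<close>
  does not increase; hence \<open>s\<^sup>2 A\<^sub>1(s) (V\<^sup>2 - s\<^sup>2)\<^sup>1\<^sup>/\<^sup>2\<close> is log-concave, and \<open>p\<^sub>+\<close> is first concave and then convex.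
  Also \<open>p\<^sub>+' < p\<^sub>-' < 0\<close>. Everything else is convex analysis of such pairs: the least resistance of a profile
  is given by the convex envelope of \<open>p\<^sub>\<epsilon>\<close> (supporting lines from below, two-slope profiles from above), and a
  splitting of the length is optimal when both envelopes have a common supporting slope. The slope
  of the front envelope on its initial segment is steeper than any slope of the rear one, and
  the front envelope is strictly convex afterwards, so the optimal splitting is unique.
  For the density \<open>(a\<^sup>2 + r\<^sup>2)\<^sup>-\<^sup>3\<close> the rear pressure is a multiple of \<open>- ((a\<^sup>2 + s\<^sup>2)\<^sup>1\<^sup>/\<^sup>2 - s)\<^sup>2\<close>, and a
  superposition of two widely different scales \<open>a\<close> yields case 4b.
\<close>

section \<open>Convex envelopes\<close>

text \<open>Origin of the log-concave function: p_+' is a negative multiple of u c^3 A_1(V c), and u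
  c^3 = s^2 (V^2 - s^2)^(1/2) / V^3 for s = V c, u >= 0. The product vanishes at both ends (s = V is
  u = 0), so p_+' falls once and rises once, and the front has a single gap, which begins at 0. The
  obstacle is the rear. There A_1 is taken at -s, where stretching half-planes gives nothing, and
  the gaps of p_- may be many. The envelope is therefore studied through its closed contact set, for
  any bounded, strictly decreasing pressure that is flat at 0 (\<open>drag_law\<close>); only the
  front gets a unimodal derivative. A common supporting slope suffices for optimality because the
  sum of the two supporting lines does not depend on where the length is cut. Constants of the
  example: up to a common factor, a kernel of width a contributes a drop of at most a^2 / a^4. Width
  10^3 with weight 10^4 thus gives 1/100, against 1 for width 1. With V = 10^5 the drops happen
  around u = V / a, that is near 10^2 and 10^5.\<close>

lemma convex_on_line_minorant:
  "convex_on {0..} (\<lambda>u::real. a + b * (u - c))"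
  by (rule convex_onI) (auto simp: algebra_simps)

text \<open>The nearer end of the chord lies between \<open>u\<close> and the farther end. Convexity
  bounds the value there, and solving for \<open>q u\<close> puts it above the prolonged
  chord.\<close>

lemma convex_on_chord_above_outside:
  fixes q :: "real \<Rightarrow> real"
  assumes q: "convex_on S q" and "a \<in> S" "b \<in> S" "u \<in> S" "a < b" "u \<le> a \<or> b \<le> u"
  shows "q a + (q b - q a) / (b - a) * (u - a) \<le> q u"
proof -
  consider "u = a" | "u = b" | "u < a" | "b < u" using assms by linarith
  then show ?thesis
  proof cases
    case 3
    define t where "t = (a - u) / (b - u)"
    have tb: "t * (b - u) = a - u" using 3 assms by (simp add: t_def)
    have "0 \<le> t" "t \<le> 1" using 3 assms by (auto simp: t_def)
    moreover have "(1 - t) * u + t * b = a" using tb by (simp add: algebra_simps)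
    ultimately
    have "q a \<le> (1 - t) * q u + t * q b"
      using convex_onD[OF q, of t u b] assms by simp
    then have "q a * (b - u) \<le> ((1 - t) * q u + t * q b) * (b - u)"
      using 3 assms by (intro mult_right_mono) auto
    also have "\<dots> = (b - u) * q u + (t * (b - u)) * (q b - q u)"
      by (simp add: algebra_simps)
    also have "\<dots> = (b - a) * q u + (a - u) * q b"
      unfolding tb by (simp add: algebra_simps)
    finally show ?thesis using assms by (simp add: field_simps)
  next
    case 4
    define t where "t = (b - a) / (u - a)"
    have tb: "t * (u - a) = b - a" using 4 assms by (simp add: t_def)
    have "0 \<le> t" "t \<le> 1" using 4 assms by (auto simp: t_def)
    moreover have "(1 - t) * a + t * u = b" using tb by (simp add: algebra_simps)
    ultimately have "q b \<le> (1 - t) * q a + t * q u"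
      using convex_onD[OF q, of t a u] assms by simp
    then have "q b * (u - a) \<le> ((1 - t) * q a + t * q u) * (u - a)"
      using 4 assms by (intro mult_right_mono) auto
    also have "\<dots> = (u - a) * q a + (t * (u - a)) * (q u - q a)"
      by (simp add: algebra_simps)
    also have "\<dots> = (u - b) * q a + (b - a) * q u"
      unfolding tb by (simp add: algebra_simps)
    finally show ?thesis using assms by (simp add: field_simps)
  qed (use assms in auto)
qed

lemma convex_on_chord_below_inside:
  fixes q :: "real \<Rightarrow> real"
  assumes q: "convex_on S q" and "a \<in> S" "b \<in> S" "a < b" "u \<in> {a..b}"
  shows "q u \<le> q a + (q b - q a) / (b - a) * (u - a)"
proof -
  define t where "t = (u - a) / (b - a)"
  have tb: "t * (b - a) = u - a" using assms by (simp add: t_def)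
  have "0 \<le> t" "t \<le> 1" using assms by (auto simp: t_def)
  moreover have "(1 - t) * a + t * b = u" using tb by (simp add: algebra_simps)
  ultimately have "q u \<le> (1 - t) * q a + t * q b"
    using convex_onD[OF q, of t a b] assms by simp
  also have "\<dots> = q a + (q b - q a) / (b - a) * (u - a)"
    by (simp add: t_def algebra_simps diff_divide_distrib)
  finally show ?thesis .
qed

text \<open>What the front and the rear pressure have in common. \<open>d_0\<close> opens a gap
  right at 0; the lower bound keeps every gap bounded, the upper bound makes the envelope
  non-increasing.\<close>

locale drag_law =
  fixes p d :: "real \<Rightarrow> real" and c C :: real
  assumes der: "\<And>u. (p has_real_derivative d u) (at u)"
    and d_0: "d 0 = 0"
    and d_neg: "\<And>u. u > 0 \<Longrightarrow> d u < 0"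
    and p_ge: "\<And>u. c \<le> p u"
    and p_le: "\<And>u. p u \<le> C"
begin

abbreviation "q \<equiv> convex_envelope p"
abbreviation "gap \<equiv> {u. 0 \<le> u \<and> q u < p u}"

section \<open>Minorants, monotonicity and continuity of the envelope\<close>

lemma p_cont: "continuous_on A p"
  using der DERIV_continuous continuous_at_imp_continuous_on by blast

lemma p_strict_decreasing: "0 \<le> a \<Longrightarrow> a < b \<Longrightarrow> p b < p a"
  by (rule DERIV_neg_imp_decreasing_open[of a b p])
     (use der d_neg p_cont in \<open>force+\<close>)

lemma const_minorant: "convex_minorant p (\<lambda>u. c)"
  using p_ge by (simp add: convex_minorant_def convex_on_def flip: distrib_right)

lemma bdd_minorants: "u \<ge> 0 \<Longrightarrow> bdd_above ((\<lambda>g. g u) ` {g. convex_minorant p g})"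
  by (rule bdd_aboveI[where M = "p u"]) (auto simp: convex_minorant_def)

lemma q_max: "convex_minorant p g \<Longrightarrow> u \<ge> 0 \<Longrightarrow> g u \<le> q u"
  unfolding convex_envelope_def by (intro cSUP_upper bdd_minorants) auto

lemma q_least: "u \<ge> 0 \<Longrightarrow> (\<And>g. convex_minorant p g \<Longrightarrow> g u \<le> x) \<Longrightarrow> q u \<le> x"
  unfolding convex_envelope_def by (intro cSUP_least) (use const_minorant in auto)

lemma q_le_p: "u \<ge> 0 \<Longrightarrow> q u \<le> p u"
  by (rule q_least) (auto simp: convex_minorant_def)

lemma q_convex: "convex_on {0..} q"
proof (rule convex_onI)
  fix t x y :: real
  assume t: "0 < t" "t < 1" and xy: "x \<in> {0..}" "y \<in> {0..}"
  have n: "0 \<le> (1 - t) * x + t * y" using t xy by auto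
  show "q ((1 - t) *\<^sub>R x + t *\<^sub>R y) \<le> (1 - t) * q x + t * q y"
  proof (simp, rule q_least[OF n])
    fix g assume g: "convex_minorant p g"
    then have "g ((1 - t) * x + t * y) \<le> (1 - t) * g x + t * g y"
      using t xy convex_onD[of "{0..}" g t x y] by (auto simp: convex_minorant_def)
    also have "\<dots> \<le> (1 - t) * q x + t * q y"
      using t xy g q_max by (intro add_mono mult_left_mono) auto
    finally show "g ((1 - t) * x + t * y) \<le> (1 - t) * q x + t * q y" .
  qed
qed auto

lemma q_minorant: "convex_minorant p q"
  using q_convex q_le_p by (simp add: convex_minorant_def)

lemma q_ge: "u \<ge> 0 \<Longrightarrow> c \<le> q u"
  using q_max[OF const_minorant] by simp

lemma line_le_q:
  assumes "\<And>u. u \<ge> 0 \<Longrightarrow> a + b * (u - x) \<le> p u" "u \<ge> 0"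
  shows "a + b * (u - x) \<le> q u"
  using q_max[of "\<lambda>u. a + b * (u - x)"] assms convex_on_line_minorant
  by (auto simp: convex_minorant_def)

text \<open>At the end point 0 convexity alone gives no continuity. A line from
  \<open>p 0 - e\<close> that descends steeply enough stays below \<open>p\<close>: near 0 by
  continuity of \<open>p\<close>, and from distance \<open>r\<close> on because it is already below
  \<open>c\<close>.\<close>

lemma q_lower_near_0:
  assumes "e > 0"
  obtains K where "K \<ge> 0" "\<And>u. u \<ge> 0 \<Longrightarrow> p 0 - e - K * u \<le> q u"
proof -
  have "isCont p 0" using der DERIV_isCont by blast
  then obtain r where r: "r > 0" "\<And>u. \<bar>u\<bar> < r \<Longrightarrow> \<bar>p u - p 0\<bar> < e"
    using assms unfolding continuous_at_eps_delta dist_real_def by (metis diff_zero)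
  define K where "K = (p 0 - c) / r"
  have K: "K \<ge> 0" using r p_ge[of 0] by (simp add: K_def)
  have "(p 0 - e) + (- K) * (u - 0) \<le> p u" if "u \<ge> 0" for u
  proof (cases "u < r")
    case True
    then have "p 0 - e \<le> p u" using r(2)[of u] that by auto
    moreover have "0 \<le> K * u" using K that by simp
    ultimately show ?thesis by simp
  next
    case False
    then have "K * r \<le> K * u" using K by (intro mult_left_mono) auto
    then have "p 0 - c \<le> K * u" using r by (simp add: K_def)
    then show ?thesis using p_ge[of u] assms by simp
  qed
  then have "(p 0 - e) + (- K) * (u - 0) \<le> q u" if "u \<ge> 0" for u
    using line_le_q that by blast
  then show thesis using that K by (simp add: algebra_simps)
qed

lemma q_0: "q 0 = p 0"
proof (rule antisym)
  show "p 0 \<le> q 0"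
  proof (rule field_le_epsilon)
    fix e :: real assume "e > 0"
    then obtain K where "\<And>u. u \<ge> 0 \<Longrightarrow> p 0 - e - K * u \<le> q u" using q_lower_near_0 by metis
    from this[of 0] show "p 0 \<le> q 0 + e" by simp
  qed
qed (simp add: q_le_p)

text \<open>A convex function that rises somewhere keeps rising at least linearly and would exceed
  the bound \<open>C\<close>.\<close>

lemma q_antimono:
  assumes "0 \<le> x" "x \<le> y" shows "q y \<le> q x"
proof (rule ccontr)
  assume n: "\<not> q y \<le> q x"
  then have xy: "x < y" using assms by (cases "x = y") auto
  define s where "s = (q y - q x) / (y - x)"
  have s: "s > 0" using n xy by (simp add: s_def)
  \<comment> \<open>Far enough for the prolonged chord through \<open>x\<close> and \<open>y\<close>
    to reach \<open>C + 1\<close>.\<close>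
  define u where "u = y + (C - q x + 1) / s"
  have "q x \<le> C" using q_le_p[of x] p_le[of x] assms by linarith
  then have u: "u \<ge> y" using s by (simp add: u_def)
  have "q x + s * (u - x) \<le> q u" unfolding s_def
    using assms xy u by (intro convex_on_chord_above_outside[OF q_convex]) auto
  moreover have "s * (u - x) = s * (y - x) + (C - q x + 1)" using s by (simp add: u_def field_simps)
  moreover have "s * (y - x) \<ge> 0" using s xy by simp
  ultimately have "q u \<ge> C + 1" by simp
  then show False using q_le_p[of u] p_le[of u] u assms by linarith
qed

text \<open>Interior points are covered by convexity. At 0 the envelope is squeezed between the
  lines of \<open>q_lower_near_0\<close> and, by monotonicity, its own value
  \<open>q 0\<close>.\<close>

lemma q_cont: "continuous_on {0..} q"
proof -
  have "continuous_on {0<..} q"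
    by (rule convex_on_continuous) (auto intro!: convex_on_subset[OF q_convex])
  then have pos: "isCont q u" if "u > 0" for u
    using that by (simp add: continuous_on_eq_continuous_at)
  have "continuous (at 0 within {0..}) q"
    unfolding continuous_within_eps_delta
  proof (intro allI impI)
    fix e :: real assume e: "e > 0"
    then obtain K where K: "K \<ge> 0" "\<And>u. u \<ge> 0 \<Longrightarrow> p 0 - e / 2 - K * u \<le> q u"
      using q_lower_near_0[of "e / 2"] by auto
    define r where "r = e / 2 / (K + 1)"
    have "dist (q u) (q 0) < e" if u: "u \<in> {0..}" "dist u 0 < r" for u
    proof -
      have "K * u \<le> (K + 1) * u" using u by (simp add: algebra_simps)
      also have "\<dots> < (K + 1) * r" using u K by (intro mult_strict_left_mono) auto
      also have "\<dots> = e / 2" using K(1) unfolding r_def by (subst nonzero_mult_div_cancel_left[symmetric, of "K + 1" "e / 2"]) simp_all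
      finally have "q 0 - e < q u" using K(2)[of u] u q_0 by auto
      moreover have "q u \<le> q 0" using q_antimono[of 0 u] u by auto
      ultimately show ?thesis by (auto simp: dist_real_def)
    qed
    moreover have "r > 0" using e K by (simp add: r_def)
    ultimately show "\<exists>r>0. \<forall>u\<in>{0..}. dist u 0 < r \<longrightarrow> dist (q u) (q 0) < e" by blast
  qed
  then have "continuous (at u within {0..}) q" if "u \<ge> 0" for u
    using pos[of u] that by (cases "u = 0") (auto intro: continuous_at_imp_continuous_at_within)
  then show ?thesis by (auto simp: continuous_on_eq_continuous_within)
qed

text \<open>
  Lower the chord of the envelope until it touches \<open>p\<close>: it is then a minorant of \<open>p\<close>, so the point
  where it touches is a contact point.
\<close>

lemma q_affine_on_gap:
  assumes ab: "0 \<le> a" "a < b" and qa: "q a = p a" and sub: "{a<..<b} \<subseteq> gap" and u: "u \<in> {a..b}"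
  shows "q u = q a + (q b - q a) / (b - a) * (u - a)"
proof -
  define s where "s = (q b - q a) / (b - a)"
  define l where "l = (\<lambda>u. q a + s * (u - a))"
  have lb: "l b = q b" using ab by (simp add: l_def s_def)
  have "continuous_on {a..b} (\<lambda>u. p u - l u)"
    unfolding l_def by (intro continuous_intros p_cont)
  then obtain t where t: "t \<in> {a..b}" and tmin: "\<And>u. u \<in> {a..b} \<Longrightarrow> p t - l t \<le> p u - l u"
    using continuous_attains_inf[of "{a..b}" "\<lambda>u. p u - l u"] ab by auto
  define m where "m = p t - l t"
  have m0: "m \<le> 0" using tmin[of a] ab qa by (simp add: m_def l_def)
  have low: "(q a + m) + s * (v - a) \<le> p v" if v: "v \<ge> 0" for v
  proof (cases "v \<in> {a..b}")
    case True
    then show ?thesis using tmin[of v] by (simp add: m_def l_def)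
  next
    case False
    then have "q a + s * (v - a) \<le> q v" unfolding s_def
      using ab v by (intro convex_on_chord_above_outside[OF q_convex]) auto
    then show ?thesis using m0 q_le_p[OF v] by simp
  qed
  have lq: "l v + m \<le> q v" if "v \<ge> 0" for v
  proof -
    have "(q a + m) + s * (v - a) \<le> q v" by (rule line_le_q[OF low that])
    then show ?thesis by (simp add: l_def)
  qed
  have "p t \<le> q t" using lq[of t] t ab by (simp add: m_def)
  then have "t \<notin> gap" by simp
  then have "t \<notin> {a<..<b}" using sub by blast
  then have "t = a \<or> t = b" using t by auto
  moreover have "p b \<le> q b \<Longrightarrow> q b = p b" using q_le_p[of b] ab by simp
  ultimately have "m = 0" using \<open>p t \<le> q t\<close> lb qa by (auto simp: m_def l_def)
  then have "l u \<le> q u" using lq[of u] u ab by simp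
  moreover have "q u \<le> l u" unfolding l_def s_def
    using ab u by (intro convex_on_chord_below_inside[OF q_convex]) auto
  ultimately show ?thesis by (simp add: l_def s_def)
qed

text \<open>Without a further contact point the envelope would be affine on the whole ray beyond
  \<open>a\<close>. Its slope would be negative because \<open>p\<close> decreases, so it would fall
  below \<open>c\<close>.\<close>

lemma gap_bounded_right:
  assumes a: "0 \<le> a" "q a = p a"
  shows "\<exists>b>a. q b = p b"
proof (rule ccontr)
  assume "\<not> (\<exists>b>a. q b = p b)"
  then have n: "q b < p b" if "b > a" for b using that q_le_p[of b] a by fastforce
  define s where "s = q (a + 1) - q a"
  have aff: "q (a + n) = q a + s * n" if "n \<ge> 1" for n
  proof -
    have "q (a + 1) = q a + (q (a + n) - q a) / (a + n - a) * (a + 1 - a)"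
      by (rule q_affine_on_gap) (use a that n in auto)
    then show ?thesis using that by (simp add: s_def field_simps)
  qed
  have "s < 0" using n[of "a + 1"] p_strict_decreasing[of a "a + 1"] a by (simp add: s_def)
  define n where "n = max 1 ((q a - c + 1) / (- s))"
  have "(q a - c + 1) / (- s) * (- s) \<le> n * (- s)"
    using \<open>s < 0\<close> by (intro mult_right_mono) (auto simp: n_def)
  then have "q (a + n) \<le> c - 1" using aff[of n] \<open>s < 0\<close> by (simp add: n_def mult.commute)
  moreover have "c \<le> q (a + n)" by (rule q_ge) (use a in \<open>auto simp: n_def\<close>)
  ultimately show False by simp
qed

section \<open>The contact set and the gaps between contact points\<close>

lemma contact_closed: "closed {u. 0 \<le> u \<and> q u = p u}"
proof -
  have "closed ({0..} \<inter> (\<lambda>u. p u - q u) -` {0})"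
    by (intro continuous_closed_preimage continuous_on_diff p_cont q_cont closed_atLeast closed_singleton)
  also have "{0..} \<inter> (\<lambda>u. p u - q u) -` {0} = {u. 0 \<le> u \<and> q u = p u}" by auto
  finally show ?thesis .
qed

text \<open>The ends are the last contact point before \<open>x\<close> and the first one after it.
  They exist by compactness; \<open>gap_bounded_right\<close> supplies the contact point
  \<open>b1\<close> that bounds the search to the right.\<close>

lemma gap_neighbours:
  assumes x: "x \<in> gap"
  obtains a b where "0 \<le> a" "a < x" "x < b" "q a = p a" "q b = p b" "{a<..<b} \<subseteq> gap"
proof -
  let ?C = "{u. 0 \<le> u \<and> q u = p u}"
  have A: "compact (?C \<inter> {0..x})" using contact_closed by (simp add: closed_Int_compact)
  have "0 \<in> ?C \<inter> {0..x}" using x q_0 by auto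
  then obtain a where a: "a \<in> ?C \<inter> {0..x}" "\<And>v. v \<in> ?C \<inter> {0..x} \<Longrightarrow> v \<le> a"
    using compact_attains_sup[OF A] by blast
  have ax: "a < x" using a x by (cases "a = x") auto
  obtain b1 where b1: "b1 > a" "q b1 = p b1" using gap_bounded_right[of a] a by blast
  have xb1: "x < b1"
  proof (rule ccontr)
    assume "\<not> x < b1"
    then have "b1 \<in> ?C \<inter> {0..x}" using b1 a by auto
    from a(2)[OF this] b1 show False by simp
  qed
  have B: "compact (?C \<inter> {x..b1})" using contact_closed by (simp add: closed_Int_compact)
  have "b1 \<in> ?C \<inter> {x..b1}" using b1 xb1 x by auto
  then obtain b where b: "b \<in> ?C \<inter> {x..b1}" "\<And>v. v \<in> ?C \<inter> {x..b1} \<Longrightarrow> b \<le> v"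
    using compact_attains_inf[OF B] by blast
  have xb: "x < b" using b x by (cases "b = x") auto
  have "{a<..<b} \<subseteq> gap"
  proof
    fix v assume v: "v \<in> {a<..<b}"
    have "v \<notin> ?C"
    proof
      assume "v \<in> ?C"
      then consider "v \<in> ?C \<inter> {0..x}" | "v \<in> ?C \<inter> {x..b1}" using v b by fastforce
      then show False using a(2) b(2) v by cases force+
    qed
    then show "v \<in> gap" using v a q_le_p[of v] by auto
  qed
  with that a b ax xb show thesis by auto
qed

text \<open>A larger connected set would contain one of the ends, and these are contact
  points.\<close>

lemma gap_component:
  assumes ab: "0 \<le> a" "a < b" "q a = p a" "q b = p b" "{a<..<b} \<subseteq> gap"
  shows "{a<..<b} \<in> components gap"
  unfolding in_components_maximal
proof (intro conjI allI impI)
  fix D assume D: "D \<noteq> {} \<and> {a<..<b} \<subseteq> D \<and> D \<subseteq> gap \<and> connected D"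
  have "(a + b) / 2 \<in> {a<..<b}" using ab by simp
  then have mid: "(a + b) / 2 \<in> D" using D by blast
  have "z \<in> {a<..<b}" if z: "z \<in> D" for z
  proof (rule ccontr)
    assume "z \<notin> {a<..<b}"
    then have "a \<in> D \<or> b \<in> D"
      using D mid z ab connectedD_interval[of D z "(a + b) / 2" a]
        connectedD_interval[of D "(a + b) / 2" z b] by auto
    then show False using D ab by auto
  qed
  then show "D = {a<..<b}" using D by blast
qed (use ab in auto)

text \<open>\<open>p\<close> is flat at 0, whereas the chord of the envelope from 0 to 1 descends at
  least at the rate \<open>p 0 - p 1\<close>; so \<open>p\<close> stays above that chord for a
  while.\<close>

lemma gap_near_0:
  obtains r where "r > 0" "{0<..<r} \<subseteq> gap"
proof -
  define k where "k = p 0 - p 1"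
  have k: "k > 0" using p_strict_decreasing[of 0 1] by (simp add: k_def)
  have "((\<lambda>u. (p u - p 0) / (u - 0)) \<longlongrightarrow> 0) (at 0)"
    using der[of 0] d_0 by (simp add: has_field_derivative_iff)
  then have "\<forall>\<^sub>F u in at 0. (p u - p 0) / (u - 0) > - k"
    using k by (intro order_tendstoD) auto
  then obtain r where r: "r > 0" "\<And>u. u \<noteq> 0 \<Longrightarrow> \<bar>u\<bar> < r \<Longrightarrow> (p u - p 0) / u > - k"
    by (auto simp: eventually_at)
  have "u \<in> gap" if u: "u \<in> {0<..<min r 1}" for u
  proof -
    have "p u - p 0 > - k * u" using r(2)[of u] u by (simp add: field_simps)
    moreover have "q u \<le> q 0 + (q 1 - q 0) / (1 - 0) * (u - 0)"
      using u by (intro convex_on_chord_below_inside[OF q_convex]) auto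
    moreover have "(q 1 - q 0) * u \<le> (- k) * u"
      using u q_le_p[of 1] q_0 by (intro mult_right_mono) (auto simp: k_def)
    ultimately show ?thesis using u q_0 by auto
  qed
  then have "{0<..<min r 1} \<subseteq> gap" by blast
  then show thesis by (intro that[of "min r 1"]) (use r in auto)
qed

lemma first_gap:
  obtains w where "w > 0" "q w = p w" "{0<..<w} \<subseteq> gap"
proof -
  obtain r where r: "r > 0" "{0<..<r} \<subseteq> gap" by (rule gap_near_0)
  then have "r / 2 \<in> gap" by (intro subsetD[OF r(2)]) auto
  then obtain a b where ab: "0 \<le> a" "a < r / 2" "r / 2 < b" "q a = p a" "q b = p b" "{a<..<b} \<subseteq> gap"
    by (rule gap_neighbours)
  have "a = 0"
  proof (rule ccontr)
    assume "a \<noteq> 0"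
    then have "a \<in> gap" using r ab by (intro subsetD[OF r(2)]) auto
    then show False using ab by simp
  qed
  then show thesis using that[of b] ab r by auto
qed

section \<open>Differentiability of the envelope\<close>

lemma q_deriv_contact:
  assumes x: "x > 0" "q x = p x"
  shows "(q has_real_derivative d x) (at x)"
proof -
  \<comment> \<open>The right derivative of \<open>q\<close> at \<open>x\<close>, hence the slope of
    a supporting line.\<close>
  define s where "s = Inf ((\<lambda>t. (q x - q t) / (x - t)) ` ({x<..} \<inter> {0..}))"
  have sup: "q y \<ge> q x + s * (y - x)" if "y \<ge> 0" for y
    unfolding s_def using x that by (intro convex_le_Inf_differential[OF q_convex]) auto
  \<comment> \<open>The line that supports \<open>q\<close> lies below \<open>p\<close> and touches
    it at \<open>x\<close>, so \<open>p\<close> minus the line has an interior minimum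
    there.\<close>
  have "d x - s = 0"
  proof (rule DERIV_local_min)
    show "((\<lambda>y. p y - s * y) has_real_derivative d x - s) (at x)"
      by (auto intro!: derivative_eq_intros der)
    show "\<forall>y. \<bar>x - y\<bar> < x \<longrightarrow> p x - s * x \<le> p y - s * y"
    proof (intro allI impI)
      fix y assume "\<bar>x - y\<bar> < x"
      then have "y \<ge> 0" by linarith
      then show "p x - s * x \<le> p y - s * y"
        using sup[of y] q_le_p[of y] x by (simp add: algebra_simps)
    qed
  qed fact
  then have s: "s = d x" by simp
  \<comment> \<open>\<open>q\<close> lies between its supporting line and \<open>p\<close>, which
    both have slope \<open>d x\<close> at \<open>x\<close>.\<close>
  have "((\<lambda>y. (q y - q x) / (y - x) - d x) \<longlongrightarrow> 0) (at x)"
  proof (rule Lim_null_comparison)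
    show "\<forall>\<^sub>F y in at x. norm ((q y - q x) / (y - x) - d x) \<le> \<bar>(p y - p x) / (y - x) - d x\<bar>"
    proof (rule eventually_mono[of "\<lambda>y. y > 0 \<and> y \<noteq> x"])
      have "\<forall>\<^sub>F y in at x. y > 0" using x
        by (intro order_tendstoD[OF tendsto_ident_at])
      then show "\<forall>\<^sub>F y in at x. y > 0 \<and> y \<noteq> x"
        by (auto simp: eventually_conj_iff eventually_at_filter)
      fix y assume y: "y > 0 \<and> y \<noteq> x"
      then have 1: "0 \<le> q y - q x - d x * (y - x)" using sup[of y] s by simp
      have 2: "q y - q x - d x * (y - x) \<le> p y - p x - d x * (y - x)" using q_le_p[of y] x y by simp
      have "\<bar>q y - q x - d x * (y - x)\<bar> / \<bar>y - x\<bar> \<le> \<bar>p y - p x - d x * (y - x)\<bar> / \<bar>y - x\<bar>"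
        using 1 2 by (intro divide_right_mono) auto
      then show "norm ((q y - q x) / (y - x) - d x) \<le> \<bar>(p y - p x) / (y - x) - d x\<bar>"
        using y by (simp add: diff_divide_distrib flip: abs_divide)
    qed
    show "((\<lambda>y. \<bar>(p y - p x) / (y - x) - d x\<bar>) \<longlongrightarrow> 0) (at x)"
      using der[of x] by (intro tendsto_rabs_zero) (simp add: has_field_derivative_iff LIM_zero)
  qed
  then show ?thesis by (simp add: has_field_derivative_iff LIM_zero_iff)
qed

lemma affine_deriv_at:
  fixes f :: "real \<Rightarrow> real"
  assumes "\<And>u. u \<in> {a<..<b} \<Longrightarrow> f u = k + s * (u - a)" "x \<in> {a<..<b}"
  shows "(f has_real_derivative s) (at x)"
proof -
  have "((\<lambda>u. k + s * (u - a)) has_real_derivative s) (at x within {a<..<b})"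
    by (auto intro!: derivative_eq_intros)
  then have "(f has_real_derivative s) (at x within {a<..<b})"
    by (rule has_field_derivative_transform_within[where d = 1]) (use assms in auto)
  then show ?thesis using assms(2) by (simp add: at_within_open[OF _ open_greaterThanLessThan])
qed

lemma q_deriv_gap:
  assumes ab: "0 \<le> a" "a < b" "q a = p a" "{a<..<b} \<subseteq> gap" "x \<in> {a<..<b}"
  shows "(q has_real_derivative (q b - q a) / (b - a)) (at x)"
proof (rule affine_deriv_at[where a = a and b = b and k = "q a"])
  show "q u = q a + (q b - q a) / (b - a) * (u - a)" if "u \<in> {a<..<b}" for u
    using q_affine_on_gap[OF ab(1-4), of u] that by simp
qed fact

lemma q_differentiable:
  assumes "x > 0" obtains D where "(q has_real_derivative D) (at x)"
proof (cases "q x = p x")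
  case True
  then show thesis using that q_deriv_contact[of x] assms by blast
next
  case False
  then have "x \<in> gap" using q_le_p[of x] assms by auto
  then obtain a b where "0 \<le> a" "a < x" "x < b" "q a = p a" "q b = p b" "{a<..<b} \<subseteq> gap"
    by (rule gap_neighbours)
  then show thesis using q_deriv_gap[of a b x] that by auto
qed

lemma q_tangent:
  assumes "x > 0" "(q has_real_derivative D) (at x)" "u \<ge> 0"
  shows "q x + D * (u - x) \<le> q u"
proof -
  have "q u - q x \<ge> D * (u - x)"
    by (rule convex_on_imp_above_tangent[OF q_convex])
       (use assms in \<open>auto intro: DERIV_subset\<close>)
  then show ?thesis by simp
qed

end

text \<open>\<open>w\<close> closes the gap that begins at 0; \<open>first_gap\<close> provides
  it.\<close>

locale drag_law_first_gap = drag_law +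
  fixes w :: real
  assumes w_pos: "w > 0" and w_contact: "q w = p w" and w_gap: "{0<..<w} \<subseteq> gap"
begin

definition "B = (p 0 - p w) / w"

lemma B_pos: "B > 0"
  using p_strict_decreasing[of 0 w] w_pos by (simp add: B_def)

lemma q_first: "u \<in> {0..w} \<Longrightarrow> q u = p 0 - B * u"
  using q_affine_on_gap[of 0 w u] w_pos w_contact w_gap q_0
  by (simp add: B_def diff_divide_distrib algebra_simps)

lemma q_deriv_0: "(q has_real_derivative - B) (at 0 within {0..})"
proof -
  have "((\<lambda>u. p 0 - B * u) has_real_derivative - B) (at 0 within {0..})"
    by (auto intro!: derivative_eq_intros)
  then show ?thesis
    by (rule has_field_derivative_transform_within[where d = w])
       (use w_pos q_first in \<open>auto simp: dist_real_def\<close>)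
qed

lemma q_deriv_first: "u \<in> {0<..<w} \<Longrightarrow> (q has_real_derivative - B) (at u)"
  by (rule affine_deriv_at[of 0 w q "p 0" "- B"]) (simp_all add: q_first)

text \<open>\<open>q\<close> is affine with slope \<open>- B\<close> to the left of \<open>w\<close>
  and differentiable at the contact point \<open>w\<close>, so its left difference quotients
  determine the derivative.\<close>

lemma w_deriv: "d w = - B"
proof -
  have t: "q w + d w * (u - w) \<le> q u" if "u \<ge> 0" for u
    using q_tangent[OF w_pos q_deriv_contact] w_pos w_contact that by blast
  have "(q w - q 0) / w \<le> d w" using t[of 0] w_pos by (simp add: field_simps)
  then have ge: "- B \<le> d w" using q_0 w_contact by (simp add: B_def minus_divide_left)
  have "((\<lambda>u. (q u - q w) / (u - w)) \<longlongrightarrow> d w) (at_left w)"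
    using q_deriv_contact[of w] w_pos w_contact
    by (simp add: has_field_derivative_iff filterlim_at_split)
  moreover have "\<forall>\<^sub>F u in at_left w. (q u - q w) / (u - w) = - B"
    using eventually_at_left_real[OF w_pos]
  proof eventually_elim
    case (elim u)
    then have "(q u - q w) = - B * (u - w)" using q_first[of u] q_first[of w] by (simp add: algebra_simps)
    then show ?case using elim by (simp add: divide_simps)
  qed
  ultimately have "((\<lambda>u. - B) \<longlongrightarrow> d w) (at_left w)"
    using tendsto_cong[of "\<lambda>u. (q u - q w) / (u - w)" "\<lambda>u. - B"] by simp
  then show ?thesis using tendsto_unique[of "at_left w" "\<lambda>u. - B" "- B" "d w"] by simp
qed

lemma q_above_first_line: "u \<ge> 0 \<Longrightarrow> p 0 - B * u \<le> q u"
  using convex_on_chord_above_outside[OF q_convex, of 0 w u] q_first[of u] q_first[of w] w_pos q_0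
  by (cases "u \<le> w") (auto simp: divide_simps)

lemma q_deriv_ge:
  assumes "x > 0" "(q has_real_derivative D) (at x)" shows "- B \<le> D"
proof -
  have "q x - D * x \<le> p 0" using q_tangent[OF assms, of 0] q_0 by simp
  then have "- B * x \<le> D * x" using q_above_first_line[of x] assms by simp
  then show ?thesis using assms mult_le_cancel_right_pos by blast
qed

text \<open>The initial slope of a convex function is its steepest descent. This limits how much the
  rear resistance grows when a piece of length is moved to the front.\<close>

lemma q_steepest:
  assumes "0 \<le> x" "x \<le> y" shows "q x - B * (y - x) \<le> q y"
proof (cases "x = 0")
  case True
  then show ?thesis using q_above_first_line[of y] q_0 assms by simp
next
  case False
  then have x: "x > 0" using assms by simp
  obtain D where D: "(q has_real_derivative D) (at x)" using q_differentiable[OF x] by blast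
  have "- B * (y - x) \<le> D * (y - x)"
    using q_deriv_ge[OF x D] assms by (intro mult_right_mono) auto
  then show ?thesis using q_tangent[OF x D, of y] assms by simp
qed

lemma component_with_left_end_0:
  assumes "u > 0" "{0<..<u} \<in> components gap" shows "u = w"
proof -
  have "{0<..<w} \<in> components gap"
    using gap_component[of 0 w] w_pos w_contact w_gap q_0 by auto
  moreover have "min u w / 2 \<in> {0<..<u} \<inter> {0<..<w}" using assms(1) w_pos by (auto simp: min_def)
  ultimately have "{0<..<u} = {0<..<w}"
    using assms(2) components_nonoverlap[of "{0<..<u}" gap "{0<..<w}"] by blast
  then have "Sup {0<..<u} = Sup {0<..<w}" by simp
  then show ?thesis using assms(1) w_pos by (simp only: cSup_greaterThanLessThan)
qed

end

section \<open>Least resistance of a profile\<close>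

text \<open>The right derivative \<open>g\<close> is monotone, hence continuous off a countable set.
  Where \<open>g\<close> is continuous, the subgradient inequalities at \<open>t\<close> and at a
  nearby \<open>s\<close> squeeze the difference quotient to \<open>g t\<close>.\<close>

lemma subgradient_on_unit_interval:
  fixes f :: "real \<Rightarrow> real"
  assumes f: "convex_on {0..1} f"
  obtains g where "mono_on {0<..<1} g"
    and "\<And>t s. t \<in> {0<..<1} \<Longrightarrow> s \<in> {0..1} \<Longrightarrow> f t + g t * (s - t) \<le> f s"
    and "countable {t \<in> {0<..<1}. \<not> (f has_real_derivative g t) (at t)}"
proof -
  define g where "g = (\<lambda>t. Inf ((\<lambda>s. (f t - f s) / (t - s)) ` ({t<..} \<inter> {0..1})))"
  have sup: "f t + g t * (s - t) \<le> f s" if "t \<in> {0<..<1}" "s \<in> {0..1}" for t s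
    unfolding g_def using that by (intro convex_le_Inf_differential[OF f]) auto
  have mono: "mono_on {0<..<1} g"
  proof (rule mono_onI)
    fix r s :: real assume rs: "r \<in> {0<..<1}" "s \<in> {0<..<1}" "r \<le> s"
    show "g r \<le> g s"
    proof (cases "r = s")
      case False
      have "g r * (s - r) \<le> g s * (s - r)"
        using sup[of r s] sup[of s r] rs by (simp add: algebra_simps)
      then show ?thesis using False rs by simp
    qed simp
  qed
  have diff: "(f has_real_derivative g t) (at t)" if t: "t \<in> {0<..<1}" and cont: "isCont g t" for t
  proof -
    have "((\<lambda>s. (f s - f t) / (s - t) - g t) \<longlongrightarrow> 0) (at t)"
    proof (rule Lim_null_comparison)
      have "\<forall>\<^sub>F s in at t. s \<in> {0<..<1}"
        using t by (intro eventually_at_in_open') auto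
      moreover have "\<forall>\<^sub>F s in at t. s \<noteq> t" by (simp add: eventually_at_filter)
      ultimately show "\<forall>\<^sub>F s in at t. norm ((f s - f t) / (s - t) - g t) \<le> \<bar>g s - g t\<bar>"
      proof eventually_elim
        case (elim s)
        have 1: "0 \<le> f s - f t - g t * (s - t)" using sup[of t s] t elim by simp
        have 2: "f s - f t - g t * (s - t) \<le> (g s - g t) * (s - t)"
          using sup[of s t] t elim by (simp add: algebra_simps)
        have "(f s - f t) / (s - t) - g t = (f s - f t - g t * (s - t)) / (s - t)"
          using elim by (simp add: diff_divide_distrib)
        then have "norm ((f s - f t) / (s - t) - g t) = \<bar>f s - f t - g t * (s - t)\<bar> / \<bar>s - t\<bar>"
          by (simp add: abs_divide)
        also have "\<dots> \<le> \<bar>(g s - g t) * (s - t)\<bar> / \<bar>s - t\<bar>"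
          using 1 2 by (intro divide_right_mono) auto
        also have "\<dots> = \<bar>g s - g t\<bar>" using elim by (simp add: abs_mult)
        finally show ?case .
      qed
      show "((\<lambda>s. \<bar>g s - g t\<bar>) \<longlongrightarrow> 0) (at t)"
        using cont by (intro tendsto_rabs_zero LIM_zero) (simp add: isCont_def)
    qed
    then show ?thesis by (simp add: has_field_derivative_iff LIM_zero_iff)
  qed
  have "countable {t \<in> {0<..<1}. \<not> isCont g t}"
    by (rule mono_on_ctble_discont_open[OF _ mono]) simp
  then have "countable {t \<in> {0<..<1}. \<not> (f has_real_derivative g t) (at t)}"
    by (rule countable_subset[rotated]) (use diff in auto)
  with that mono sup show thesis by blast
qed

lemma linear_profile: "h \<ge> 0 \<Longrightarrow> (\<lambda>t. - h + h * t) \<in> profiles h"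
  using convex_on_subset[OF convex_on_line_minorant[of "- h" h 0], of "{0..1}"]
  by (auto simp: profiles_def intro!: mono_onI mult_left_mono mult_left_le continuous_intros)

text \<open>\<open>ti\<close> is the place where the slope changes, chosen so that the profile ends
  at height 0. With \<open>a = 0\<close> this is the profile of a trapezium.\<close>

definition two_slope_profile :: "real \<Rightarrow> real \<Rightarrow> real \<Rightarrow> real \<Rightarrow> real" where
  "two_slope_profile a b h =
     (let ti = (b - h) / (b - a) in
      (\<lambda>t. if t \<le> ti then - h + a * t else - h + a * ti + b * (t - ti)))"

text \<open>Because \<open>a < b\<close>, the profile is the maximum of its two lines, which yields
  convexity, monotonicity and continuity together.\<close>

lemma two_slope_profile:
  assumes "0 \<le> a" "a \<le> h" "h \<le> b" "a < b"
  shows "two_slope_profile a b h \<in> profiles h"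
proof -
  define ti where "ti = (b - h) / (b - a)"
  have ti: "ti * (b - a) = b - h" "0 \<le> ti" "ti \<le> 1" using assms by (auto simp: ti_def)
  define f where "f = two_slope_profile a b h"
  have f: "f t = max (- h + a * t) (- h + a * ti + b * (t - ti))" for t
  proof -
    have "(- h + a * ti + b * (t - ti)) - (- h + a * t) = (b - a) * (t - ti)"
      by (simp add: algebra_simps)
    moreover have "(b - a) * (t - ti) \<le> 0 \<longleftrightarrow> t \<le> ti" using assms by (simp add: mult_le_0_iff)
    ultimately show ?thesis
      unfolding f_def two_slope_profile_def Let_def ti_def[symmetric] by (auto simp: max_def)
  qed
  have "convex_on {0..1} f"
  proof (rule convex_onI)
    fix t x y :: real assume t: "0 < t" "t < 1"
    have "- h + a * ((1 - t) * x + t * y) = (1 - t) * (- h + a * x) + t * (- h + a * y)"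
      by (simp add: algebra_simps)
    also have "\<dots> \<le> (1 - t) * f x + t * f y"
      using t by (intro add_mono mult_left_mono) (auto simp: f)
    finally have 1: "- h + a * ((1 - t) * x + t * y) \<le> (1 - t) * f x + t * f y" .
    have "- h + a * ti + b * ((1 - t) * x + t * y - ti)
        = (1 - t) * (- h + a * ti + b * (x - ti)) + t * (- h + a * ti + b * (y - ti))"
      by (simp add: algebra_simps)
    also have "\<dots> \<le> (1 - t) * f x + t * f y"
      using t by (intro add_mono mult_left_mono) (auto simp: f)
    finally have "max (- h + a * ((1 - t) * x + t * y)) (- h + a * ti + b * ((1 - t) * x + t * y - ti))
        \<le> (1 - t) * f x + t * f y"
      using 1 by simp
    then show "f ((1 - t) *\<^sub>R x + t *\<^sub>R y) \<le> (1 - t) * f x + t * f y"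
      unfolding real_scaleR_def f[of "(1 - t) * x + t * y"] .
  qed simp
  moreover have mono: "f x \<le> f y" if "x \<le> y" for x y
    unfolding f using assms that by (intro max.mono add_left_mono mult_left_mono) auto
  have "- h + a * ti + b * (1 - ti) = 0" using ti(1) by (simp add: algebra_simps)
  then have f1: "f 1 = 0" using assms by (simp add: f)
  then have "f t \<le> 0" if "t \<in> {0..1}" for t using mono[of t 1] that by simp
  moreover have "mono_on {0..1} f" using mono by (simp add: mono_on_def)
  moreover have "continuous_on {0..1} f" unfolding f by (intro continuous_intros)
  moreover have "f 0 = - h"
  proof -
    have "a * ti - b * ti \<le> 0" using ti assms by (simp flip: left_diff_distrib add: mult_nonpos_nonneg)
    then show ?thesis by (simp add: f max_def)
  qed
  ultimately show ?thesis by (simp add: profiles_def f_def)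
qed

context drag_law
begin

definition "res f = integral {0..1} (\<lambda>t. p (deriv f t))"

lemma res_linear: "res (\<lambda>t. - h + h * t) = p h"
proof -
  have "deriv (\<lambda>t. - h + h * t) t = h" for t
    by (rule DERIV_imp_deriv) (auto intro!: derivative_eq_intros)
  then show ?thesis by (simp add: res_def)
qed

text \<open>The slopes \<open>a\<close> and \<open>b\<close> occupy portions \<open>ti\<close> and
  \<open>1 - ti\<close> of the interval, so the resistance is the height at \<open>h\<close> of the
  chord of \<open>p\<close>. Over a gap with contact ends this chord is the envelope.\<close>

lemma res_two_slope:
  assumes "0 \<le> a" "a \<le> h" "h \<le> b" "a < b"
  shows "res (two_slope_profile a b h) = p a + (p b - p a) / (b - a) * (h - a)"
proof -
  define ti where "ti = (b - h) / (b - a)"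
  have ti: "ti * (b - a) = b - h" "0 \<le> ti" "ti \<le> 1" using assms by (auto simp: ti_def)
  define f where "f = two_slope_profile a b h"
  have f: "f t = (if t \<le> ti then - h + a * t else - h + a * ti + b * (t - ti))" for t
    by (simp add: f_def two_slope_profile_def Let_def ti_def)
  have left: "deriv f t = a" if "t < ti" for t
  proof (rule DERIV_imp_deriv)
    have "((\<lambda>t. - h + a * t) has_real_derivative a) (at t)"
      by (auto intro!: derivative_eq_intros)
    then show "(f has_real_derivative a) (at t)"
      by (rule has_field_derivative_transform_within[where d = "ti - t"])
         (use that in \<open>auto simp: f dist_real_def\<close>)
  qed
  have right: "deriv f t = b" if "t > ti" for t
  proof (rule DERIV_imp_deriv)
    have "((\<lambda>t. - h + a * ti + b * (t - ti)) has_real_derivative b) (at t)"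
      by (auto intro!: derivative_eq_intros)
    then show "(f has_real_derivative b) (at t)"
      by (rule has_field_derivative_transform_within[where d = "t - ti"])
         (use that in \<open>auto simp: f dist_real_def\<close>)
  qed
  have "((\<lambda>t. p a) has_integral (p a * ti)) {0..ti}"
    using has_integral_const_real[of "p a" 0 ti] ti by (simp add: mult.commute)
  then have 1: "((\<lambda>t. p (deriv f t)) has_integral (p a * ti)) {0..ti}"
    by (rule has_integral_spike_finite[of "{ti}", rotated 2]) (auto simp: left)
  have "((\<lambda>t. p b) has_integral (p b * (1 - ti))) {ti..1}"
    using has_integral_const_real[of "p b" ti 1] ti by (simp add: mult.commute)
  then have 2: "((\<lambda>t. p (deriv f t)) has_integral (p b * (1 - ti))) {ti..1}"
    by (rule has_integral_spike_finite[of "{ti}", rotated 2]) (auto simp: right)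
  have "((\<lambda>t. p (deriv f t)) has_integral (p a * ti + p b * (1 - ti))) {0..1}"
    by (rule has_integral_combine[OF ti(2,3) 1 2])
  then have "res f = p a * ti + p b * (1 - ti)" by (simp add: res_def integral_unique)
  also have "\<dots> = p a + (p b - p a) * (1 - ti)" by (simp add: algebra_simps)
  also have "1 - ti = (h - a) / (b - a)" using assms by (simp add: ti_def field_simps)
  finally show ?thesis by (simp add: f_def)
qed

end

context drag_law_first_gap
begin

text \<open>At 0, where only a one-sided derivative exists, the first segment serves. The sign of
  \<open>s\<close> is what \<open>res_ge\<close> uses for the telescoped rise of a profile, which
  may be less than \<open>z\<close>.\<close>

lemma supporting_slope:
  assumes "z \<ge> 0" obtains s where "s \<le> 0" "\<And>u. u \<ge> 0 \<Longrightarrow> q z + s * (u - z) \<le> q u"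
proof (cases "z = 0")
  case True
  then show thesis using that[of "- B"] B_pos q_above_first_line q_0 by simp
next
  case False
  then have z: "z > 0" using assms by simp
  obtain D where D: "(q has_real_derivative D) (at z)" using q_differentiable[OF z] .
  have "D \<le> 0" using q_tangent[OF z D, of "z + 1"] q_antimono[of z "z + 1"] z by simp
  then show thesis using that q_tangent[OF z D] by blast
qed

text \<open>
  On each cell of a uniform partition the derivative of \<open>f\<close> is at most the mean slope over the next cell,
  so the integral dominates the Riemann sum of a supporting line of the envelope at these mean slopes,
  which telescopes. This avoids integrating the possibly unbounded derivative.
\<close>

lemma res_ge:
  assumes f: "f \<in> profiles z"
  shows "q z \<le> res f"
proof -
  have fc: "convex_on {0..1} f" and f_le: "\<And>t. t \<in> {0..1} \<Longrightarrow> f t \<le> 0" and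
    fm: "\<And>x y. 0 \<le> x \<Longrightarrow> x \<le> y \<Longrightarrow> y \<le> 1 \<Longrightarrow> f x \<le> f y" and f0: "f 0 = - z"
    using f by (auto simp: profiles_def mono_on_def)
  have z: "z \<ge> 0" using f_le[of 0] f0 by simp
  obtain s where s: "s \<le> 0" "\<And>u. u \<ge> 0 \<Longrightarrow> q z + s * (u - z) \<le> q u"
    using supporting_slope[OF z] by blast
  obtain g where gm: "mono_on {0<..<1} g"
    and g: "\<And>t s. t \<in> {0<..<1} \<Longrightarrow> s \<in> {0..1} \<Longrightarrow> f t + g t * (s - t) \<le> f s"
    and gd: "countable {t \<in> {0<..<1}. \<not> (f has_real_derivative g t) (at t)}"
    using subgradient_on_unit_interval[OF fc] by blast
  \<comment> \<open>The ends 0 and 1, where a subgradient may not exist, get the value 0. This keeps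
    \<open>w\<close> non-negative and measurable and changes no integral.\<close>
  define w where "w = (\<lambda>t. if t \<in> {0<..<1} then g t else 0)"
  have w_ge: "0 \<le> w t" for t
  proof (cases "t \<in> {0<..<1}")
    case True
    have "0 \<le> g t * t" using g[of t 0] fm[of 0 t] True by simp
    then show ?thesis using True by (simp add: w_def zero_le_mult_iff)
  qed (auto simp: w_def)
  have "g \<in> borel_measurable (restrict_space borel {0<..<1})"
    by (rule borel_measurable_mono_on_fnc[OF gm])
  then have "w \<in> borel_measurable borel"
  proof (subst (asm) borel_measurable_restrict_space_iff)
    have "w = (\<lambda>t. indicator {0<..<1} t *\<^sub>R g t)" by (auto simp: w_def indicator_def)
    then show "(\<lambda>t. indicator {0<..<1} t *\<^sub>R g t) \<in> borel_measurable borel \<Longrightarrow> w \<in> borel_measurable borel"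
      by simp
  qed simp
  moreover have "p \<in> borel_measurable borel"
    by (rule borel_measurable_continuous_onI[OF p_cont])
  ultimately have pw: "(\<lambda>t. p (w t)) \<in> borel_measurable borel" by measurable
  have int: "(\<lambda>t. p (w t)) integrable_on {x..y}" for x y
  proof (rule measurable_bounded_by_integrable_imp_integrable_real)
    show "(\<lambda>t. p (w t)) \<in> borel_measurable (lebesgue_on {x..y})"
      using pw by (intro measurable_restrict_space1 measurable_completion) simp
    show "(\<lambda>t. \<bar>c\<bar> + \<bar>C\<bar>) integrable_on {x..y}" by (rule integrable_const_ivl)
    show "\<bar>p (w t)\<bar> \<le> \<bar>c\<bar> + \<bar>C\<bar>" for t using p_ge[of "w t"] p_le[of "w t"] by linarith
  qed simp
  define I where "I = (\<lambda>x. integral {0..x} (\<lambda>t. p (w t)))"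
  have "I 1 = res f" unfolding I_def res_def
  proof (rule integral_spike)
    show "negligible ({t \<in> {0<..<1}. \<not> (f has_real_derivative g t) (at t)} \<union> {0, 1})"
      using gd by (auto simp: negligible_iff_null_sets intro: null_sets_completionI countable_imp_null_set_lborel)
    fix t :: real
    assume "t \<in> {0..1} - ({t \<in> {0<..<1}. \<not> (f has_real_derivative g t) (at t)} \<union> {0, 1})"
    then have "t \<in> {0<..<1}" "(f has_real_derivative g t) (at t)" by auto
    then show "p (deriv f t) = p (w t)" by (simp add: w_def DERIV_imp_deriv)
  qed
  have split: "I y = I x + integral {x..y} (\<lambda>t. p (w t))" if "0 \<le> x" "x \<le> y" for x y
    unfolding I_def using Henstock_Kurzweil_Integration.integral_combine[OF that int] by simp
  \<comment> \<open>The last cell has no successor and is only bounded below by \<open>c\<close>; it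
    is the whole error of order \<open>1 / n\<close>.\<close>
  have main: "q z - (q z - s * z - c) / n \<le> I 1" if n: "n \<ge> 1" for n :: nat
  proof -
    have cell: "I (real k / n) + (q z - s * z) / n + s * (f (real (k + 2) / n) - f (real (k + 1) / n))
        \<le> I (real (k + 1) / n)" if k: "k + 2 \<le> n" for k
    proof -
      define x y where "x = real (k + 1) / n" and "y = real (k + 2) / n"
      have xy: "x \<in> {0<..<1}" "y \<in> {0..1}" "y - x = 1 / n" "x < y"
        using k n by (auto simp: x_def y_def field_simps)
      define \<sigma> where "\<sigma> = n * (f y - f x)"
      have gx: "g x \<le> \<sigma>" using g[of x y] xy n by (simp add: \<sigma>_def field_simps)
      have "0 \<le> \<sigma>" using w_ge[of x] gx xy by (simp add: w_def)
      have low: "q z + s * (\<sigma> - z) \<le> p (w t)" if t: "t \<in> {real k / n..x}" for t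
      proof -
        have "w t \<le> \<sigma>"
        proof (cases "t \<in> {0<..<1}")
          case True
          then show ?thesis using mono_onD[OF gm, of t x] t xy gx by (simp add: w_def)
        qed (use \<open>0 \<le> \<sigma>\<close> in \<open>auto simp: w_def\<close>)
        then have "q \<sigma> \<le> q (w t)" using w_ge by (intro q_antimono)
        then show ?thesis using s(2)[OF \<open>0 \<le> \<sigma>\<close>] q_le_p[OF w_ge[of t]] by linarith
      qed
      have "integral {real k / n..x} (\<lambda>t. q z + s * (\<sigma> - z)) \<le> integral {real k / n..x} (\<lambda>t. p (w t))"
        using low by (intro integral_le int) auto
      moreover have "x - real k / n = 1 / n" "real k / n \<le> x"
        using n by (simp_all add: x_def field_simps)
      then have "integral {real k / n..x} (\<lambda>t. q z + s * (\<sigma> - z)) = (q z + s * (\<sigma> - z)) / n"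
        by simp
      ultimately have "(q z + s * (\<sigma> - z)) / n \<le> integral {real k / n..x} (\<lambda>t. p (w t))"
        by simp
      moreover have "I x = I (real k / n) + integral {real k / n..x} (\<lambda>t. p (w t))"
        using n by (intro split) (auto simp: x_def divide_right_mono)
      moreover have "(q z + s * (\<sigma> - z)) / n = (q z - s * z) / n + s * (f y - f x)"
        using n by (simp add: \<sigma>_def field_simps)
      ultimately show ?thesis by (simp add: x_def y_def)
    qed
    define K where "K = (q z - s * z) / n"
    have ind: "real k * K + s * (f (real (k + 1) / n) - f (1 / n)) \<le> I (real k / n)"
      if "k + 1 \<le> n" for k
      using that
    proof (induction k)
      case 0
      then show ?case by (simp add: I_def)
    next
      case (Suc k)
      then show ?case using cell[of k] by (simp add: K_def[symmetric] algebra_simps)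
    qed
    define m where "m = n - 1"
    have m: "real m = real n - 1" "m + 1 \<le> n" "real (m + 1) / n = 1" using n by (auto simp: m_def)
    have "integral {real m / n..1} (\<lambda>t. c) \<le> integral {real m / n..1} (\<lambda>t. p (w t))"
      using p_ge by (intro integral_le int) auto
    moreover have "1 - real m / n = 1 / n" using n m by (simp add: field_simps)
    ultimately have "c / n \<le> integral {real m / n..1} (\<lambda>t. p (w t))" using m by simp
    moreover have "I 1 = I (real m / n) + integral {real m / n..1} (\<lambda>t. p (w t))"
      using m n by (intro split) auto
    moreover have "s * z \<le> s * (f 1 - f (1 / n))"
      using f_le[of 1] fm[of 0 "1 / n"] f0 n s(1) by (intro mult_left_mono_neg) auto
    ultimately have "real m * K + s * z + c / n \<le> I 1"
      using ind[OF m(2)] m(3) by simp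
    moreover have "real m * K = (q z - s * z) - (q z - s * z) / n"
      using n by (simp add: m K_def field_simps)
    ultimately show ?thesis by (simp add: diff_divide_distrib)
  qed
  have "(\<lambda>n. q z - (q z - s * z - c) / real n) \<longlonglongrightarrow> q z - 0"
    by (intro tendsto_intros lim_const_over_n)
  then have "q z - 0 \<le> I 1"
    by (rule LIMSEQ_le_const2) (use main in blast)
  then show ?thesis using \<open>I 1 = res f\<close> by simp
qed

lemma res_two_slope_gap:
  assumes "0 \<le> a" "a < b" "q a = p a" "q b = p b" "{a<..<b} \<subseteq> gap" "h \<in> {a..b}"
  shows "res (two_slope_profile a b h) = q h"
  using res_two_slope[of a h b] q_affine_on_gap[of a b h] assms by auto

lemma res_attained:
  assumes "z \<ge> 0" obtains f where "f \<in> profiles z" "res f = q z"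
proof (cases "q z = p z")
  case True
  then show thesis using that[of "\<lambda>t. - z + z * t"] res_linear linear_profile[OF assms] by simp
next
  case False
  then have "z \<in> gap" using q_le_p[of z] assms by auto
  then obtain a b where "0 \<le> a" "a < z" "z < b" "q a = p a" "q b = p b" "{a<..<b} \<subseteq> gap"
    by (rule gap_neighbours)
  then show thesis
    by (intro that[of "two_slope_profile a b z"] two_slope_profile res_two_slope_gap) auto
qed

lemma INF_res:
  assumes "z \<ge> 0" shows "(INF f \<in> profiles z. res f) = q z"
proof -
  obtain f where f: "f \<in> profiles z" "res f = q z" using res_attained[OF assms] .
  show ?thesis
    by (rule cInf_eq_minimum) (use f res_ge in force)+
qed

end

section \<open>Splitting the length between front and rear\<close>

text \<open>\<open>m\<close> is the inflection point: \<open>p\<close> is strictly concave on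
  \<open>{0..m}\<close> and strictly convex afterwards, which leaves room for one gap only.\<close>

locale unimodal_drag_law = drag_law_first_gap +
  fixes m :: real
  assumes d_cont: "continuous_on UNIV d" and m_pos: "m > 0"
    and d_decreasing: "\<And>u v. 0 \<le> u \<Longrightarrow> u < v \<Longrightarrow> v \<le> m \<Longrightarrow> d v < d u"
    and d_increasing: "\<And>u v. m \<le> u \<Longrightarrow> u < v \<Longrightarrow> d u < d v"
begin

text \<open>If \<open>w\<close> did not exceed \<open>m\<close>, strict concavity would make the
  tangent at \<open>w\<close> steeper than the chord from 0, whereas the line supporting the
  envelope at \<open>w\<close> must not pass above \<open>p 0\<close>.\<close>

lemma w_gt_m: "m < w"
proof (rule ccontr)
  assume n: "\<not> m < w"
  obtain x where x: "0 < x" "x < w" "p w - p 0 = (w - 0) * d x"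
    using MVT2[OF w_pos, of p d] der by blast
  have "q w + d w * (0 - w) \<le> q 0"
    by (rule q_tangent[OF w_pos q_deriv_contact]) (use w_pos w_contact in auto)
  then have "w * d x \<le> w * d w" using x q_0 w_contact by (simp add: algebra_simps)
  moreover have "d w < d x" using d_decreasing x n by simp
  ultimately show False using w_pos by simp
qed

lemma p_tangent:
  assumes "m \<le> u" "m \<le> v" shows "p u + d u * (v - u) \<le> p v"
proof (cases u v rule: linorder_cases)
  case less
  obtain x where x: "u < x" "x < v" "p v - p u = (v - u) * d x"
    using MVT2[OF less, of p d] der by blast
  have "(v - u) * d u \<le> (v - u) * d x" using d_increasing[of u x] x assms by (intro mult_left_mono) auto
  then show ?thesis using x by (simp add: algebra_simps)
next
  case greater
  obtain x where x: "v < x" "x < u" "p u - p v = (u - v) * d x"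
    using MVT2[OF greater, of p d] der by blast
  have "(u - v) * d x \<le> (u - v) * d u" using d_increasing[of x u] x assms by (intro mult_left_mono) auto
  then show ?thesis using x by (simp add: algebra_simps)
qed simp

text \<open>The tangent of \<open>p\<close> at \<open>u\<close> lies below \<open>p\<close>: beyond
  \<open>w\<close> by convexity, and before \<open>w\<close> because it lies below the tangent at
  \<open>w\<close>, which is the first segment of the envelope.\<close>

lemma contact_beyond_w:
  assumes u: "w \<le> u" shows "q u = p u"
proof -
  have "p u + d u * (v - u) \<le> p v" if v: "v \<ge> 0" for v
  proof (cases "w \<le> v")
    case True
    then show ?thesis using p_tangent[of u v] u w_gt_m by simp
  next
    case False
    have "d w \<le> d u" using d_increasing[of w u] u w_gt_m by (cases "w = u") auto
    then have "d u * (v - w) \<le> d w * (v - w)" using False by (intro mult_right_mono_neg) auto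
    moreover have "p u + d u * (w - u) \<le> p w" using p_tangent[of u w] u w_gt_m by simp
    moreover have "p w + d w * (v - w) \<le> p v"
      using q_le_p[OF v] q_first[of v] q_first[of w] w_contact w_pos w_deriv v False
      by (simp add: algebra_simps)
    ultimately show ?thesis by (simp add: algebra_simps)
  qed
  then have "p u + d u * (u - u) \<le> q u" using u w_pos by (intro line_le_q) auto
  then show ?thesis using q_le_p[of u] u w_pos by simp
qed

lemma gap_eq: "gap = {0<..<w}"
proof (intro equalityI subsetI)
  fix u assume u: "u \<in> gap"
  then have "u \<noteq> 0" "\<not> w \<le> u" using q_0 contact_beyond_w by auto
  then show "u \<in> {0<..<w}" using u by auto
qed (use w_gap in blast)

lemma q_strict_convex:
  assumes "w \<le> x" "x < y" shows "q ((x + y) / 2) < (q x + q y) / 2"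
proof -
  define k where "k = (x + y) / 2"
  have k: "x < k" "k < y" "k - x = (y - x) / 2" "y - k = (y - x) / 2" using assms by (auto simp: k_def field_simps)
  obtain a where a: "x < a" "a < k" "p k - p x = (k - x) * d a"
    using MVT2[OF k(1), of p d] der by blast
  obtain b where b: "k < b" "b < y" "p y - p k = (y - k) * d b"
    using MVT2[OF k(2), of p d] der by blast
  have "d a < d b" using d_increasing[of a b] a b assms w_gt_m by simp
  then have "(y - x) / 2 * d a < (y - x) / 2 * d b" using assms by (intro mult_strict_left_mono) auto
  then have "p k - p x < p y - p k" unfolding a(3) b(3) k(3,4) .
  then show ?thesis using contact_beyond_w assms k by (simp add: k_def[symmetric] field_simps)
qed

text \<open>A derivative that stayed below \<open>s < 0\<close> would drive \<open>p\<close> below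
  its bound \<open>c\<close>. So \<open>d\<close> climbs to \<open>s\<close> from its value
  \<open>- B\<close> at \<open>w\<close>.\<close>

lemma d_attains:
  assumes s: "- B < s" "s < 0"
  obtains u where "u > w" "d u = s"
proof -
  have "\<exists>N>w. d N \<ge> s"
  proof (rule ccontr)
    assume "\<not> (\<exists>N>w. s \<le> d N)"
    then have lt: "d N < s" if "N > w" for N using that by force
    define n where "n = (p w - c + 1) / (- s)"
    have "n > 0" using p_ge[of w] s unfolding n_def by (intro divide_pos_pos) auto
    moreover have "n * s = - (p w - c + 1)" using s by (simp add: n_def)
    ultimately have n: "n > 0" "n * s = - (p w - c + 1)" by auto
    obtain x where x: "w < x" "x < w + n" "p (w + n) - p w = (w + n - w) * d x"
      using MVT2[of w "w + n" p d] n der by auto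
    have "n * d x \<le> n * s" using lt[of x] x n by (intro mult_left_mono) auto
    then have "p (w + n) \<le> c - 1" using x n by simp
    then show False using p_ge[of "w + n"] by simp
  qed
  then obtain N where N: "N > w" "s \<le> d N" by blast
  obtain u where u: "w \<le> u" "u \<le> N" "d u = s"
    using IVT'[of d w s N] N s w_deriv continuous_on_subset[OF d_cont] by auto
  then show thesis using that[of u] s w_deriv by (cases "u = w") auto
qed

end

locale two_faces =
  plus: unimodal_drag_law "pressure \<rho> 1" d1 c1 C1 w1 m +
  minus: drag_law_first_gap "pressure \<rho> (- 1)" d2 c2 C2 w2
  for \<rho> :: "real \<times> real \<Rightarrow> real" and d1 c1 C1 w1 m d2 c2 C2 w2 +
  assumes steeper: "\<And>u. u > 0 \<Longrightarrow> d1 u < d2 u"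
begin

text \<open>Over the first rear gap the rear pressure drops by \<open>minus.B * w2\<close>. The
  front pressure drops by more, but by at most \<open>plus.B * w2\<close>, since the first line of
  its envelope supports it.\<close>

lemma B_less: "minus.B < plus.B"
proof -
  let ?f = "\<lambda>u. pressure \<rho> 1 u - pressure \<rho> (- 1) u"
  have "?f w2 < ?f 0"
  proof (rule DERIV_neg_imp_decreasing_open[OF minus.w_pos])
    show "\<exists>y. (?f has_real_derivative y) (at x) \<and> y < 0" if "0 < x" for x
      using steeper[OF that] by (intro exI[of _ "d1 x - d2 x"]) (auto intro!: DERIV_diff plus.der minus.der)
    show "continuous_on {0..w2} ?f" by (intro continuous_intros plus.p_cont minus.p_cont)
  qed
  moreover have "pressure \<rho> 1 0 - plus.B * w2 \<le> pressure \<rho> 1 w2"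
    using plus.q_above_first_line[of w2] plus.q_le_p[of w2] minus.w_pos by simp
  moreover have "minus.B * w2 = pressure \<rho> (- 1) 0 - pressure \<rho> (- 1) w2"
    using minus.w_pos by (simp add: minus.B_def)
  ultimately have "minus.B * w2 < plus.B * w2" by simp
  then show ?thesis using minus.w_pos by simp
qed

lemma us_exists: obtains us where "us > w1" "d1 us = - minus.B"
  using plus.d_attains[of "- minus.B"] B_less minus.B_pos by auto

definition "split h z = plus.q z + minus.q (h - z)"

text \<open>Strict minimality is built in, so every optimality proof settles uniqueness as
  well.\<close>

definition "optimal h z \<longleftrightarrow> z \<in> {0..h} \<and> (\<forall>y\<in>{0..h}. y \<noteq> z \<longrightarrow> split h z < split h y)"

lemma optimal_unique: "optimal h y \<Longrightarrow> optimal h z \<Longrightarrow> y = z"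
  unfolding optimal_def by fastforce

text \<open>If \<open>x\<close> lies on the first segment of the front, moving length to the front
  gains at rate \<open>plus.B\<close> and costs at most \<open>minus.B\<close>. Otherwise both
  points lie where the front envelope is strictly convex, and their midpoint is better.\<close>

lemma minimizers_eq:
  assumes xy: "x \<in> {0..h}" "y \<in> {0..h}" "x < y"
    and min: "\<And>z. z \<in> {0..h} \<Longrightarrow> split h x \<le> split h z" and eq: "split h x = split h y"
  shows False
proof (cases "x < w1")
  case True
  define z where "z = min y w1"
  have z: "x < z" "z \<le> w1" "z \<in> {0..h}" using True xy by (auto simp: z_def)
  have "plus.q z = plus.q x - plus.B * (z - x)"
    using plus.q_first[of x] plus.q_first[of z] xy z by (simp add: algebra_simps)
  moreover have "minus.q (h - z) - minus.B * ((h - x) - (h - z)) \<le> minus.q (h - x)"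
    using z by (intro minus.q_steepest) auto
  moreover have "minus.B * (z - x) < plus.B * (z - x)" using B_less z by simp
  ultimately have "split h z < split h x" by (simp add: split_def)
  then show False using min[OF z(3)] by simp
next
  case False
  define z where "z = (x + y) / 2"
  have z: "z \<in> {0..h}" using xy by (auto simp: z_def)
  have "plus.q z < (plus.q x + plus.q y) / 2"
    unfolding z_def using plus.q_strict_convex False xy by simp
  moreover have "minus.q (h - z) \<le> (minus.q (h - x) + minus.q (h - y)) / 2"
  proof -
    have "h - z = (1 - 1/2) *\<^sub>R (h - x) + (1/2) *\<^sub>R (h - y)" by (simp add: z_def field_simps)
    then have "minus.q (h - z) \<le> (1 - 1/2) * minus.q (h - x) + 1/2 * minus.q (h - y)"
      using convex_onD[OF minus.q_convex, of "1/2" "h - x" "h - y"] xy by simp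
    then show ?thesis by (simp add: add_divide_distrib)
  qed
  ultimately have "split h z < (split h x + split h y) / 2" by (simp add: split_def)
  then show False using min[OF z] eq by simp
qed

text \<open>The two supporting lines of slope \<open>s\<close> add up to a bound that is the same
  for every splitting of \<open>h\<close>; ties are excluded by
  \<open>minimizers_eq\<close>.\<close>

lemma optimalI:
  assumes z: "z \<in> {0..h}"
    and 1: "\<And>u. u \<in> {0..h} \<Longrightarrow> plus.q z + s * (u - z) \<le> plus.q u"
    and 2: "\<And>u. u \<in> {0..h} \<Longrightarrow> minus.q (h - z) + s * (u - (h - z)) \<le> minus.q u"
  shows "optimal h z"
proof -
  have min: "split h z \<le> split h y" if "y \<in> {0..h}" for y
    using 1[OF that] 2[of "h - y"] that by (simp add: split_def algebra_simps)
  have "split h z < split h y" if y: "y \<in> {0..h}" "y \<noteq> z" for y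
  proof (rule ccontr)
    assume "\<not> split h z < split h y"
    then have eq: "split h z = split h y" using min[OF y(1)] by simp
    show False
    proof (cases "z < y")
      case True
      show False by (rule minimizers_eq[OF z y(1) True min eq])
    next
      case False
      then have "y < z" using y by simp
      then show False by (rule minimizers_eq[OF y(1) z]) (use min eq in simp_all)
    qed
  qed
  then show ?thesis using z by (simp add: optimal_def)
qed

lemma optimal_of_equal_slopes:
  assumes "0 < a" "0 < b" "(plus.q has_real_derivative D) (at a)" "(minus.q has_real_derivative D) (at b)"
  shows "optimal (a + b) a"
proof (rule optimalI)
  show "plus.q a + D * (u - a) \<le> plus.q u" if "u \<in> {0..a + b}" for u
    using plus.q_tangent[OF assms(1,3)] that by simp
  show "minus.q (a + b - a) + D * (u - (a + b - a)) \<le> minus.q u" if "u \<in> {0..a + b}" for u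
    using minus.q_tangent[OF assms(2,4)] that by simp
qed (use assms in auto)

lemma split_resistance_eq: "z \<in> {0..h} \<Longrightarrow> split_resistance \<rho> h z = split h z"
  using plus.INF_res[of z] minus.INF_res[of "h - z"]
  by (simp add: split_resistance_def inf_resistance_def resistance_def split_def plus.res_def minus.res_def)

lemma optimal_arg_min:
  assumes "optimal h z" shows "is_arg_min (split_resistance \<rho> h) (\<lambda>z. z \<in> {0..h}) y \<longleftrightarrow> y = z"
  using assms split_resistance_eq unfolding is_arg_min_def optimal_def
  by (smt (verit, best))

lemma h_plus_optimal: "optimal h z \<Longrightarrow> h_plus \<rho> h = z"
  unfolding h_plus_def arg_min_on_def arg_min_def
  by (rule some_equality) (simp_all only: optimal_arg_min)

lemma h_minus_optimal: "optimal h z \<Longrightarrow> h_minus \<rho> h = h - z"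
  by (simp add: h_minus_def h_plus_optimal)

text \<open>The bound \<open>res_ge\<close> on both faces reduces each competing body to its
  splitting of the length.\<close>

lemma optimal_attains:
  assumes z: "optimal h z" and f: "f \<in> profiles z" "plus.res f = plus.q z"
    and g: "g \<in> profiles (h - z)" "minus.res g = minus.q (h - z)"
  shows "attains_minimum \<rho> h f g"
    and "minimal_resistance \<rho> h = plus.q z + minus.q (h - z)"
proof -
  have fg: "(f, g) \<in> bodies h" using z f g
    unfolding bodies_def optimal_def by (force intro: exI[of _ z] exI[of _ "h - z"])
  have t: "total_resistance \<rho> x = plus.res (fst x) + minus.res (snd x)" for x
    by (simp add: total_resistance_def resistance_def plus.res_def minus.res_def)
  have low: "split h z \<le> total_resistance \<rho> x" if "x \<in> bodies h" for x
  proof -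
    from that obtain f g y where y: "x = (f, g)" "0 \<le> y" "y \<le> h" "f \<in> profiles y" "g \<in> profiles (h - y)"
      by (force simp: bodies_def)
    have "split h z \<le> split h y" using z y by (cases "y = z") (auto simp: optimal_def intro: less_imp_le)
    also have "\<dots> \<le> total_resistance \<rho> x"
      using plus.res_ge[OF y(4)] minus.res_ge[OF y(5)] y(1) by (simp add: t split_def)
    finally show ?thesis .
  qed
  have tot: "total_resistance \<rho> (f, g) = split h z" using f g by (simp add: t split_def)
  have "minimal_resistance \<rho> h = split h z"
    unfolding minimal_resistance_def by (rule cInf_eq_minimum) (use fg tot low in force)+
  then show "minimal_resistance \<rho> h = plus.q z + minus.q (h - z)" "attains_minimum \<rho> h f g"
    using fg tot low by (auto simp: attains_minimum_def split_def)
qed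

lemma minimal_resistance_optimal:
  assumes z: "optimal h z" shows "minimal_resistance \<rho> h = plus.q z + minus.q (h - z)"
proof -
  have z0: "0 \<le> z" "0 \<le> h - z" using z by (auto simp: optimal_def)
  obtain f where "f \<in> profiles z" "plus.res f = plus.q z" using plus.res_attained[OF z0(1)] .
  moreover obtain g where "g \<in> profiles (h - z)" "minus.res g = minus.q (h - z)"
    using minus.res_attained[OF z0(2)] .
  ultimately show ?thesis using optimal_attains(2)[OF z] by blast
qed

lemma gap_sets: "gap_set \<rho> 1 = {u. 0 \<le> u \<and> plus.q u < pressure \<rho> 1 u}"
  "gap_set \<rho> (- 1) = {u. 0 \<le> u \<and> minus.q u < pressure \<rho> (- 1) u}"
  by (auto simp: gap_set_def pbar_def)

lemma u0_plus_eq: "u0_plus \<rho> = w1"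
  unfolding u0_plus_def gap_sets plus.gap_eq
proof (rule the_equality)
  fix u assume u: "0 < u \<and> {0<..<w1} = {0<..<u}"
  then have "Sup {0<..<u} = Sup {0<..<w1}" by simp
  then show "u = w1" using conjunct1[OF u] plus.w_pos by (simp only: cSup_greaterThanLessThan)
qed (simp add: plus.w_pos)

lemma first_component: "{0<..<w2} \<in> components (gap_set \<rho> (- 1))"
  unfolding gap_sets
  using minus.gap_component[of 0 w2] minus.w_pos minus.w_contact minus.w_gap minus.q_0 by auto

lemma u0_minus_eq: "u0_minus \<rho> = w2"
  unfolding u0_minus_def
proof (rule the_equality)
  show "0 < w2 \<and> {0<..<w2} \<in> components (gap_set \<rho> (- 1))"
    using first_component minus.w_pos by simp
  fix u assume "0 < u \<and> {0<..<u} \<in> components (gap_set \<rho> (- 1))"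
  then show "u = w2" unfolding gap_sets by (intro minus.component_with_left_end_0) simp_all
qed

lemma slope_B_eq: "slope_B \<rho> 1 = plus.B" "slope_B \<rho> (- 1) = minus.B"
proof -
  have nt: "at 0 within {0::real..} \<noteq> bot" by (simp add: at_within_Ici_at_right)
  show "slope_B \<rho> 1 = plus.B"
    using vector_derivative_within[OF nt plus.q_deriv_0[unfolded has_real_derivative_iff_has_vector_derivative]]
    by (simp add: slope_B_def pbar_def)
  show "slope_B \<rho> (- 1) = minus.B"
    using vector_derivative_within[OF nt minus.q_deriv_0[unfolded has_real_derivative_iff_has_vector_derivative]]
    by (simp add: slope_B_def pbar_def)
qed

lemma is_u_star_iff:
  assumes us: "us > w1" "d1 us = - minus.B"
  shows "is_u_star \<rho> u \<longleftrightarrow> u = us"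
proof
  assume "is_u_star \<rho> u"
  then have u: "u > w1" "(pressure \<rho> 1 has_real_derivative - minus.B) (at u)"
    by (auto simp: is_u_star_def u0_plus_eq slope_B_eq)
  then have "d1 u = d1 us" using DERIV_unique[OF plus.der] us by simp
  then show "u = us"
    using plus.d_increasing[of u us] plus.d_increasing[of us u] u us plus.w_gt_m
    by (cases u us rule: linorder_cases) auto
next
  assume "u = us"
  then show "is_u_star \<rho> u"
    using us plus.q_deriv_contact[of us] plus.contact_beyond_w[of us] plus.der[of us] plus.w_pos
    by (simp add: is_u_star_def u0_plus_eq slope_B_eq pbar_def)
qed

end

section \<open>The optimal splitting of each length\<close>

locale two_faces_star = two_faces +
  fixes us :: real
  assumes us_gt: "us > w1" and us_slope: "d1 us = - minus.B"
begin

lemma u_star_eq: "u_star \<rho> = us"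
  unfolding u_star_def by (rule the_equality) (simp_all add: is_u_star_iff[OF us_gt us_slope])

lemma us_pos: "us > 0" using us_gt plus.w_pos by simp

lemma q_plus_deriv: "u \<ge> w1 \<Longrightarrow> (plus.q has_real_derivative d1 u) (at u)"
  using plus.q_deriv_contact plus.contact_beyond_w plus.w_pos by simp

text \<open>The common slope is \<open>- minus.B\<close>, which supports the rear at length 0. The
  front is at least as steep at \<open>h\<close>, but only lengths \<open>u \<le> h\<close> compete,
  and to the left of \<open>h\<close> a flatter line still supports.\<close>

lemma optimal_short:
  assumes h: "0 < h" "h \<le> us" shows "optimal h h"
proof (rule optimalI)
  have "\<exists>D \<le> - minus.B. (plus.q has_real_derivative D) (at h)"
  proof (cases "h < w1")
    case True
    then show ?thesis using plus.q_deriv_first[of h] h B_less by (intro exI[of _ "- plus.B"]) auto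
  next
    case False
    then have "d1 h \<le> d1 us"
      using plus.d_increasing[of h us] h plus.w_gt_m by (cases "h = us") auto
    then show ?thesis using q_plus_deriv[of h] False us_slope by (intro exI[of _ "d1 h"]) auto
  qed
  then obtain D where D: "D \<le> - minus.B" "(plus.q has_real_derivative D) (at h)" by blast
  show "plus.q h + - minus.B * (u - h) \<le> plus.q u" if "u \<in> {0..h}" for u
    using plus.q_tangent[OF h(1) D(2), of u] mult_right_mono_neg[OF D(1), of "u - h"] that by simp
  show "minus.q (h - h) + - minus.B * (u - (h - h)) \<le> minus.q u" if "u \<in> {0..h}" for u
    using minus.q_above_first_line[of u] minus.q_0 that by simp
qed (use h in auto)

text \<open>At \<open>us\<close> the front has the slope of the first rear segment, so extra length
  goes to the rear until that segment is used up.\<close>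

lemma optimal_medium:
  assumes h: "us < h" "h < us + w2" shows "optimal h us"
proof -
  have "optimal (us + (h - us)) us"
    using h us_pos us_slope q_plus_deriv[of us] us_gt minus.q_deriv_first[of "h - us"]
    by (intro optimal_of_equal_slopes) auto
  then show ?thesis by simp
qed

text \<open>An interior minimizer of \<open>split h\<close> on \<open>{us..h - w2}\<close> has equal
  slopes. At an end, minimality gives only one inequality; the other holds because
  \<open>- minus.B\<close> is the front slope at \<open>us\<close>, the rear slope at
  \<open>w2\<close> and the steepest rear slope.\<close>

lemma long_equal_slopes:
  assumes h: "us + w2 \<le> h"
  obtains z where "us \<le> z" "w2 \<le> h - z" "(minus.q has_real_derivative d1 z) (at (h - z))"
proof -
  have w2: "w2 > 0" by (rule minus.w_pos)
  have "continuous_on {us..h - w2} (split h)"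
    unfolding split_def
    by (intro continuous_intros continuous_on_compose2[OF plus.q_cont] continuous_on_compose2[OF minus.q_cont])
       (use us_pos w2 in auto)
  then obtain z where z: "z \<in> {us..h - w2}" "\<And>y. y \<in> {us..h - w2} \<Longrightarrow> split h z \<le> split h y"
    using continuous_attains_inf[of "{us..h - w2}" "split h"] h by auto
  have hz: "h - z > 0" using z w2 by simp
  obtain D where D: "(minus.q has_real_derivative D) (at (h - z))" using minus.q_differentiable[OF hz] .
  have Q: "(plus.q has_real_derivative d1 z) (at z)" using q_plus_deriv[of z] z us_gt by simp
  have der: "(split h has_real_derivative d1 z - D) (at z)"
  proof -
    have "((\<lambda>z. minus.q (h - z)) has_real_derivative D * (- 1)) (at z)"
      by (rule DERIV_chain2[where f = minus.q and g = "\<lambda>z. h - z", OF D]) (auto intro!: derivative_eq_intros)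
    then show ?thesis unfolding split_def using DERIV_add[OF Q] by fastforce
  qed
  have le: "d1 z \<le> D"
  proof (cases "z = us")
    case True
    then show ?thesis using minus.q_deriv_ge[OF hz D] us_slope by simp
  next
    case False
    show ?thesis
    proof (rule ccontr)
      assume "\<not> d1 z \<le> D"
      then obtain e where e: "e > 0" "\<And>r. 0 < r \<Longrightarrow> r < e \<Longrightarrow> split h (z - r) < split h z"
        using DERIV_pos_inc_left[OF der] by auto
      define r where "r = min (e / 2) (z - us)"
      have "0 < r" "r < e" "z - r \<in> {us..h - w2}" using e z False by (auto simp: r_def)
      then show False using e(2)[of r] z(2)[of "z - r"] by simp
    qed
  qed
  have ge: "D \<le> d1 z"
  proof (cases "z = h - w2")
    case True
    have "h - z = w2" using True by simp
    then have "D = - minus.B"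
      using DERIV_unique[OF D] minus.q_deriv_contact[of w2] w2 minus.w_contact minus.w_deriv by simp
    moreover have "d1 us \<le> d1 z"
      using plus.d_increasing[of us z] z us_gt plus.w_gt_m by (cases "z = us") auto
    ultimately show ?thesis using us_slope by simp
  next
    case False
    show ?thesis
    proof (rule ccontr)
      assume "\<not> D \<le> d1 z"
      then obtain e where e: "e > 0" "\<And>r. 0 < r \<Longrightarrow> r < e \<Longrightarrow> split h (z + r) < split h z"
        using DERIV_neg_dec_right[OF der] by auto
      define r where "r = min (e / 2) (h - w2 - z)"
      have "0 < r" "r < e" "z + r \<in> {us..h - w2}" using e z False by (auto simp: r_def)
      then show False using e(2)[of r] z(2)[of "z + r"] by simp
    qed
  qed
  from le ge D have "(minus.q has_real_derivative d1 z) (at (h - z))" by simp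
  then show thesis using that[of z] z by auto
qed

lemma optimal_long:
  assumes "us \<le> z" "w2 \<le> h - z" "(minus.q has_real_derivative d1 z) (at (h - z))"
  shows "optimal h z"
  using optimal_of_equal_slopes[of z "h - z" "d1 z"] assms q_plus_deriv[of z] us_gt us_pos minus.w_pos
  by simp

lemma balanced_optimal:
  assumes "balanced \<rho> h a b" shows "optimal h a" "b = h - a"
proof -
  obtain D where D: "a + b = h" "(pressure \<rho> 1 has_real_derivative D) (at a)"
    "(minus.q has_real_derivative D) (at b)" "w1 \<le> a" "w2 \<le> b"
    using assms by (auto simp: balanced_def u0_plus_eq u0_minus_eq pbar_def)
  have "d1 a = D" using DERIV_unique[OF plus.der D(2)] .
  then show "optimal h a"
    using optimal_of_equal_slopes[of a b D] q_plus_deriv[of a] D plus.w_pos minus.w_pos by auto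
qed (use assms in \<open>auto simp: balanced_def\<close>)

lemma optimal_exists:
  assumes "h > 0" obtains z where "optimal h z"
proof -
  consider "h \<le> us" | "us < h" "h < us + w2" | "us + w2 \<le> h" by linarith
  then show thesis
  proof cases
    case 3
    then obtain z where "us \<le> z" "w2 \<le> h - z" "(minus.q has_real_derivative d1 z) (at (h - z))"
      by (rule long_equal_slopes)
    then show thesis using optimal_long that by blast
  qed (use that optimal_short optimal_medium assms in blast)+
qed

lemma long_body:
  assumes "us + w2 \<le> h"
  shows "us \<le> h_plus \<rho> h" "w2 \<le> h_minus \<rho> h" "optimal h (h_plus \<rho> h)"
    "(minus.q has_real_derivative d1 (h_plus \<rho> h)) (at (h_minus \<rho> h))"
proof -
  obtain z where z: "us \<le> z" "w2 \<le> h - z" "(minus.q has_real_derivative d1 z) (at (h - z))"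
    using long_equal_slopes[OF assms] .
  then have o: "optimal h z" by (rule optimal_long)
  then show "us \<le> h_plus \<rho> h" "w2 \<le> h_minus \<rho> h" "optimal h (h_plus \<rho> h)"
    "(minus.q has_real_derivative d1 (h_plus \<rho> h)) (at (h_minus \<rho> h))"
    using z h_plus_optimal[OF o] h_minus_optimal[OF o] by auto
qed

text \<open>
  Inside a gap of \<open>minus.q\<close> the slope, hence the optimal \<open>h_plus\<close>, does not depend on \<open>h\<close>.
\<close>

lemma open_case_4b: "open (case_4b \<rho>)"
  unfolding open_contains_ball
proof
  fix h assume "h \<in> case_4b \<rho>"
  then have h: "us + w2 \<le> h" and hg: "h_minus \<rho> h \<in> {u. 0 \<le> u \<and> minus.q u < pressure \<rho> (- 1) u}"
    by (auto simp: case_4b_def u_star_eq u0_minus_eq gap_sets)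
  define z where "z = h_plus \<rho> h"
  have z: "us \<le> z" "w2 \<le> h - z" "(minus.q has_real_derivative d1 z) (at (h - z))"
    using long_body[OF h] by (auto simp: z_def h_minus_def)
  obtain a b where ab: "0 \<le> a" "a < h - z" "h - z < b" "minus.q a = pressure \<rho> (- 1) a"
    "minus.q b = pressure \<rho> (- 1) b" "{a<..<b} \<subseteq> {u. 0 \<le> u \<and> minus.q u < pressure \<rho> (- 1) u}"
    using minus.gap_neighbours[OF hg] unfolding h_minus_def z_def by blast
  have "w2 \<le> a"
  proof (rule ccontr)
    assume "\<not> w2 \<le> a"
    then have "w2 \<in> {a<..<b}" using z ab by auto
    then have "minus.q w2 < pressure \<rho> (- 1) w2" using ab(6) by blast
    then show False using minus.w_contact by simp
  qed
  have slope: "(minus.q b - minus.q a) / (b - a) = d1 z"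
    using DERIV_unique[OF minus.q_deriv_gap[of a b "h - z"] z(3)] ab by auto
  have "h' \<in> case_4b \<rho>" if h': "h' - z \<in> {a<..<b}" for h'
  proof -
    have "(minus.q has_real_derivative d1 z) (at (h' - z))"
      using minus.q_deriv_gap[of a b "h' - z"] ab h' slope by auto
    then have "optimal h' z" using z h' \<open>w2 \<le> a\<close> by (intro optimal_long) auto
    then have "h_minus \<rho> h' = h' - z" by (rule h_minus_optimal)
    moreover have "h' - z \<in> {u. 0 \<le> u \<and> minus.q u < pressure \<rho> (- 1) u}" using h' ab(6) by blast
    moreover have "us + w2 \<le> h'" using z h' \<open>w2 \<le> a\<close> by auto
    ultimately show ?thesis by (simp add: case_4b_def u_star_eq u0_minus_eq gap_sets)
  qed
  then have "ball h (min (h - z - a) (b - (h - z))) \<subseteq> case_4b \<rho>"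
    by (auto simp: dist_real_def abs_if split: if_splits)
  then show "\<exists>e>0. ball h e \<subseteq> case_4b \<rho>" using ab by (intro exI[of _ "min (h - z - a) (b - (h - z))"]) auto
qed

text \<open>The rear of a long body has length at least \<open>w2\<close>, and \<open>w2\<close>
  itself is a contact point, hence outside the gaps.\<close>

lemma case_4b_subset: "case_4b \<rho> \<subseteq> {us + w2<..}"
proof
  fix h assume "h \<in> case_4b \<rho>"
  then have h: "us + w2 \<le> h" and hg: "minus.q (h_minus \<rho> h) < pressure \<rho> (- 1) (h_minus \<rho> h)"
    by (auto simp: case_4b_def u_star_eq u0_minus_eq gap_sets)
  have "h_minus \<rho> h \<noteq> w2" using hg minus.w_contact by auto
  then show "h \<in> {us + w2<..}" using long_body[OF h] by (simp add: h_minus_def)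
qed

text \<open>The problem read backwards: the rear slope at \<open>b\<close> lies between
  \<open>- minus.B\<close> and 0, and the derivative of the front attains each such value. This
  produces bodies with a chosen rear, in a gap or at a contact point as desired.\<close>

lemma optimal_for_prescribed_rear:
  assumes b: "b \<ge> w2"
  obtains a where "a \<ge> us" "optimal (a + b) a"
proof -
  have bp: "b > 0" using b minus.w_pos by simp
  obtain D where D: "(minus.q has_real_derivative D) (at b)" using minus.q_differentiable[OF bp] .
  \<comment> \<open>Beyond \<open>b\<close> there is a contact point, and the envelope is strictly
    lower there.\<close>
  have "D < 0"
  proof -
    obtain b' where b': "b' > b" "minus.q b' = pressure \<rho> (- 1) b'"
    proof (cases "minus.q b = pressure \<rho> (- 1) b")
      case True
      then show thesis using minus.gap_bounded_right[of b] bp that by auto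
    next
      case False
      then have "b \<in> {u. 0 \<le> u \<and> minus.q u < pressure \<rho> (- 1) u}"
        using minus.q_le_p[of b] bp by auto
      then show thesis using minus.gap_neighbours[of b thesis] that by blast
    qed
    have b'p: "b' > 0" using b' bp by simp
    have "minus.q b + D * (b' - b) \<le> minus.q b'" using minus.q_tangent[OF bp D] b'p by simp
    moreover have "minus.q b' < minus.q b"
    proof -
      have t: "minus.q b' + d2 b' * (b - b') \<le> minus.q b"
        using minus.q_tangent[OF b'p minus.q_deriv_contact] b'p b'(2) bp by simp
      have "d2 b' * (b - b') > 0" using minus.d_neg[OF b'p] b' by (simp add: mult_neg_neg)
      then show ?thesis using t by simp
    qed
    ultimately have "D * (b' - b) < 0" by simp
    then show ?thesis using b' by (simp add: mult_less_0_iff)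
  qed
  have "- minus.B \<le> D" by (rule minus.q_deriv_ge[OF bp D])
  then have "- plus.B < D" using B_less by simp
  then obtain a where a: "a > w1" "d1 a = D" using plus.d_attains \<open>D < 0\<close> by blast
  have "a \<ge> us"
  proof (rule ccontr)
    assume "\<not> a \<ge> us"
    then have "d1 a < d1 us" using plus.d_increasing[of a us] a plus.w_gt_m by simp
    then show False using a us_slope \<open>- minus.B \<le> D\<close> by simp
  qed
  moreover have "optimal (a + b) a"
    using optimal_of_equal_slopes[of a b D] a q_plus_deriv[of a] D bp plus.w_pos by simp
  ultimately show thesis using that by blast
qed

text \<open>Take a contact point beyond \<open>w2\<close> as the rear length.\<close>

lemma case_4b_complement: "{us + w2<..} - case_4b \<rho> \<noteq> {}"
proof -
  obtain b where b: "b > w2" "minus.q b = pressure \<rho> (- 1) b"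
    using minus.gap_bounded_right[of w2] minus.w_pos minus.w_contact by auto
  obtain a where a: "a \<ge> us" "optimal (a + b) a" using optimal_for_prescribed_rear[of b] b by auto
  then have "a + b \<in> {us + w2<..} - case_4b \<rho>"
    using b h_minus_optimal[OF a(2)] by (auto simp: case_4b_def gap_sets)
  then show ?thesis by blast
qed

lemma case_4b_nonempty:
  assumes "b \<in> gap_set \<rho> (- 1)" "b \<ge> w2" shows "case_4b \<rho> \<noteq> {}"
proof -
  obtain a where a: "a \<ge> us" "optimal (a + b) a" using optimal_for_prescribed_rear assms by blast
  then have "a + b \<in> case_4b \<rho>"
    using assms h_minus_optimal[OF a(2)] by (auto simp: case_4b_def u_star_eq u0_minus_eq)
  then show ?thesis by blast
qed

end

section \<open>Half-plane moments of a radial density\<close>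

text \<open>Serves to differentiate the moments without interchanging derivative and integral: chord
  bounds follow by integrating pointwise inequalities, and continuity of \<open>g\<close> does the
  rest.\<close>

lemma deriv_of_chord_bounds:
  fixes f g :: "real \<Rightarrow> real"
  assumes bounds: "\<And>s t. s < t \<Longrightarrow> (t - s) * g s \<le> f t - f s \<and> f t - f s \<le> (t - s) * g t"
    and cont: "isCont g x"
  shows "(f has_real_derivative g x) (at x)"
proof -
  have "((\<lambda>t. (f t - f x) / (t - x) - g x) \<longlongrightarrow> 0) (at x)"
  proof (rule Lim_null_comparison)
    have "\<forall>\<^sub>F t in at x. t \<noteq> x" by (simp add: eventually_at_filter)
    then show "\<forall>\<^sub>F t in at x. norm ((f t - f x) / (t - x) - g x) \<le> \<bar>g t - g x\<bar>"
    proof eventually_elim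
      case (elim t)
      consider "t < x" | "x < t" using elim by linarith
      then show ?case
      proof cases
        case 1
        have "g t \<le> (f t - f x) / (t - x)" "(f t - f x) / (t - x) \<le> g x"
          using bounds[OF 1] 1 by (simp_all add: field_simps)
        then show ?thesis by simp
      next
        case 2
        have "g x \<le> (f t - f x) / (t - x)" "(f t - f x) / (t - x) \<le> g t"
          using bounds[OF 2] 2 by (simp_all add: field_simps)
        then show ?thesis by simp
      qed
    qed
    show "((\<lambda>t. \<bar>g t - g x\<bar>) \<longlongrightarrow> 0) (at x)"
      using cont by (intro tendsto_rabs_zero LIM_zero) (simp add: isCont_def)
  qed
  then show ?thesis by (simp add: has_field_derivative_iff LIM_zero_iff)
qed

section \<open>Fubini and rotations in the plane\<close>

abbreviation plane :: "(real \<times> real) measure" where "plane \<equiv> lborel"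

lemma fst_snd_borel [measurable]:
  "(fst :: real \<times> real \<Rightarrow> real) \<in> borel_measurable borel"
  "(snd :: real \<times> real \<Rightarrow> real) \<in> borel_measurable borel"
  by (intro borel_measurable_continuous_onI continuous_intros)+

lemma nn_integral_lborel_pair:
  fixes f :: "real \<times> real \<Rightarrow> ennreal"
  assumes [measurable]: "f \<in> borel_measurable borel"
  shows "(\<integral>\<^sup>+v. f v \<partial>lborel) = (\<integral>\<^sup>+x. \<integral>\<^sup>+y. f (x, y) \<partial>lborel \<partial>lborel)"
    and "(\<integral>\<^sup>+v. f v \<partial>lborel) = (\<integral>\<^sup>+y. \<integral>\<^sup>+x. f (x, y) \<partial>lborel \<partial>lborel)"
proof -
  have f: "f \<in> borel_measurable (lborel \<Otimes>\<^sub>M lborel)" by (simp add: lborel_prod)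
  show "(\<integral>\<^sup>+v. f v \<partial>lborel) = (\<integral>\<^sup>+x. \<integral>\<^sup>+y. f (x, y) \<partial>lborel \<partial>lborel)"
    using lborel.nn_integral_fst[OF f] by (simp add: lborel_prod)
  show "(\<integral>\<^sup>+v. f v \<partial>lborel) = (\<integral>\<^sup>+y. \<integral>\<^sup>+x. f (x, y) \<partial>lborel \<partial>lborel)"
    using lborel_pair.nn_integral_snd[OF f] by (simp add: lborel_prod)
qed

text \<open>The rotation is done one coordinate at a time, through the mixed coordinates (new
  abscissa, old ordinate). Both substitutions are affine bijections because
  \<open>a \<noteq> 0\<close>, and their factors \<open>\<bar>a\<bar>\<close> and
  \<open>\<bar>1 / a\<bar>\<close> cancel.\<close>

lemma nn_integral_rotation:
  fixes f :: "real \<times> real \<Rightarrow> ennreal"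
  assumes [measurable]: "f \<in> borel_measurable borel" and a: "a \<noteq> 0" and ab: "a\<^sup>2 + b\<^sup>2 = 1"
  shows "(\<integral>\<^sup>+v. f (a * fst v - b * snd v, b * fst v + a * snd v) \<partial>lborel) = (\<integral>\<^sup>+v. f v \<partial>lborel)"
proof -
  let ?g = "\<lambda>X y. f (X, b / a * X + y / a)"
  have 1: "(\<integral>\<^sup>+X. ?g X y \<partial>lborel) = \<bar>a\<bar> * (\<integral>\<^sup>+x. f (a * x - b * y, b * x + a * y) \<partial>lborel)" for y
  proof -
    have "(\<integral>\<^sup>+X. ?g X y \<partial>lborel) = \<bar>a\<bar> * (\<integral>\<^sup>+x. ?g (- b * y + a * x) y \<partial>lborel)"
      by (rule nn_integral_real_affine[OF _ a]) measurable
    also have "(\<lambda>x. ?g (- b * y + a * x) y) = (\<lambda>x. f (a * x - b * y, b * x + a * y))"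
    proof
      fix x
      have "y = (a\<^sup>2 + b\<^sup>2) * y" using ab by simp
      then have "b / a * (- b * y + a * x) + y / a = b * x + a * y"
        using a by (simp add: field_simps power2_eq_square)
      then show "?g (- b * y + a * x) y = f (a * x - b * y, b * x + a * y)" by simp
    qed
    finally show ?thesis .
  qed
  have 2: "(\<integral>\<^sup>+Y. f (X, Y) \<partial>lborel) = \<bar>1 / a\<bar> * (\<integral>\<^sup>+y. ?g X y \<partial>lborel)" for X
    using nn_integral_real_affine[of "\<lambda>Y. f (X, Y)" "1 / a" "b / a * X"] a by simp
  have inv: "ennreal \<bar>1 / a\<bar> * (ennreal \<bar>a\<bar> * x) = x" for x
    using a by (simp add: mult.assoc[symmetric] ennreal_mult[symmetric] flip: abs_mult)
  have g: "(\<lambda>v. ?g (fst v) (snd v)) \<in> borel_measurable borel"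
    by (rule measurable_compose[OF _ assms(1)], rule borel_measurable_continuous_onI)
       (intro continuous_intros a ballI)
  have "(\<integral>\<^sup>+v. f v \<partial>lborel) = (\<integral>\<^sup>+X. \<bar>1 / a\<bar> * (\<integral>\<^sup>+y. ?g X y \<partial>lborel) \<partial>lborel)"
    by (simp add: nn_integral_lborel_pair(1) 2)
  also have "\<dots> = \<bar>1 / a\<bar> * (\<integral>\<^sup>+X. \<integral>\<^sup>+y. ?g X y \<partial>lborel \<partial>lborel)"
    by (rule nn_integral_cmult) measurable
  also have "\<dots> = \<bar>1 / a\<bar> * (\<integral>\<^sup>+y. \<integral>\<^sup>+X. ?g X y \<partial>lborel \<partial>lborel)"
    using nn_integral_lborel_pair[OF g] by simp
  also have "\<dots> = \<bar>1 / a\<bar> * (\<bar>a\<bar> * (\<integral>\<^sup>+y. \<integral>\<^sup>+x. f (a * x - b * y, b * x + a * y) \<partial>lborel \<partial>lborel))"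
    unfolding 1 by (subst nn_integral_cmult) measurable
  also have "\<dots> = (\<integral>\<^sup>+v. f (a * fst v - b * snd v, b * fst v + a * snd v) \<partial>lborel)"
    unfolding inv by (subst nn_integral_lborel_pair(2)) simp_all
  finally show ?thesis by simp
qed

locale radial_density =
  fixes \<sigma> :: "real \<Rightarrow> real"
  assumes dec: "\<And>r s. 0 \<le> r \<Longrightarrow> r \<le> s \<Longrightarrow> \<sigma> s \<le> \<sigma> r"
    and pos: "\<And>r. 0 \<le> r \<Longrightarrow> 0 < \<sigma> r"
    and cont: "continuous_on {0..} \<sigma>"
    and moment: "set_integrable lborel {0..} (\<lambda>r. r ^ 3 * \<sigma> r)"
begin

lemma radial_continuous: "continuous_on UNIV (\<lambda>v::real \<times> real. \<sigma> (norm v))"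
  by (intro continuous_on_compose2[OF cont] continuous_intros) auto

lemma radial_measurable [measurable]: "(\<lambda>v::real \<times> real. \<sigma> (norm v)) \<in> borel_measurable borel"
  by (rule borel_measurable_continuous_onI[OF radial_continuous])

lemma abs_measurable [measurable]: "(\<lambda>x::real. \<sigma> \<bar>x\<bar>) \<in> borel_measurable borel"
  by (intro borel_measurable_continuous_onI continuous_on_compose2[OF cont] continuous_intros) auto

text \<open>The plane moment is compared with the sum of the moments over \<open>|y| \<le> |x|\<close> and \<open>|x| \<le> |y|\<close>,
  where \<open>|v|\<close> is replaced by \<open>|x|\<close>, respectively \<open>|y|\<close>.\<close>

lemma plane_moment: "integrable lborel (\<lambda>v::real \<times> real. (1 + (norm v)\<^sup>2) * \<sigma> (norm v))"
proof -
  define k where "k = (\<lambda>x::real. (1 + 2 * x\<^sup>2) * \<sigma> \<bar>x\<bar>)"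
  have k0: "k x \<ge> 0" for x using pos[of "\<bar>x\<bar>"] by (simp add: k_def)
  have [measurable]: "k \<in> borel_measurable borel" unfolding k_def by measurable
  \<comment> \<open>The factor \<open>2 * x\<close> is the length of the slice of the cone at
    abscissa \<open>x\<close>.\<close>
  define J where "J = (\<lambda>x. indicator {0..} x * (2 * x * k x))"
  have "integrable lborel (\<lambda>x. 2 * \<sigma> 0 * indicator {0..1} x + 6 * (indicator {0..} x *\<^sub>R (x ^ 3 * \<sigma> x)))"
    using moment unfolding set_integrable_def by (intro Bochner_Integration.integrable_add integrable_mult_right) auto
  then have J: "integrable lborel J"
  proof (rule Bochner_Integration.integrable_bound)
    show "AE x in lborel. norm (J x) \<le> norm (2 * \<sigma> 0 * indicator {0..1} x + 6 * (indicator {0..} x *\<^sub>R (x ^ 3 * \<sigma> x)))"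
    proof (rule AE_I2)
      fix x :: real
      show "norm (J x) \<le> norm (2 * \<sigma> 0 * indicator {0..1} x + 6 * (indicator {0..} x *\<^sub>R (x ^ 3 * \<sigma> x)))"
      proof (cases "x \<ge> 0")
        case True
        have J: "J x = 2 * (x * \<sigma> x) + 4 * (x ^ 3 * \<sigma> x)"
          using True by (simp add: J_def k_def algebra_simps power2_eq_square power3_eq_cube)
        have p: "0 \<le> x ^ 3 * \<sigma> x" "0 \<le> x * \<sigma> x" using True pos[OF True] by simp_all
        \<comment> \<open>Only the third moment is given; the first one is controlled by
          \<open>\<sigma> 0\<close> up to 1 and by the third beyond.\<close>
        have "x * \<sigma> x \<le> \<sigma> 0 * indicator {0..1} x + x ^ 3 * \<sigma> x"
        proof (cases "x \<le> 1")
          case x1: True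
          have "x * \<sigma> x \<le> 1 * \<sigma> 0" using True x1 dec[of 0 x] pos[OF True] by (intro mult_mono) auto
          then show ?thesis using x1 True p by simp
        next
          case False
          have "x ^ 1 \<le> x ^ 3" using False by (intro power_increasing) auto
          then have "x * \<sigma> x \<le> x ^ 3 * \<sigma> x" using pos[OF True] by (intro mult_right_mono) auto
          then show ?thesis using False by simp
        qed
        moreover have "0 \<le> \<sigma> 0 * indicator {0..1} x" using pos[of 0] by simp
        ultimately have "norm (2 * (x * \<sigma> x) + 4 * (x ^ 3 * \<sigma> x))
            \<le> 2 * (\<sigma> 0 * indicator {0..1} x) + 6 * (x ^ 3 * \<sigma> x)"
          using p by (simp only: real_norm_def)
        also have "\<dots> = norm (2 * \<sigma> 0 * indicator {0..1} x + 6 * (indicator {0..} x *\<^sub>R (x ^ 3 * \<sigma> x)))"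
          using True p \<open>0 \<le> \<sigma> 0 * indicator {0..1} x\<close> by (simp add: mult.assoc)
        finally show ?thesis unfolding J .
      qed (simp add: J_def)
    qed
  qed (simp add: J_def)
  have "integrable lborel (\<lambda>x. J x + J (0 + - 1 * x))"
    using J by (intro Bochner_Integration.integrable_add lborel_integrable_real_affine) auto
  moreover have "J x + J (0 + - 1 * x) = 2 * \<bar>x\<bar> * k x" for x
    by (auto simp: J_def k_def indicator_def)
  ultimately have "integrable lborel (\<lambda>x. 2 * \<bar>x\<bar> * k x)" by simp
  then have fin: "(\<integral>\<^sup>+x. ennreal (2 * \<bar>x\<bar> * k x) \<partial>lborel) < \<infinity>"
    using k0 by (simp add: integrable_iff_bounded abs_mult)
  let ?f = "\<lambda>v::real \<times> real. ennreal (k (fst v)) * indicator {v. \<bar>snd v\<bar> \<le> \<bar>fst v\<bar>} v"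
  let ?g = "\<lambda>v::real \<times> real. ennreal (k (snd v)) * indicator {v. \<bar>fst v\<bar> \<le> \<bar>snd v\<bar>} v"
  have slice: "(\<integral>\<^sup>+y. ennreal (k x) * indicator {y. \<bar>y\<bar> \<le> \<bar>x\<bar>} y \<partial>lborel) = ennreal (2 * \<bar>x\<bar> * k x)" for x
  proof -
    have "{y. \<bar>y\<bar> \<le> \<bar>x\<bar>} = {- \<bar>x\<bar>..\<bar>x\<bar>}" by auto
    then show ?thesis using k0[of x] by (simp add: nn_integral_cmult_indicator ennreal_mult[symmetric] mult.commute)
  qed
  have f: "(\<integral>\<^sup>+v. ?f v \<partial>lborel) = (\<integral>\<^sup>+x. ennreal (2 * \<bar>x\<bar> * k x) \<partial>lborel)"
    by (subst nn_integral_lborel_pair(1)) (simp_all add: slice[symmetric] indicator_def)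
  have g: "(\<integral>\<^sup>+v. ?g v \<partial>lborel) = (\<integral>\<^sup>+x. ennreal (2 * \<bar>x\<bar> * k x) \<partial>lborel)"
    by (subst nn_integral_lborel_pair(2)) (simp_all add: slice[symmetric] indicator_def)
  have bound: "(1 + (norm v)\<^sup>2) * \<sigma> (norm v) \<le> k z"
    if "(norm v)\<^sup>2 \<le> 2 * z\<^sup>2" "\<bar>z\<bar> \<le> norm v" for v :: "real \<times> real" and z
    unfolding k_def using that dec[of "\<bar>z\<bar>" "norm v"] pos[of "norm v"] by (intro mult_mono) auto
  have "(\<integral>\<^sup>+v. ennreal (norm ((1 + (norm v)\<^sup>2) * \<sigma> (norm v))) \<partial>plane) \<le> (\<integral>\<^sup>+v. ?f v + ?g v \<partial>lborel)"
  proof (rule nn_integral_mono)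
    fix v :: "real \<times> real"
    have n: "norm v = sqrt ((fst v)\<^sup>2 + (snd v)\<^sup>2)" by (simp add: norm_prod_def)
    have nn: "norm ((1 + (norm v)\<^sup>2) * \<sigma> (norm v)) = (1 + (norm v)\<^sup>2) * \<sigma> (norm v)"
      using pos[of "norm v"] by simp
    show "ennreal (norm ((1 + (norm v)\<^sup>2) * \<sigma> (norm v))) \<le> ?f v + ?g v"
    proof (cases "\<bar>snd v\<bar> \<le> \<bar>fst v\<bar>")
      case True
      then have "(snd v)\<^sup>2 \<le> (fst v)\<^sup>2" by (simp add: abs_le_square_iff)
      then have "(norm v)\<^sup>2 \<le> 2 * (fst v)\<^sup>2" by (simp add: n)
      moreover have "\<bar>fst v\<bar> \<le> norm v" using norm_fst_le[of "fst v" "snd v"] by simp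
      ultimately have "ennreal ((1 + (norm v)\<^sup>2) * \<sigma> (norm v)) \<le> ennreal (k (fst v))"
        using bound k0 by (intro ennreal_leI) blast
      then show ?thesis unfolding nn using True by (simp add: add_increasing2)
    next
      case False
      then have "(fst v)\<^sup>2 \<le> (snd v)\<^sup>2" by (simp add: abs_le_square_iff)
      then have "(norm v)\<^sup>2 \<le> 2 * (snd v)\<^sup>2" by (simp add: n)
      moreover have "\<bar>snd v\<bar> \<le> norm v" using norm_snd_le[of "snd v" "fst v"] by simp
      ultimately have "ennreal ((1 + (norm v)\<^sup>2) * \<sigma> (norm v)) \<le> ennreal (k (snd v))"
        using bound k0 by (intro ennreal_leI) blast
      then show ?thesis unfolding nn using False by simp
    qed
  qed
  also have "\<dots> = (\<integral>\<^sup>+v. ?f v \<partial>lborel) + (\<integral>\<^sup>+v. ?g v \<partial>lborel)"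
    by (rule nn_integral_add) measurable
  also have "\<dots> < \<infinity>" using f g fin by simp
  finally show ?thesis by (intro integrableI_bounded) auto
qed

lemma plane_integrable:
  fixes f :: "real \<times> real \<Rightarrow> real"
  assumes [measurable]: "f \<in> borel_measurable borel" and b: "\<And>v. \<bar>f v\<bar> \<le> K * (1 + (norm v)\<^sup>2)"
  shows "integrable lborel (\<lambda>v. f v * \<sigma> (norm v))"
proof (rule Bochner_Integration.integrable_bound[OF integrable_mult_right[OF plane_moment, of K]])
  show "AE v in lborel. norm (f v * \<sigma> (norm v)) \<le> norm (K * ((1 + (norm v)\<^sup>2) * \<sigma> (norm v)))"
  proof (rule AE_I2)
    fix v :: "real \<times> real"
    have "\<bar>f v\<bar> * \<sigma> (norm v) \<le> K * (1 + (norm v)\<^sup>2) * \<sigma> (norm v)"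
      using b pos[of "norm v"] by (intro mult_right_mono) auto
    also have "\<dots> \<le> norm (K * ((1 + (norm v)\<^sup>2) * \<sigma> (norm v)))" by (simp add: mult.assoc)
    finally show "norm (f v * \<sigma> (norm v)) \<le> norm (K * ((1 + (norm v)\<^sup>2) * \<sigma> (norm v)))"
      using pos[of "norm v"] by (simp add: abs_mult)
  qed
qed simp

section \<open>Half-plane moments and their derivatives\<close>

definition "A0 s = (\<integral>v. of_bool (snd v \<le> s) * \<sigma> (norm v) \<partial>plane)"
definition "A1 s = (\<integral>v. max (s - snd v) 0 * \<sigma> (norm v) \<partial>plane)"
definition "A2 s = (\<integral>v. (max (s - snd v) 0)\<^sup>2 * \<sigma> (norm v) \<partial>plane)"

lemma A0_integrable: "integrable lborel (\<lambda>v::real \<times> real. of_bool (snd v \<le> s) * \<sigma> (norm v))"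
proof (rule plane_integrable[of _ 1])
  have "{v::real \<times> real. snd v \<le> s} \<in> sets borel" by measurable
  then have "(indicator {v::real \<times> real. snd v \<le> s} :: _ \<Rightarrow> real) \<in> borel_measurable borel"
    by (rule borel_measurable_indicator)
  then show "(\<lambda>v::real \<times> real. of_bool (snd v \<le> s) :: real) \<in> borel_measurable borel"
    by (simp add: indicator_def)
qed auto

lemma A2_integrable: "integrable lborel (\<lambda>v::real \<times> real. (max (s - snd v) 0)\<^sup>2 * \<sigma> (norm v))"
proof (rule plane_integrable[of _ "2 * (1 + s\<^sup>2)"])
  fix v :: "real \<times> real"
  have "(max (s - snd v) 0)\<^sup>2 \<le> (s - snd v)\<^sup>2" by (simp add: max_def)
  also have "\<dots> \<le> 2 * s\<^sup>2 + 2 * (snd v)\<^sup>2"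
    using zero_le_power2[of "s + snd v"] by (simp add: power2_eq_square algebra_simps)
  also have "(snd v)\<^sup>2 \<le> (norm v)\<^sup>2" using norm_snd_le[of "snd v" "fst v"] by (simp add: abs_le_square_iff[symmetric])
  also have "2 * s\<^sup>2 + 2 * (norm v)\<^sup>2 \<le> 2 * (1 + s\<^sup>2) * (1 + (norm v)\<^sup>2)"
    by (simp add: algebra_simps)
  finally show "\<bar>(max (s - snd v) 0)\<^sup>2\<bar> \<le> 2 * (1 + s\<^sup>2) * (1 + (norm v)\<^sup>2)" by simp
qed measurable

lemma A1_integrable: "integrable lborel (\<lambda>v::real \<times> real. max (s - snd v) 0 * \<sigma> (norm v))"
proof (rule plane_integrable[of _ "2 * (1 + s\<^sup>2)"])
  fix v :: "real \<times> real"
  have "\<bar>max (s - snd v) 0\<bar> \<le> \<bar>s\<bar> + \<bar>snd v\<bar>" by linarith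
  also have "\<bar>s\<bar> \<le> 1 + s\<^sup>2" using zero_le_power2[of "\<bar>s\<bar> - 1"] by (simp add: power2_eq_square algebra_simps)
  also have "\<bar>snd v\<bar> \<le> norm v" using norm_snd_le[of "snd v" "fst v"] by simp
  also have "norm v \<le> 1 + (norm v)\<^sup>2"
    using zero_le_power2[of "norm v - 1"] norm_ge_zero[of v] by (simp add: power2_eq_square algebra_simps del: norm_ge_zero)
  also have "1 + s\<^sup>2 + (1 + (norm v)\<^sup>2) \<le> 2 * (1 + s\<^sup>2) * (1 + (norm v)\<^sup>2)"
    by (simp add: algebra_simps)
  finally show "\<bar>max (s - snd v) 0\<bar> \<le> 2 * (1 + s\<^sup>2) * (1 + (norm v)\<^sup>2)" by simp
qed measurable

text \<open>Pointwise, \<open>max (s - y) 0\<close> is convex in \<open>s\<close> with slope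
  \<open>of_bool (y \<le> s)\<close>; its chord bounds are integrated.\<close>

lemma A1_chord:
  assumes st: "s < t"
  shows "(t - s) * A0 s \<le> A1 t - A1 s \<and> A1 t - A1 s \<le> (t - s) * A0 t"
proof -
  have "(t - s) * A0 s = (\<integral>v. (t - s) * (of_bool (snd v \<le> s) * \<sigma> (norm v)) \<partial>plane)"
    by (simp add: A0_def)
  also have "\<dots> \<le> (\<integral>v. max (t - snd v) 0 * \<sigma> (norm v) - max (s - snd v) 0 * \<sigma> (norm v) \<partial>plane)"
  proof (intro integral_mono integrable_mult_right A0_integrable Bochner_Integration.integrable_diff A1_integrable)
    fix v :: "real \<times> real"
    have "(t - s) * of_bool (snd v \<le> s) \<le> max (t - snd v) 0 - max (s - snd v) 0" using st by auto
    then show "(t - s) * (of_bool (snd v \<le> s) * \<sigma> (norm v))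
        \<le> max (t - snd v) 0 * \<sigma> (norm v) - max (s - snd v) 0 * \<sigma> (norm v)"
      using pos[of "norm v"] mult_right_mono[of _ _ "\<sigma> (norm v)"] by (fastforce simp: algebra_simps)
  qed
  finally have 1: "(t - s) * A0 s \<le> A1 t - A1 s"
    by (simp add: A1_def Bochner_Integration.integral_diff A1_integrable)
  have "A1 t - A1 s = (\<integral>v. max (t - snd v) 0 * \<sigma> (norm v) - max (s - snd v) 0 * \<sigma> (norm v) \<partial>plane)"
    by (simp add: A1_def Bochner_Integration.integral_diff A1_integrable)
  also have "\<dots> \<le> (\<integral>v. (t - s) * (of_bool (snd v \<le> t) * \<sigma> (norm v)) \<partial>plane)"
  proof (intro integral_mono integrable_mult_right A0_integrable Bochner_Integration.integrable_diff A1_integrable)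
    fix v :: "real \<times> real"
    have "max (t - snd v) 0 - max (s - snd v) 0 \<le> (t - s) * of_bool (snd v \<le> t)" using st by auto
    then show "max (t - snd v) 0 * \<sigma> (norm v) - max (s - snd v) 0 * \<sigma> (norm v)
        \<le> (t - s) * (of_bool (snd v \<le> t) * \<sigma> (norm v))"
      using pos[of "norm v"] mult_right_mono[of _ _ "\<sigma> (norm v)"] by (fastforce simp: algebra_simps)
  qed
  finally show ?thesis using 1 by (simp add: A0_def)
qed

lemma A2_chord:
  assumes st: "s < t"
  shows "(t - s) * (2 * A1 s) \<le> A2 t - A2 s \<and> A2 t - A2 s \<le> (t - s) * (2 * A1 t)"
proof -
  have D: "A2 t - A2 s = (\<integral>v. (max (t - snd v) 0)\<^sup>2 * \<sigma> (norm v) - (max (s - snd v) 0)\<^sup>2 * \<sigma> (norm v) \<partial>plane)"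
    by (simp add: A2_def Bochner_Integration.integral_diff A2_integrable)
  have pw: "(t - s) * (2 * max (s - y) 0) \<le> (max (t - y) 0)\<^sup>2 - (max (s - y) 0)\<^sup>2"
      "(max (t - y) 0)\<^sup>2 - (max (s - y) 0)\<^sup>2 \<le> (t - s) * (2 * max (t - y) 0)" for y
  proof -
    define a b where "a = max (s - y) 0" and "b = max (t - y) 0"
    have ab: "0 \<le> a" "a \<le> b" "b - a \<le> t - s" "a = 0 \<or> b - a = t - s"
      using st by (auto simp: a_def b_def max_def)
    have e: "b\<^sup>2 - a\<^sup>2 = (b - a) * (a + b)" by (simp add: power2_eq_square algebra_simps)
    have "(t - s) * (2 * a) = (b - a) * (2 * a)" using ab(4) by auto
    also have "\<dots> \<le> (b - a) * (a + b)" using ab by (intro mult_left_mono) auto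
    finally show "(t - s) * (2 * a) \<le> b\<^sup>2 - a\<^sup>2" using e by simp
    have "(b - a) * (a + b) \<le> (t - s) * (2 * b)" using ab by (intro mult_mono) auto
    then show "b\<^sup>2 - a\<^sup>2 \<le> (t - s) * (2 * b)" using e by simp
  qed
  have "(t - s) * (2 * A1 s) = (\<integral>v. (t - s) * (2 * (max (s - snd v) 0 * \<sigma> (norm v))) \<partial>plane)"
    by (simp add: A1_def)
  also have "\<dots> \<le> A2 t - A2 s" unfolding D
  proof (intro integral_mono integrable_mult_right A1_integrable Bochner_Integration.integrable_diff A2_integrable)
    fix v :: "real \<times> real"
    show "(t - s) * (2 * (max (s - snd v) 0 * \<sigma> (norm v)))
        \<le> (max (t - snd v) 0)\<^sup>2 * \<sigma> (norm v) - (max (s - snd v) 0)\<^sup>2 * \<sigma> (norm v)"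
      using mult_right_mono[OF pw(1)[of "snd v"], of "\<sigma> (norm v)"] pos[of "norm v"] by (simp add: algebra_simps)
  qed
  finally have 1: "(t - s) * (2 * A1 s) \<le> A2 t - A2 s" .
  have "A2 t - A2 s \<le> (\<integral>v. (t - s) * (2 * (max (t - snd v) 0 * \<sigma> (norm v))) \<partial>plane)" unfolding D
  proof (intro integral_mono integrable_mult_right A1_integrable Bochner_Integration.integrable_diff A2_integrable)
    fix v :: "real \<times> real"
    show "(max (t - snd v) 0)\<^sup>2 * \<sigma> (norm v) - (max (s - snd v) 0)\<^sup>2 * \<sigma> (norm v)
        \<le> (t - s) * (2 * (max (t - snd v) 0 * \<sigma> (norm v)))"
      using mult_right_mono[OF pw(2)[of "snd v"], of "\<sigma> (norm v)"] pos[of "norm v"] by (simp add: algebra_simps)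
  qed
  also have "\<dots> = (t - s) * (2 * A1 t)" by (simp add: A1_def)
  finally show ?thesis using 1 by simp
qed

lemma A0_mono: "s \<le> t \<Longrightarrow> A0 s \<le> A0 t"
  unfolding A0_def
  by (intro integral_mono A0_integrable mult_right_mono) (auto intro: less_imp_le[OF pos])

lemma A0_pos: "A0 s > 0"
proof -
  \<comment> \<open>A unit square inside the half-plane, on which the density is bounded away from
    0.\<close>
  define S where "S = cbox (0::real, s - 1) (1, s)"
  obtain R where R: "R > 0" "\<And>v. v \<in> S \<Longrightarrow> norm v \<le> R"
    using bounded_cbox[of "(0::real, s - 1)" "(1, s)"] unfolding bounded_pos S_def by blast
  have "measure lborel S = 1" unfolding S_def by (simp add: content_Pair)
  moreover have "emeasure lborel S < \<infinity>" unfolding S_def by (rule emeasure_lborel_cbox_finite)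
  moreover have S: "S \<in> sets lborel" by (simp add: S_def)
  ultimately have "(\<integral>v. \<sigma> R * indicator S v \<partial>lborel) = \<sigma> R" "integrable lborel (\<lambda>v. \<sigma> R * indicator S v)"
    by auto
  moreover have "(\<integral>v. \<sigma> R * indicator S v \<partial>lborel) \<le> A0 s"
    unfolding A0_def
  proof (intro integral_mono A0_integrable)
    show "\<sigma> R * indicator S v \<le> of_bool (snd v \<le> s) * \<sigma> (norm v)" for v
    proof (cases "v \<in> S")
      case True
      then have "snd v \<le> s" by (cases v) (auto simp: S_def cbox_Pair_eq)
      then show ?thesis using True dec[OF norm_ge_zero R(2)[OF True]] by simp
    qed (use pos[of "norm v"] in simp)
  qed fact
  ultimately show ?thesis using pos[of R] R by simp
qed

lemma A1_strict_mono: "s < t \<Longrightarrow> A1 s < A1 t"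
  using A1_chord[of s t] mult_pos_pos[of "t - s" "A0 s"] A0_pos[of s] by linarith

lemma A1_pos: "A1 s > 0"
proof -
  have "0 \<le> A1 (s - 1)" unfolding A1_def
    by (intro Bochner_Integration.integral_nonneg) (auto intro!: mult_nonneg_nonneg less_imp_le[OF pos])
  then show ?thesis using A1_strict_mono[of "s - 1" s] by simp
qed

lemma A2_mono: "s \<le> t \<Longrightarrow> A2 s \<le> A2 t"
proof (cases "s = t")
  case False
  moreover assume "s \<le> t"
  ultimately have "s < t" by simp
  then have "0 \<le> (t - s) * (2 * A1 s)" using A1_pos[of s] by (intro mult_nonneg_nonneg) auto
  then show ?thesis using A2_chord[OF \<open>s < t\<close>] by linarith
qed simp

lemma A2_nonneg: "A2 s \<ge> 0"
  unfolding A2_def by (intro Bochner_Integration.integral_nonneg) (auto intro!: mult_nonneg_nonneg less_imp_le[OF pos])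

text \<open>\<open>A0\<close> is at most the total mass \<open>M\<close>, so the chord bounds make
  \<open>A1\<close> Lipschitz with constant \<open>M\<close>.\<close>

lemma A1_continuous: "continuous_on UNIV A1"
proof -
  define M where "M = (\<integral>v. \<sigma> (norm v) \<partial>plane)"
  have i: "integrable lborel (\<lambda>v::real \<times> real. \<sigma> (norm v))" using plane_integrable[of "\<lambda>_. 1" 1] by simp
  have "A0 s \<le> M" for s unfolding A0_def M_def
    by (intro integral_mono A0_integrable i) (auto intro: less_imp_le[OF pos])
  then have AM: "A0 t \<le> M" for t by blast
  have le: "A1 t - A1 s \<le> M * (t - s)" "0 \<le> A1 t - A1 s" if "s \<le> t" for s t
  proof -
    have "(t - s) * A0 t \<le> (t - s) * M" using AM that by (intro mult_left_mono) auto
    moreover have "A1 t - A1 s \<le> (t - s) * A0 t" using A1_chord[of s t] that by (cases "s = t") auto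
    ultimately show "A1 t - A1 s \<le> M * (t - s)" by (simp only: mult.commute[of M])
    show "0 \<le> A1 t - A1 s" using A1_strict_mono[of s t] that by (cases "s = t") auto
  qed
  have "M-lipschitz_on UNIV A1"
  proof (rule lipschitz_onI)
    show "dist (A1 x) (A1 y) \<le> M * dist x y" for x y
      using le[of x y] le[of y x] by (cases "x \<le> y") (auto simp: dist_real_def abs_if)
    show "0 \<le> M" using le[of 0 1] by simp
  qed
  then show ?thesis by (rule lipschitz_on_continuous_on)
qed

lemma A2_deriv: "(A2 has_real_derivative 2 * A1 s) (at s)"
proof (rule deriv_of_chord_bounds[OF A2_chord])
  show "isCont (\<lambda>s. 2 * A1 s) s"
    using A1_continuous by (intro continuous_intros) (simp add: continuous_on_eq_continuous_at)
qed

text \<open>Stretch the half-plane \<open>y \<le> s\<close> to \<open>y \<le> t\<close>: the density decreases along the way.\<close>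

lemma A0_scaling:
  assumes st: "0 < s" "s \<le> t" shows "A0 t \<le> t / s * A0 s"
proof -
  define r where "r = t / s"
  have r: "r \<ge> 1" "r > 0" using st by (auto simp: r_def)
  have e: "ennreal (A0 s) = (\<integral>\<^sup>+v. ennreal (of_bool (snd v \<le> s) * \<sigma> (norm (v::real \<times> real))) \<partial>lborel)" for s
    unfolding A0_def
    by (intro nn_integral_eq_integral[symmetric] A0_integrable AE_I2 mult_nonneg_nonneg less_imp_le[OF pos]) auto
  have "ennreal (A0 t) = (\<integral>\<^sup>+x. \<integral>\<^sup>+y. ennreal (of_bool (y \<le> t) * \<sigma> (norm (x::real, y))) \<partial>lborel \<partial>lborel)"
    unfolding e by (subst nn_integral_lborel_pair(1)) simp_all
  also have "\<dots> = (\<integral>\<^sup>+x. r * (\<integral>\<^sup>+y. ennreal (of_bool (r * y \<le> t) * \<sigma> (norm (x::real, r * y))) \<partial>lborel) \<partial>lborel)"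
  proof (rule nn_integral_cong)
    fix x :: real
    have [measurable]: "(\<lambda>y. \<sigma> (norm (x, y))) \<in> borel_measurable borel"
      by (intro borel_measurable_continuous_onI continuous_on_compose2[OF cont] continuous_intros) auto
    show "(\<integral>\<^sup>+y. ennreal (of_bool (y \<le> t) * \<sigma> (norm (x, y))) \<partial>lborel)
        = r * (\<integral>\<^sup>+y. ennreal (of_bool (r * y \<le> t) * \<sigma> (norm (x, r * y))) \<partial>lborel)"
      using nn_integral_real_affine[of "\<lambda>y. ennreal (of_bool (y \<le> t) * \<sigma> (norm (x, y)))" r 0] r by simp
  qed
  also have "\<dots> \<le> (\<integral>\<^sup>+x. r * (\<integral>\<^sup>+y. ennreal (of_bool (y \<le> s) * \<sigma> (norm (x::real, y))) \<partial>lborel) \<partial>lborel)"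
  proof (intro nn_integral_mono mult_left_mono ennreal_leI mult_mono)
    fix x y :: real
    show "of_bool (r * y \<le> t) \<le> (of_bool (y \<le> s) :: real)" using st by (auto simp: r_def field_simps)
    have "y\<^sup>2 \<le> (r * y)\<^sup>2" using r by (simp add: power_mult_distrib mult_le_cancel_right1 power2_eq_square[of r] mult_ge1_I)
    then have "norm (x, y) \<le> norm (x, r * y)" by (simp add: norm_Pair)
    then show "\<sigma> (norm (x, r * y)) \<le> \<sigma> (norm (x, y))" by (intro dec) auto
  qed (use pos in \<open>auto intro: less_imp_le\<close>)
  also have "\<dots> = r * (\<integral>\<^sup>+x. \<integral>\<^sup>+y. ennreal (of_bool (y \<le> s) * \<sigma> (norm (x::real, y))) \<partial>lborel \<partial>lborel)"
    by (rule nn_integral_cmult) measurable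
  also have "\<dots> = r * ennreal (A0 s)"
    unfolding e by (subst nn_integral_lborel_pair(1)) simp_all
  also have "\<dots> = ennreal (r * A0 s)" using r A0_pos[of s] by (simp add: ennreal_mult)
  finally have "A0 t \<le> r * A0 s" using r A0_pos[of s] by (simp add: ennreal_le_iff)
  then show ?thesis by (simp add: r_def)
qed

text \<open>On either side of \<open>s\<close>, monotonicity and \<open>A0_scaling\<close> confine
  \<open>A0 t\<close> between \<open>A0 s\<close> and \<open>t / s * A0 s\<close>.\<close>

lemma A0_isCont:
  assumes s: "s > 0" shows "isCont A0 s"
proof -
  have "((\<lambda>t. A0 t - A0 s) \<longlongrightarrow> 0) (at s)"
  proof (rule Lim_null_comparison)
    have "\<forall>\<^sub>F t in at s. t > 0" using s by (intro order_tendstoD[OF tendsto_ident_at])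
    then show "\<forall>\<^sub>F t in at s. norm (A0 t - A0 s) \<le> \<bar>t / s - 1\<bar> * A0 s"
    proof eventually_elim
      case (elim t)
      show ?case
      proof (cases "s \<le> t")
        case True
        then have "A0 t - A0 s \<le> (t / s - 1) * A0 s" "0 \<le> A0 t - A0 s" "0 \<le> t / s - 1"
          using A0_scaling[of s t] A0_mono[of s t] s by (auto simp: algebra_simps)
        then show ?thesis by simp
      next
        case False
        then have "A0 s \<le> s / t * A0 t" "A0 t \<le> A0 s" using A0_scaling[of t s] A0_mono[of t s] elim by auto
        then have "t / s * A0 s \<le> A0 t" using s elim by (simp add: field_simps)
        then have "A0 s - A0 t \<le> (1 - t / s) * A0 s" by (simp add: algebra_simps)
        moreover have "\<bar>t / s - 1\<bar> = 1 - t / s" using False s by (simp add: field_simps)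
        ultimately show ?thesis using \<open>A0 t \<le> A0 s\<close> by simp
      qed
    qed
    have "((\<lambda>t. \<bar>t / s - 1\<bar> * A0 s) \<longlongrightarrow> \<bar>s / s - 1\<bar> * A0 s) (at s)"
      using s by (intro tendsto_intros) auto
    then show "((\<lambda>t. \<bar>t / s - 1\<bar> * A0 s) \<longlongrightarrow> 0) (at s)" using s by simp
  qed
  then show ?thesis by (simp add: isCont_def LIM_zero_iff)
qed

lemma A1_deriv: "s > 0 \<Longrightarrow> (A1 has_real_derivative A0 s) (at s)"
  by (rule deriv_of_chord_bounds[OF A1_chord A0_isCont])

text \<open>The expression is the logarithmic derivative of \<open>s^2 * A1 s\<close>. From
  \<open>s\<close> to \<open>t\<close>, \<open>A0\<close> grows at most by the factor
  \<open>t / s\<close>, and \<open>A1\<close> gains at least \<open>(t - s) * A0 s\<close>; what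
  remains is an inequality between the ratios \<open>r\<close> and \<open>k\<close>.\<close>

lemma A0_A1_ratio:
  assumes st: "0 < s" "s < t"
  shows "2 / t + A0 t / A1 t < 2 / s + A0 s / A1 s"
proof -
  define r k where "r = t / s" and "k = s * A0 s / A1 s"
  have r: "r > 1" and k: "k > 0" using st A0_pos[of s] A1_pos[of s] by (auto simp: r_def k_def)
  have den: "1 + (r - 1) * k > 0" using r k by (simp add: add_pos_pos)
  have "A1 s + (t - s) * A0 s \<le> A1 t" using A1_chord[of s t] st by simp
  moreover have "A1 s + (t - s) * A0 s = A1 s * (1 + (r - 1) * k)"
    using st A1_pos[of s] by (simp add: r_def k_def field_simps)
  ultimately have le: "A1 s * (1 + (r - 1) * k) \<le> A1 t" by simp
  have "A0 t / A1 t \<le> (t / s * A0 s) / (A1 s * (1 + (r - 1) * k))"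
    using A0_scaling[of s t] A0_pos[of s] A1_pos[of s] le den st
    by (intro frac_le mult_nonneg_nonneg mult_pos_pos) (auto intro: less_imp_le)
  then have "s * (A0 t / A1 t) \<le> s * ((t / s * A0 s) / (A1 s * (1 + (r - 1) * k)))"
    using st by (intro mult_left_mono) auto
  also have "\<dots> = (t * A0 s / A1 s) / (1 + (r - 1) * k)" using st by simp
  also have "t * A0 s / A1 s = r * k" using st by (simp add: r_def k_def)
  finally have 1: "s * (A0 t / A1 t) \<le> r * k / (1 + (r - 1) * k)" .
  have "k\<^sup>2 - k + 2 = (k - 1/2)\<^sup>2 + 7/4" by (simp add: power2_eq_square algebra_simps)
  then have "0 < k\<^sup>2 - k + 2" using zero_le_power2[of "k - 1/2"] by linarith
  moreover have "0 \<le> (r - 1) * (k\<^sup>2 + k)" using r k by simp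
  \<comment> \<open>The difference of the two sides vanishes at \<open>r = 1\<close>. Once
    \<open>r - 1\<close> is split off, the rest is a polynomial in \<open>r - 1\<close> whose
    constant term \<open>k^2 - k + 2\<close> has no real zero.\<close>
  ultimately have "0 < (r - 1) * (k\<^sup>2 - k + 2 + (r - 1) * (k\<^sup>2 + k))" using r by simp
  also have "\<dots> = r * ((2 + k - 2 / r) * (1 + (r - 1) * k) - r * k)"
    using r by (simp add: field_simps power2_eq_square)
  finally have "r * k < (2 + k - 2 / r) * (1 + (r - 1) * k)" using r by (simp add: zero_less_mult_iff)
  then have 2: "r * k / (1 + (r - 1) * k) < 2 + k - 2 / r" using den by (simp add: divide_less_eq)
  have "s * (2 / t + A0 t / A1 t) = 2 / r + s * (A0 t / A1 t)" using st by (simp add: r_def field_simps)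
  also have "\<dots> < 2 + k" using 1 2 by simp
  also have "\<dots> = s * (2 / s + A0 s / A1 s)" using st by (simp add: k_def field_simps)
  finally show ?thesis using st by simp
qed

end

section \<open>The pressure functions\<close>

text \<open>The sign of the derivative makes \<open>\<sigma>\<close> strictly decreasing. Were it
  not positive, it would stay below a negative constant from some point on, and the third moment
  would diverge.\<close>

lemma class_A2_radial_density:
  assumes "\<sigma> \<in> class_A2" shows "radial_density \<sigma>"
proof -
  obtain \<sigma>' where der: "\<And>r. r \<ge> 0 \<Longrightarrow> (\<sigma> has_real_derivative \<sigma>' r) (at r within {0..})"
    and neg: "\<And>r. r > 0 \<Longrightarrow> \<sigma>' r / r < 0"
    and int: "set_integrable lborel {0..} (\<lambda>r. r\<^sup>2 * \<sigma> r * (2 * r))"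
    using assms by (auto simp: class_A2_def)
  have cont: "continuous_on {0..} \<sigma>"
    using der by (intro DERIV_continuous_on) auto
  have der': "(\<sigma> has_real_derivative \<sigma>' r) (at r)" if "r > 0" for r
    using der[of r] that by (simp add: at_within_interior[of r "{0..}"])
  have strict: "\<sigma> s < \<sigma> r" if "0 \<le> r" "r < s" for r s
  proof (rule DERIV_neg_imp_decreasing_open[OF that(2)])
    show "\<exists>y. (\<sigma> has_real_derivative y) (at x) \<and> y < 0" if "r < x" for x
      using der'[of x] neg[of x] that \<open>0 \<le> r\<close> by (intro exI[of _ "\<sigma>' x"]) (auto simp: divide_less_0_iff)
    show "continuous_on {r..s} \<sigma>" using cont by (rule continuous_on_subset) (use that in auto)
  qed
  have int': "integrable lborel (\<lambda>r. indicator {0..} r * (r ^ 3 * \<sigma> r))"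
  proof -
    have "(\<lambda>r. indicator {0..} r * (r ^ 3 * \<sigma> r)) = (\<lambda>r. (1 / 2) * (indicator {0..} r *\<^sub>R (r\<^sup>2 * \<sigma> r * (2 * r))))"
      by (auto simp: power2_eq_square power3_eq_cube)
    moreover have "integrable lborel (\<lambda>r. (1 / 2) * (indicator {0..} r *\<^sub>R (r\<^sup>2 * \<sigma> r * (2 * r))))"
      using int unfolding set_integrable_def by (rule integrable_mult_right)
    ultimately show ?thesis by (simp only:)
  qed
  show ?thesis
  proof
    show "\<sigma> s \<le> \<sigma> r" if "0 \<le> r" "r \<le> s" for r s
      using strict[of r s] that by (cases "r = s") auto
    show "0 < \<sigma> r" if r: "0 \<le> r" for r
    proof (rule ccontr)
      assume "\<not> 0 < \<sigma> r"
      define k R where "k = - \<sigma> (r + 1)" and "R = r + 1"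
      have k: "k > 0" using strict[of r "r + 1"] \<open>\<not> 0 < \<sigma> r\<close> r by (simp add: k_def)
      have "integrable lborel (\<lambda>x. k * indicator {R..} x)"
      proof (rule Bochner_Integration.integrable_bound[OF int'])
        show "AE x in lborel. norm (k * indicator {R..} x) \<le> norm (indicator {0..} x * (x ^ 3 * \<sigma> x))"
        proof (rule AE_I2)
          fix x :: real
          show "norm (k * indicator {R..} x) \<le> norm (indicator {0..} x * (x ^ 3 * \<sigma> x))"
          proof (cases "x \<ge> R")
            case True
            then have x: "x \<ge> 1" using r by (simp add: R_def)
            have s: "k \<le> - \<sigma> x" using strict[of R x] True r by (cases "x = R") (auto simp: k_def R_def)
            have "1 * k \<le> x ^ 3 * - \<sigma> x" using x k s by (intro mult_mono) auto
            then show ?thesis using True x k s by (simp add: abs_mult)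
          qed simp
        qed
      qed simp
      then have "integrable lborel (indicator {R..} :: real \<Rightarrow> real)" using k by simp
      then have fin: "emeasure lborel {R..} < \<infinity>" by (simp add: integrable_indicator_iff)
      then obtain n where n: "emeasure lborel {R..} < of_nat n"
        using ennreal_Ex_less_of_nat by (auto simp: less_top)
      have "of_nat n = emeasure lborel {R..R + of_nat n}" by (simp add: ennreal_of_nat_eq_real_of_nat)
      also have "\<dots> \<le> emeasure lborel {R..}" by (intro emeasure_mono) auto
      finally show False using n by simp
    qed
    show "set_integrable lborel {0..} (\<lambda>r. r ^ 3 * \<sigma> r)"
      using int' by (simp add: set_integrable_def)
  qed fact
qed

text \<open>The cosine of the angle between the direction of motion and the normal of a face of
  slope \<open>u\<close>.\<close>

definition cosine :: "real \<Rightarrow> real" where "cosine u = 1 / sqrt (1 + u\<^sup>2)"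

lemma cosine_pos: "cosine u > 0"
  by (simp add: cosine_def add_pos_nonneg)

lemma cosine_le_1: "cosine u \<le> 1"
proof -
  have "1 \<le> sqrt (1 + u\<^sup>2)" "0 < sqrt (1 + u\<^sup>2)" by (simp_all add: add_pos_nonneg)
  then show ?thesis by (simp only: cosine_def divide_le_eq_1_pos)
qed

lemma cosine_sq: "(cosine u)\<^sup>2 * (1 + u\<^sup>2) = 1"
proof -
  have "1 + u\<^sup>2 > 0" by (simp add: add_pos_nonneg)
  then have "(sqrt (1 + u\<^sup>2))\<^sup>2 = 1 + u\<^sup>2" "1 + u\<^sup>2 \<noteq> 0" by (simp_all only: real_sqrt_pow2_iff less_imp_le)
  then show ?thesis by (simp add: cosine_def power_divide)
qed

lemma cosine_0: "cosine 0 = 1"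
  by (simp add: cosine_def)

lemma cosine_strict_decreasing: "0 \<le> u \<Longrightarrow> u < v \<Longrightarrow> cosine v < cosine u"
  unfolding cosine_def
  by (intro divide_strict_left_mono real_sqrt_less_mono mult_pos_pos real_sqrt_gt_zero)
     (auto simp: power_strict_mono add_pos_nonneg)

lemma cosine_deriv: "(cosine has_real_derivative - u * cosine u ^ 3) (at u)"
proof -
  have p: "1 + u\<^sup>2 > 0" by (simp add: add_pos_nonneg)
  show ?thesis
    unfolding cosine_def[abs_def] using p
    by (auto intro!: derivative_eq_intros simp: power3_eq_cube) (simp add: field_simps)
qed

lemma cosine_continuous: "continuous_on S cosine"
  by (rule DERIV_continuous_on) (rule has_field_derivative_at_within[OF cosine_deriv])

locale moving_medium = radial_density +
  fixes V :: real
  assumes V_pos: "V > 0"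
begin

text \<open>The translation by \<open>(0, V)\<close> centres the density. The orthogonal map
  \<open>T\<close> then makes the component along the unit normal
  \<open>(u, \<epsilon>) / sqrt (1 + u^2)\<close> the second coordinate, so a half-plane moment
  remains.\<close>

lemma pressure_formula:
  assumes \<epsilon>: "\<epsilon> = 1 \<or> \<epsilon> = - 1"
  shows "pressure (flux_density \<sigma> V) \<epsilon> u = \<epsilon> * A2 (\<epsilon> * (V * cosine u))"
proof -
  define s a b where "s = sqrt (1 + u\<^sup>2)" and "a = \<epsilon> / s" and "b = u / s"
  have s: "s > 0" "s\<^sup>2 = 1 + u\<^sup>2" by (simp_all add: s_def add_pos_nonneg)
  have "\<epsilon>\<^sup>2 = 1" using \<epsilon> by auto
  then have ab: "a\<^sup>2 + b\<^sup>2 = 1" using s(1) by (simp add: a_def b_def power_divide s(2) flip: add_divide_distrib)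
      (metis s power_not_zero less_irrefl)
  have a: "a \<noteq> 0" using s \<epsilon> by (auto simp: a_def)
  define F where "F = (\<lambda>v. (max (- (fst v * u + \<epsilon> * snd v)) 0)\<^sup>2 / (1 + u\<^sup>2) * flux_density \<sigma> V v)"
  define H where "H = (\<lambda>v::real \<times> real. (max (\<epsilon> * (V * cosine u) - snd v) 0)\<^sup>2 * \<sigma> (norm v))"
  define T where "T = (\<lambda>v. (a * fst v - b * snd v, b * fst v + a * snd v))"
  have [measurable]: "H \<in> borel_measurable borel" unfolding H_def by measurable
  have [measurable]: "(\<lambda>v. H (T v)) \<in> borel_measurable borel" unfolding T_def
    by (rule measurable_compose[OF _ \<open>H \<in> borel_measurable borel\<close>], rule borel_measurable_continuous_onI)
       (intro continuous_intros)
  have FT: "F v = H (T ((0, V) + v))" for v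
  proof -
    obtain x y where v: "v = (x, y)" by (cases v)
    have "(norm (T w))\<^sup>2 = (norm w)\<^sup>2" for w
    proof -
      have "(norm (T w))\<^sup>2 = (a * fst w - b * snd w)\<^sup>2 + (b * fst w + a * snd w)\<^sup>2"
        by (simp add: T_def norm_Pair)
      also have "\<dots> = (a\<^sup>2 + b\<^sup>2) * ((fst w)\<^sup>2 + (snd w)\<^sup>2)" by (simp add: power2_eq_square algebra_simps)
      finally have "(norm (T w))\<^sup>2 = (a\<^sup>2 + b\<^sup>2) * ((fst w)\<^sup>2 + (snd w)\<^sup>2)" .
      then show ?thesis by (simp add: ab norm_prod_def)
    qed
    then have "norm (T w) = norm w" for w by (simp add: power2_eq_iff_nonneg)
    moreover have mx: "(max (- (x * u + \<epsilon> * y)) 0)\<^sup>2 / (1 + u\<^sup>2) = (max (\<epsilon> * (V * cosine u) - snd (T ((0, V) + v))) 0)\<^sup>2"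
    proof -
      have "\<epsilon> * (V * cosine u) - snd (T ((0, V) + v)) = - (x * u + \<epsilon> * y) / s"
        by (simp add: T_def v cosine_def s_def[symmetric] a_def b_def diff_divide_distrib add_divide_distrib algebra_simps)
      moreover have "max (z / s) 0 = max z 0 / s" for z
        using s(1) by (cases "z \<le> 0") (auto simp: max_def divide_le_0_iff)
      then have "(max z 0)\<^sup>2 / (1 + u\<^sup>2) = (max (z / s) 0)\<^sup>2" for z
        by (simp only: power_divide s(2))
      ultimately show ?thesis by (simp only:)
    qed
    moreover have "F v = (max (- (x * u + \<epsilon> * y)) 0)\<^sup>2 / (1 + u\<^sup>2) * \<sigma> (norm ((0, V) + v))"
      by (simp add: F_def flux_density_def v add.commute)
    ultimately show ?thesis by (simp only: H_def)
  qed
  have H0: "H v \<ge> 0" for v unfolding H_def using pos[of "norm v"] by simp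
  have "(\<integral>v. F v \<partial>plane) = enn2real (\<integral>\<^sup>+v. ennreal (H (T ((0, V) + v))) \<partial>plane)"
    unfolding FT by (rule integral_eq_nn_integral) (use H0 in auto)
  also have "(\<integral>\<^sup>+v. ennreal (H (T ((0, V) + v))) \<partial>plane) = (\<integral>\<^sup>+v. ennreal (H (T v)) \<partial>distr lborel borel ((+) (0, V)))"
    by (subst nn_integral_distr) simp_all
  also have "\<dots> = (\<integral>\<^sup>+v. ennreal (H v) \<partial>plane)"
    unfolding lborel_distr_plus T_def using nn_integral_rotation[of "\<lambda>v. ennreal (H v)" a b] a ab by simp
  also have "enn2real \<dots> = (\<integral>v. H v \<partial>plane)"
    by (rule integral_eq_nn_integral[symmetric]) (use H0 in auto)
  finally show ?thesis by (simp add: pressure_def F_def H_def A2_def)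
qed

definition "drag_slope \<epsilon> u = - 2 * V * (u * cosine u ^ 3 * A1 (\<epsilon> * (V * cosine u)))"

lemma pressure_deriv:
  assumes "\<epsilon> = 1 \<or> \<epsilon> = - 1"
  shows "(pressure (flux_density \<sigma> V) \<epsilon> has_real_derivative drag_slope \<epsilon> u) (at u)"
proof -
  have "pressure (flux_density \<sigma> V) \<epsilon> = (\<lambda>u. \<epsilon> * A2 (\<epsilon> * (V * cosine u)))"
    using pressure_formula[OF assms] by auto
  moreover have "((\<lambda>u. A2 (\<epsilon> * (V * cosine u))) has_real_derivative
      2 * A1 (\<epsilon> * (V * cosine u)) * (\<epsilon> * (V * (- u * cosine u ^ 3)))) (at u)"
    by (rule DERIV_chain2[OF A2_deriv]) (intro DERIV_cmult cosine_deriv)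
  then have "((\<lambda>u. \<epsilon> * A2 (\<epsilon> * (V * cosine u))) has_real_derivative
      \<epsilon> * (2 * A1 (\<epsilon> * (V * cosine u)) * (\<epsilon> * (V * (- u * cosine u ^ 3))))) (at u)"
    by (rule DERIV_cmult)
  moreover have "\<epsilon> * (2 * A1 (\<epsilon> * (V * cosine u)) * (\<epsilon> * (V * (- u * cosine u ^ 3)))) = drag_slope \<epsilon> u"
    using assms by (auto simp: drag_slope_def)
  ultimately show ?thesis by simp
qed

lemma pressure_bound:
  assumes \<epsilon>: "\<epsilon> = 1 \<or> \<epsilon> = - 1"
  shows "\<bar>pressure (flux_density \<sigma> V) \<epsilon> u\<bar> \<le> A2 V"
proof -
  have "V * cosine u \<le> V * 1" "0 \<le> V * cosine u"
    using V_pos cosine_le_1[of u] cosine_pos[of u] by (intro mult_left_mono mult_nonneg_nonneg; simp)+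
  then have "\<epsilon> * (V * cosine u) \<le> V * 1" using \<epsilon> V_pos by (elim disjE) (simp only:; linarith)+
  then have "A2 (\<epsilon> * (V * cosine u)) \<le> A2 V" by (intro A2_mono) simp
  then show ?thesis using \<epsilon> A2_nonneg by (auto simp: pressure_formula abs_mult)
qed

lemma drag_law_pressure:
  assumes "\<epsilon> = 1 \<or> \<epsilon> = - 1"
  shows "drag_law (pressure (flux_density \<sigma> V) \<epsilon>) (drag_slope \<epsilon>) (- A2 V) (A2 V)"
proof
  show "(pressure (flux_density \<sigma> V) \<epsilon> has_real_derivative drag_slope \<epsilon> u) (at u)" for u
    by (rule pressure_deriv[OF assms])
  show "drag_slope \<epsilon> u < 0" if "u > 0" for u
    using that V_pos cosine_pos A1_pos by (simp add: drag_slope_def)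
  show "- A2 V \<le> pressure (flux_density \<sigma> V) \<epsilon> u" "pressure (flux_density \<sigma> V) \<epsilon> u \<le> A2 V" for u
    using pressure_bound[OF assms, of u] by auto
qed (simp add: drag_slope_def)

text \<open>The two slopes differ only in the sign of the argument of \<open>A1\<close>, which
  increases strictly.\<close>

lemma drag_slope_front_less: "u > 0 \<Longrightarrow> drag_slope 1 u < drag_slope (- 1) u"
proof -
  assume u: "u > 0"
  have "A1 (- (V * cosine u)) < A1 (V * cosine u)"
    using V_pos cosine_pos[of u] by (intro A1_strict_mono) (auto intro: less_trans[of _ 0])
  then show ?thesis using u V_pos cosine_pos[of u] by (simp add: drag_slope_def)
qed

lemma drag_slope_continuous: "continuous_on UNIV (drag_slope \<epsilon>)"
  unfolding drag_slope_def[abs_def]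
  by (intro continuous_intros cosine_continuous continuous_on_compose2[OF A1_continuous]) auto

text \<open>Its sign is that of the second derivative of the front pressure.\<close>

definition "curvature u = (let s = V * cosine u in 2 / s + A0 s / A1 s - 1 / (s * u\<^sup>2))"

lemma drag_slope_deriv:
  assumes u: "u > 0"
  shows "(drag_slope 1 has_real_derivative
    2 * V * (u\<^sup>2 * cosine u ^ 5 * A1 (V * cosine u) * (V * cosine u)) * curvature u) (at u)"
proof -
  define c s where "c = cosine u" and "s = V * cosine u"
  have c: "c > 0" "c\<^sup>2 * (1 + u\<^sup>2) = 1" and s: "s > 0" "s = V * c"
    using cosine_pos cosine_sq V_pos by (auto simp: c_def s_def)
  have "((\<lambda>u. A1 (V * cosine u)) has_real_derivative A0 s * (V * (- u * c ^ 3))) (at u)"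
    unfolding c_def s_def
    by (rule DERIV_chain2[where g = "\<lambda>u. V * cosine u", OF A1_deriv DERIV_cmult[OF cosine_deriv]])
       (use s in \<open>simp add: s_def\<close>)
  note D1 = this
  have D3: "((\<lambda>u. cosine u ^ 3) has_real_derivative 3 * c\<^sup>2 * (- u * c ^ 3)) (at u)"
    using DERIV_power[OF cosine_deriv[of u], of 3] by (simp add: c_def algebra_simps)
  have D: "(drag_slope 1 has_real_derivative
      - 2 * V * (u * c ^ 3 * (A0 s * (V * (- u * c ^ 3))) + (u * (3 * c\<^sup>2 * (- u * c ^ 3)) + 1 * c ^ 3) * A1 s)) (at u)"
    unfolding drag_slope_def[abs_def] mult_1
    by (rule DERIV_cong[OF DERIV_cmult[OF DERIV_mult[OF DERIV_mult[OF DERIV_ident D3] D1]]])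
       (simp add: c_def s_def algebra_simps)
  \<comment> \<open>Brings all terms to the factor \<open>c ^ 5\<close>: it turns 3 u^2 c^5 - c^3
    into c^5 (2 u^2 - 1).\<close>
  have c3: "c ^ 3 = c ^ 5 * (1 + u\<^sup>2)"
  proof -
    have "c ^ 5 * (1 + u\<^sup>2) = c ^ 3 * (c\<^sup>2 * (1 + u\<^sup>2))" by (simp add: power_def numeral_eq_Suc)
    then show ?thesis by (simp add: c(2))
  qed
  have sL: "A1 s * s * curvature u = 2 * A1 s + s * A0 s - A1 s / u\<^sup>2"
    using s(1) A1_pos[of s] u by (simp add: curvature_def Let_def s_def[symmetric] field_simps)
  have "- 2 * V * (u * c ^ 3 * (A0 s * (V * (- u * c ^ 3))) + (u * (3 * c\<^sup>2 * (- u * c ^ 3)) + 1 * c ^ 3) * A1 s)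
      = 2 * V * (u\<^sup>2 * c ^ 5 * (V * c) * A0 s + 3 * u\<^sup>2 * c ^ 5 * A1 s - c ^ 3 * A1 s)"
    by (simp add: power_def numeral_eq_Suc algebra_simps)
  also have "\<dots> = 2 * V * (u\<^sup>2 * c ^ 5 * (A1 s * s * curvature u))"
  proof -
    have "u\<^sup>2 * (A1 s / u\<^sup>2) = A1 s" using u by simp
    then have "u\<^sup>2 * (2 * A1 s + s * A0 s - A1 s / u\<^sup>2) = u\<^sup>2 * s * A0 s + 2 * u\<^sup>2 * A1 s - A1 s"
      by (simp add: algebra_simps)
    then have "u\<^sup>2 * c ^ 5 * (A1 s * s * curvature u) = c ^ 5 * (u\<^sup>2 * s * A0 s + 2 * u\<^sup>2 * A1 s - A1 s)"
      unfolding sL by (simp only: mult.commute[of "u\<^sup>2" "c ^ 5"] mult.assoc)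
    also have "\<dots> = u\<^sup>2 * c ^ 5 * s * A0 s + 3 * u\<^sup>2 * c ^ 5 * A1 s - c ^ 5 * (1 + u\<^sup>2) * A1 s"
      by (simp add: algebra_simps)
    finally show ?thesis by (simp only: c3 s(2)[symmetric])
  qed
  finally have "(drag_slope 1 has_real_derivative 2 * V * (u\<^sup>2 * c ^ 5 * (A1 s * s * curvature u))) (at u)"
    using D by (simp only:)
  then show ?thesis unfolding c_def s_def by (simp only: mult.assoc)
qed

text \<open>Since s u^2 = (V^2 - s^2) / s, \<open>curvature\<close> is the logarithmic derivative in
  \<open>s\<close> of the log-concave function s^2 A_1(s) (V^2 - s^2)^(1/2), and \<open>s\<close>
  decreases in \<open>u\<close>.\<close>

lemma curvature_strict_mono:
  assumes uv: "0 < u" "u < v" shows "curvature u < curvature v"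
proof -
  define s t where "s = V * cosine u" and "t = V * cosine v"
  have st: "0 < t" "t < s"
    using cosine_strict_decreasing[of u v] cosine_pos[of v] V_pos uv by (auto simp: s_def t_def)
  have "u\<^sup>2 * s < v\<^sup>2 * t"
  proof -
    have e: "u\<^sup>2 * cosine u = 1 / cosine u - cosine u" for u
      using cosine_sq[of u] cosine_pos[of u] by (simp add: field_simps power2_eq_square)
    have "1 / cosine u - cosine u < 1 / cosine v - cosine v"
      using cosine_strict_decreasing[of u v] cosine_pos[of v] cosine_pos[of u] uv
      by (intro diff_strict_mono divide_strict_left_mono) auto
    then have "u\<^sup>2 * cosine u < v\<^sup>2 * cosine v" unfolding e .
    then show ?thesis using V_pos by (simp add: s_def t_def mult.left_commute)
  qed
  then have "1 / (t * v\<^sup>2) < 1 / (s * u\<^sup>2)"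
    using st uv by (intro divide_strict_left_mono mult_pos_pos) (auto simp: mult.commute)
  moreover have "2 / s + A0 s / A1 s < 2 / t + A0 t / A1 t" by (rule A0_A1_ratio[OF st])
  ultimately show ?thesis by (simp add: curvature_def Let_def s_def[symmetric] t_def[symmetric])
qed

text \<open>After multiplication by \<open>s\<close>, the first two terms are at most
  \<open>M\<close>, while \<open>1 / u^2\<close> is unbounded near 0. At \<open>u = 1\<close> it
  equals 1 and is beaten by the first term, 2.\<close>

lemma curvature_zero: obtains m where "m > 0" "curvature m = 0"
proof -
  define M where "M = 2 + V * A0 V / A1 0"
  have M: "M > 0" using V_pos A0_pos[of V] A1_pos[of 0] by (simp add: M_def add_pos_pos)
  define u where "u = 1 / (M + 1)"
  have u: "0 < u" "u \<le> 1" "1 / u\<^sup>2 > M"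
    using M by (auto simp: u_def power_divide power2_eq_square field_simps add_pos_pos)
  have "curvature u \<le> 0"
  proof -
    define s where "s = V * cosine u"
    have s: "0 < s" "s \<le> V" using V_pos cosine_pos[of u] cosine_le_1[of u] by (auto simp: s_def)
    have "s * A0 s / A1 s \<le> V * A0 V / A1 0"
      using s A0_mono[of s V] A0_pos[of s] A1_pos[of 0] A1_strict_mono[of 0 s] V_pos
      by (intro frac_le mult_mono) (auto intro: less_imp_le)
    then have "s * curvature u \<le> M - 1 / u\<^sup>2"
      using s A1_pos[of s] u by (simp add: curvature_def Let_def s_def[symmetric] M_def algebra_simps)
    also have "\<dots> \<le> 0" using u by simp
    finally show ?thesis using s by (simp add: mult_le_0_iff)
  qed
  moreover have "0 \<le> curvature 1"
    using V_pos cosine_pos[of 1] A0_pos A1_pos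
    by (simp add: curvature_def Let_def field_simps add_nonneg_nonneg less_imp_le)
  moreover have "continuous_on {u..1} curvature"
  proof -
    have nz: "V * cosine x > 0" for x using V_pos cosine_pos[of x] by simp
    have nz': "cosine x \<noteq> 0" for x using cosine_pos[of x] by simp
    have A1_nz: "A1 s \<noteq> 0" for s using A1_pos[of s] by simp
    have "continuous_on {0<..} A0" using A0_isCont by (simp add: continuous_at_imp_continuous_on)
    then have "continuous_on {u..1} (\<lambda>x. A0 (V * cosine x))"
      by (rule continuous_on_compose2) (use nz in \<open>auto intro!: continuous_intros cosine_continuous\<close>)
    moreover have "continuous_on {u..1} (\<lambda>x. A1 (V * cosine x))"
      by (rule continuous_on_compose2[OF A1_continuous]) (auto intro!: continuous_intros cosine_continuous)
    ultimately show ?thesis unfolding curvature_def Let_def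
      by (intro continuous_intros cosine_continuous)
         (use nz' A1_nz V_pos u in auto)
  qed
  ultimately obtain m where "u \<le> m" "curvature m = 0"
    using IVT'[of curvature u 0 1] u by auto
  then show thesis using that[of m] u by simp
qed

lemma two_faces_star_exists:
  obtains d1 c1 C1 w1 m d2 c2 C2 w2 us where
    "two_faces_star (flux_density \<sigma> V) d1 c1 C1 w1 m d2 c2 C2 w2 us"
proof -
  let ?\<rho> = "flux_density \<sigma> V"
  interpret plus: drag_law "pressure ?\<rho> 1" "drag_slope 1" "- A2 V" "A2 V"
    by (rule drag_law_pressure) simp
  interpret minus: drag_law "pressure ?\<rho> (- 1)" "drag_slope (- 1)" "- A2 V" "A2 V"
    by (rule drag_law_pressure) simp
  obtain w1 where w1: "w1 > 0" "plus.q w1 = pressure ?\<rho> 1 w1" "{0<..<w1} \<subseteq> plus.gap"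
    by (rule plus.first_gap)
  obtain w2 where w2: "w2 > 0" "minus.q w2 = pressure ?\<rho> (- 1) w2" "{0<..<w2} \<subseteq> minus.gap"
    by (rule minus.first_gap)
  obtain m where m: "m > 0" "curvature m = 0" by (rule curvature_zero)
  have factor: "0 < 2 * V * (x\<^sup>2 * cosine x ^ 5 * A1 (V * cosine x) * (V * cosine x))" if "x > 0" for x
    using that V_pos cosine_pos[of x] A1_pos by simp
  interpret two_faces ?\<rho> "drag_slope 1" "- A2 V" "A2 V" w1 m "drag_slope (- 1)" "- A2 V" "A2 V" w2
  proof unfold_locales
    show "drag_slope 1 v < drag_slope 1 u" if uv: "0 \<le> u" "u < v" "v \<le> m" for u v
    proof (rule DERIV_neg_imp_decreasing_open[OF uv(2)])
      show "\<exists>y. (drag_slope 1 has_real_derivative y) (at x) \<and> y < 0" if "u < x" "x < v" for x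
      proof (intro exI conjI)
        show "(drag_slope 1 has_real_derivative
            2 * V * (x\<^sup>2 * cosine x ^ 5 * A1 (V * cosine x) * (V * cosine x)) * curvature x) (at x)"
          by (rule drag_slope_deriv) (use uv m that in auto)
        show "2 * V * (x\<^sup>2 * cosine x ^ 5 * A1 (V * cosine x) * (V * cosine x)) * curvature x < 0"
          by (intro mult_pos_neg factor) (use curvature_strict_mono[of x m] m uv that in auto)
      qed
    qed (rule continuous_on_subset[OF drag_slope_continuous], simp)
    show "drag_slope 1 u < drag_slope 1 v" if uv: "m \<le> u" "u < v" for u v
    proof (rule DERIV_pos_imp_increasing_open[OF uv(2)])
      show "\<exists>y. (drag_slope 1 has_real_derivative y) (at x) \<and> y > 0" if "u < x" "x < v" for x
      proof (intro exI conjI)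
        show "(drag_slope 1 has_real_derivative
            2 * V * (x\<^sup>2 * cosine x ^ 5 * A1 (V * cosine x) * (V * cosine x)) * curvature x) (at x)"
          by (rule drag_slope_deriv) (use uv m that in auto)
        show "2 * V * (x\<^sup>2 * cosine x ^ 5 * A1 (V * cosine x) * (V * cosine x)) * curvature x > 0"
          by (intro mult_pos_pos factor) (use curvature_strict_mono[of m x] m uv that in auto)
      qed
    qed (rule continuous_on_subset[OF drag_slope_continuous], simp)
  qed (use w1 w2 m drag_slope_front_less drag_slope_continuous in auto)
  obtain us where us: "us > w1" "drag_slope 1 us = - minus.B" by (rule us_exists)
  have "two_faces_star ?\<rho> (drag_slope 1) (- A2 V) (A2 V) w1 m (drag_slope (- 1)) (- A2 V) (A2 V) w2 us"
    by unfold_locales (use us in auto)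
  then show thesis by (rule that)
qed

end

section \<open>The shapes of optimal bodies\<close>

lemma two_slope_profile_from_0:
  assumes "b > 0"
  shows "two_slope_profile 0 b h = (\<lambda>t. if t \<le> 1 - h / b then - h else - h + b * (t - (1 - h / b)))"
  using assms by (auto simp: two_slope_profile_def Let_def diff_divide_distrib)

context two_faces_star
begin

lemma flat_rear:
  "(\<lambda>t. 0) \<in> profiles 0" "minus.res (\<lambda>t. 0) = minus.q 0"
  using linear_profile[of 0] minus.res_linear[of 0] minus.q_0 by simp_all

lemma trapezium_case:
  assumes h: "0 < h" "h < w1"
  shows "h_plus \<rho> h = h" "h_minus \<rho> h = 0"
    "attains_minimum \<rho> h (\<lambda>t. if t \<le> 1 - h / w1 then - h else - h + w1 * (t - (1 - h / w1))) (\<lambda>t. 0)"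
    "minimal_resistance \<rho> h = pressure \<rho> 1 0 - plus.B * h + pressure \<rho> (- 1) 0"
proof -
  have o: "optimal h h" using optimal_short h us_gt by simp
  have f: "two_slope_profile 0 w1 h \<in> profiles h" "plus.res (two_slope_profile 0 w1 h) = plus.q h"
    using h plus.w_gap plus.w_contact plus.q_0 plus.w_pos
    by (auto intro!: two_slope_profile plus.res_two_slope_gap)
  show "h_plus \<rho> h = h" "h_minus \<rho> h = 0"
    using h_plus_optimal[OF o] h_minus_optimal[OF o] by simp_all
  show "attains_minimum \<rho> h (\<lambda>t. if t \<le> 1 - h / w1 then - h else - h + w1 * (t - (1 - h / w1))) (\<lambda>t. 0)"
    using optimal_attains(1)[OF o f] flat_rear two_slope_profile_from_0[OF plus.w_pos] by simp
  show "minimal_resistance \<rho> h = pressure \<rho> 1 0 - plus.B * h + pressure \<rho> (- 1) 0"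
    using minimal_resistance_optimal[OF o] plus.q_first[of h] minus.q_0 h by simp
qed

lemma triangle_case:
  assumes h: "w1 \<le> h" "h \<le> us"
  shows "h_plus \<rho> h = h" "h_minus \<rho> h = 0"
    "attains_minimum \<rho> h (\<lambda>t. - h + h * t) (\<lambda>t. 0)"
    "minimal_resistance \<rho> h = pressure \<rho> 1 h + pressure \<rho> (- 1) 0"
proof -
  have h0: "h > 0" using h plus.w_pos by simp
  have o: "optimal h h" using optimal_short[OF h0] h by simp
  have f: "(\<lambda>t. - h + h * t) \<in> profiles h" "plus.res (\<lambda>t. - h + h * t) = plus.q h"
    using linear_profile[of h] plus.res_linear[of h] plus.contact_beyond_w[of h] h h0 by simp_all
  show "h_plus \<rho> h = h" "h_minus \<rho> h = 0"
    using h_plus_optimal[OF o] h_minus_optimal[OF o] by simp_all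
  show "attains_minimum \<rho> h (\<lambda>t. - h + h * t) (\<lambda>t. 0)"
    using optimal_attains(1)[OF o f] flat_rear by simp
  show "minimal_resistance \<rho> h = pressure \<rho> 1 h + pressure \<rho> (- 1) 0"
    using minimal_resistance_optimal[OF o] plus.contact_beyond_w[of h] minus.q_0 h by simp
qed

lemma triangle_trapezium_case:
  assumes h: "us < h" "h < us + w2"
  shows "h_plus \<rho> h = us" "h_minus \<rho> h = h - us"
    "attains_minimum \<rho> h (\<lambda>t. - us + us * t)
       (\<lambda>t. if t \<le> 1 - (h - us) / w2 then - (h - us) else - (h - us) + w2 * (t - (1 - (h - us) / w2)))"
    "minimal_resistance \<rho> h = pressure \<rho> 1 us + pressure \<rho> (- 1) 0 - minus.B * (h - us)"
proof -
  have o: "optimal h us" using optimal_medium[OF h] .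
  have c: "plus.q us = pressure \<rho> 1 us" using plus.contact_beyond_w[of us] us_gt by simp
  have f: "(\<lambda>t. - us + us * t) \<in> profiles us" "plus.res (\<lambda>t. - us + us * t) = plus.q us"
    using linear_profile[of us] plus.res_linear[of us] c us_pos by simp_all
  have g: "two_slope_profile 0 w2 (h - us) \<in> profiles (h - us)"
    "minus.res (two_slope_profile 0 w2 (h - us)) = minus.q (h - us)"
    using h minus.w_gap minus.w_contact minus.q_0 minus.w_pos
    by (auto intro!: two_slope_profile minus.res_two_slope_gap)
  show "h_plus \<rho> h = us" "h_minus \<rho> h = h - us"
    using h_plus_optimal[OF o] h_minus_optimal[OF o] by simp_all
  show "attains_minimum \<rho> h (\<lambda>t. - us + us * t)
       (\<lambda>t. if t \<le> 1 - (h - us) / w2 then - (h - us) else - (h - us) + w2 * (t - (1 - (h - us) / w2)))"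
    using optimal_attains(1)[OF o f g] two_slope_profile_from_0[OF minus.w_pos] by (simp only:)
  show "minimal_resistance \<rho> h = pressure \<rho> 1 us + pressure \<rho> (- 1) 0 - minus.B * (h - us)"
    using minimal_resistance_optimal[OF o] c minus.q_first[of "h - us"] h by simp
qed

lemma long_case:
  assumes h: "us + w2 \<le> h"
  defines "hp \<equiv> h_plus \<rho> h" and "hm \<equiv> h_minus \<rho> h"
  shows "balanced \<rho> h hp hm"
    and "balanced \<rho> h a b \<Longrightarrow> a = hp \<and> b = hm"
    and "minimal_resistance \<rho> h = pressure \<rho> 1 hp + minus.q hm"
    and "hm \<notin> gap_set \<rho> (- 1) \<Longrightarrow> attains_minimum \<rho> h (\<lambda>t. - hp + hp * t) (\<lambda>t. - hm + hm * t)"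
    and "hm \<in> gap_set \<rho> (- 1) \<Longrightarrow>
      \<exists>a b. {a<..<b} \<in> components (gap_set \<rho> (- 1)) \<and> hm \<in> {a<..<b} \<and> {a<..<b} \<noteq> {0<..<w2} \<and>
        attains_minimum \<rho> h (\<lambda>t. - hp + hp * t) (two_slope_profile a b hm)"
proof -
  have hp: "us \<le> hp" and hm: "w2 \<le> hm" "hm = h - hp" and o: "optimal h hp"
    and D: "(minus.q has_real_derivative d1 hp) (at hm)"
    using long_body[OF h] by (simp_all add: hp_def hm_def h_minus_def)
  have pos: "hp > 0" "hm > 0" using hp hm us_pos minus.w_pos by auto
  have c: "plus.q hp = pressure \<rho> 1 hp" using plus.contact_beyond_w[of hp] us_gt hp by simp
  have f: "(\<lambda>t. - hp + hp * t) \<in> profiles hp" "plus.res (\<lambda>t. - hp + hp * t) = plus.q hp"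
    using linear_profile[of hp] plus.res_linear[of hp] c pos by simp_all
  show "balanced \<rho> h hp hm"
    unfolding balanced_def u0_plus_eq u0_minus_eq pbar_def
    using hp hm D plus.der[of hp] us_gt by auto
  show "a = hp \<and> b = hm" if b: "balanced \<rho> h a b"
    using balanced_optimal[OF b] optimal_unique[OF _ o] hm by auto
  show "minimal_resistance \<rho> h = pressure \<rho> 1 hp + minus.q hm"
    using minimal_resistance_optimal[OF o] c hm by simp
  show "attains_minimum \<rho> h (\<lambda>t. - hp + hp * t) (\<lambda>t. - hm + hm * t)" if "hm \<notin> gap_set \<rho> (- 1)"
  proof -
    have "minus.q hm = pressure \<rho> (- 1) hm"
      using that minus.q_le_p[of hm] pos by (auto simp: gap_sets)
    then show ?thesis
      using optimal_attains(1)[OF o f, of "\<lambda>t. - hm + hm * t"] linear_profile[of hm] minus.res_linear[of hm] hm pos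
      by simp
  qed
  show "\<exists>a b. {a<..<b} \<in> components (gap_set \<rho> (- 1)) \<and> hm \<in> {a<..<b} \<and> {a<..<b} \<noteq> {0<..<w2} \<and>
        attains_minimum \<rho> h (\<lambda>t. - hp + hp * t) (two_slope_profile a b hm)"
    if hg: "hm \<in> gap_set \<rho> (- 1)"
  proof -
    obtain a b where ab: "0 \<le> a" "a < hm" "hm < b" "minus.q a = pressure \<rho> (- 1) a"
      "minus.q b = pressure \<rho> (- 1) b" "{a<..<b} \<subseteq> {u. 0 \<le> u \<and> minus.q u < pressure \<rho> (- 1) u}"
      using minus.gap_neighbours[of hm thesis] hg unfolding gap_sets by blast
    have g: "two_slope_profile a b hm \<in> profiles hm" "minus.res (two_slope_profile a b hm) = minus.q hm"
      using ab by (auto intro!: two_slope_profile minus.res_two_slope_gap)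
    have "hm \<notin> {0<..<w2}" using hm by simp
    then have "{a<..<b} \<noteq> {0<..<w2}" using ab by (metis greaterThanLessThan_iff)
    moreover have "attains_minimum \<rho> h (\<lambda>t. - hp + hp * t) (two_slope_profile a b hm)"
      using optimal_attains(1)[OF o f, of "two_slope_profile a b hm"] g hm by simp
    moreover have "{a<..<b} \<in> components (gap_set \<rho> (- 1))"
      unfolding gap_sets by (rule minus.gap_component) (use ab in auto)
    ultimately show ?thesis using ab by (intro exI[of _ a] exI[of _ b]) simp
  qed
qed

lemma arg_min_unique:
  assumes "h > 0" shows "\<exists>!z. is_arg_min (split_resistance \<rho> h) (\<lambda>z. z \<in> {0..h}) z"
proof -
  obtain z where "optimal h z" by (rule optimal_exists[OF assms])
  then show ?thesis by (simp only: optimal_arg_min) simp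
qed

end

section \<open>A density with case 4b\<close>

text \<open>The exponent gives a finite third moment and makes the rear moment an algebraic function
  of the distance \<open>s\<close>.\<close>

definition cubic_kernel :: "real \<Rightarrow> real \<Rightarrow> real" where
  "cubic_kernel a r = 1 / (a\<^sup>2 + r\<^sup>2) ^ 3"

lemma cubic_kernel_denominator_pos: "a > 0 \<Longrightarrow> a\<^sup>2 + r\<^sup>2 > (0::real)"
  by (simp add: add_pos_nonneg)

lemma cubic_kernel_pos: "a > 0 \<Longrightarrow> cubic_kernel a r > 0"
  using cubic_kernel_denominator_pos[of a r] by (simp add: cubic_kernel_def)

lemma cubic_kernel_measurable [measurable]: "cubic_kernel a \<in> borel_measurable borel"
  unfolding cubic_kernel_def[abs_def] by measurable

lemma cubic_kernel_deriv:
  assumes "a > 0" shows "(cubic_kernel a has_real_derivative - 6 * r / (a\<^sup>2 + r\<^sup>2) ^ 4) (at r within S)"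
  unfolding cubic_kernel_def[abs_def] using cubic_kernel_denominator_pos[OF assms, of r]
  by (auto intro!: derivative_eq_intros simp: divide_simps power2_eq_square[of "(_ ^ 3)"])

lemma cubic_kernel_third_moment:
  assumes a: "a > 0" shows "set_integrable lborel {0..} (\<lambda>r. r\<^sup>2 * cubic_kernel a r * (2 * r))"
proof -
  \<comment> \<open>An antiderivative written in terms of \<open>r^2 / (a^2 + r^2)\<close>, which
    tends to 1.\<close>
  let ?F = "\<lambda>r::real. (r\<^sup>2 / (a\<^sup>2 + r\<^sup>2))\<^sup>2 / (2 * a\<^sup>2)"
  have "(\<integral>\<^sup>+r. ennreal (r\<^sup>2 * cubic_kernel a r * (2 * r)) * indicator {0..} r \<partial>lborel) = ennreal (1 / (2 * a\<^sup>2) - ?F 0)"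
  proof (rule nn_integral_FTC_atLeast)
    fix r :: real assume r: "0 \<le> r"
    show "0 \<le> r\<^sup>2 * cubic_kernel a r * (2 * r)" using r cubic_kernel_pos[OF a, of r] by simp
    have p: "a\<^sup>2 + r\<^sup>2 > 0" using cubic_kernel_denominator_pos[OF a] .
    show "(?F has_real_derivative r\<^sup>2 * cubic_kernel a r * (2 * r)) (at r)"
      using p a
      by (auto intro!: derivative_eq_intros simp: cubic_kernel_def divide_simps)
         (simp add: power_def numeral_eq_Suc algebra_simps)
  next
    have "filterlim (\<lambda>r::real. a\<^sup>2 + r\<^sup>2) at_top at_top"
      by (intro filterlim_tendsto_add_at_top[OF tendsto_const] filterlim_pow_at_top filterlim_ident) simp
    then have "((\<lambda>r. 1 - a\<^sup>2 * inverse (a\<^sup>2 + r\<^sup>2)) \<longlongrightarrow> 1 - a\<^sup>2 * 0) at_top"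
      by (intro tendsto_intros tendsto_inverse_0_at_top)
    moreover have "1 - a\<^sup>2 * inverse (a\<^sup>2 + r\<^sup>2) = r\<^sup>2 / (a\<^sup>2 + r\<^sup>2)" for r
    proof -
      have "(a\<^sup>2 + r\<^sup>2) * inverse (a\<^sup>2 + r\<^sup>2) = 1"
        using a by (intro right_inverse) simp
      then show ?thesis by (simp only: distrib_right divide_inverse)
    qed
    ultimately have "((\<lambda>r. r\<^sup>2 / (a\<^sup>2 + r\<^sup>2)) \<longlongrightarrow> 1) at_top" by simp
    then have "(?F \<longlongrightarrow> 1\<^sup>2 / (2 * a\<^sup>2)) at_top" using a by (intro tendsto_intros) auto
    then show "(?F \<longlongrightarrow> 1 / (2 * a\<^sup>2)) at_top" by simp
  qed measurable
  moreover have "(\<integral>\<^sup>+r. ennreal (indicator {0..} r *\<^sub>R (r\<^sup>2 * cubic_kernel a r * (2 * r))) \<partial>lborel)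
      = (\<integral>\<^sup>+r. ennreal (r\<^sup>2 * cubic_kernel a r * (2 * r)) * indicator {0..} r \<partial>lborel)"
    by (rule nn_integral_cong) (simp add: indicator_def)
  ultimately have "(\<integral>\<^sup>+r. ennreal (indicator {0..} r *\<^sub>R (r\<^sup>2 * cubic_kernel a r * (2 * r))) \<partial>lborel)
      = ennreal (1 / (2 * a\<^sup>2))"
    by simp
  then show ?thesis unfolding set_integrable_def
    by (intro integrableI_nonneg) (use cubic_kernel_pos[OF a] in \<open>auto simp: indicator_def less_imp_le\<close>)
qed

text \<open>Left unevaluated: it is a common factor of the rear moments at both scales, and what
  matters is that it is positive and finite.\<close>

definition line_mass :: ennreal where
  "line_mass = (\<integral>\<^sup>+x. ennreal (cubic_kernel 1 x) \<partial>lborel)"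

lemma cubic_kernel_line_integral:
  assumes w: "w > 0"
  shows "(\<integral>\<^sup>+x. ennreal (cubic_kernel w x) \<partial>lborel) = line_mass * ennreal (1 / w ^ 5)"
proof -
  have "(\<integral>\<^sup>+x. ennreal (cubic_kernel w x) \<partial>lborel) = \<bar>w\<bar> * (\<integral>\<^sup>+x. ennreal (cubic_kernel w (0 + w * x)) \<partial>lborel)"
    by (rule nn_integral_real_affine) (use w in auto)
  also have "(\<lambda>x. cubic_kernel w (0 + w * x)) = (\<lambda>x. 1 / w ^ 6 * cubic_kernel 1 x)"
  proof
    fix x
    have "w\<^sup>2 + (w * x)\<^sup>2 = w\<^sup>2 * (1 + x\<^sup>2)" by (simp add: power_mult_distrib algebra_simps)
    then show "cubic_kernel w (0 + w * x) = 1 / w ^ 6 * cubic_kernel 1 x"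
      by (simp add: cubic_kernel_def power_mult_distrib)
  qed
  also have "(\<integral>\<^sup>+x. ennreal (1 / w ^ 6 * cubic_kernel 1 x) \<partial>lborel) = ennreal (1 / w ^ 6) * line_mass"
    unfolding line_mass_def using w cubic_kernel_pos[of 1]
    by (subst nn_integral_cmult[symmetric])
       (auto intro!: nn_integral_cong ennreal_mult simp del: times_divide_eq_left simp: less_imp_le)
  also have "ennreal \<bar>w\<bar> * (ennreal (1 / w ^ 6) * line_mass) = line_mass * ennreal (1 / w ^ 5)"
  proof -
    have "\<bar>w\<bar> * (1 / w ^ 6) = 1 / w ^ 5" using w by (simp add: power_def numeral_eq_Suc)
    then have "ennreal \<bar>w\<bar> * ennreal (1 / w ^ 6) = ennreal (1 / w ^ 5)"
      using w by (subst ennreal_mult[symmetric]) auto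
    then show ?thesis by (metis mult.assoc mult.commute)
  qed
  finally show ?thesis .
qed

lemma cubic_kernel_half_line_integral:
  assumes a: "a > 0" and s: "s \<ge> 0"
  shows "(\<integral>\<^sup>+y. ennreal ((max (- s - y) 0)\<^sup>2 / sqrt (a\<^sup>2 + y\<^sup>2) ^ 5) \<partial>lborel)
    = ennreal ((sqrt (a\<^sup>2 + s\<^sup>2) - s)\<^sup>2 / (3 * a ^ 4))"
proof -
  define w where "w = (\<lambda>y::real. sqrt (a\<^sup>2 + y\<^sup>2))"
  have w: "w y > 0" "(w y)\<^sup>2 = a\<^sup>2 + y\<^sup>2" for y
    using cubic_kernel_denominator_pos[OF a, of y] by (auto simp: w_def less_imp_le)
  have w_deriv: "(w has_real_derivative y / w y) (at y)" for y
    unfolding w_def using cubic_kernel_denominator_pos[OF a, of y]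
    by (auto intro!: derivative_eq_intros simp: divide_simps)
  have [measurable]: "w \<in> borel_measurable borel" unfolding w_def by measurable
  define f where "f = (\<lambda>y. (y - s)\<^sup>2 / w y ^ 5)"
  \<comment> \<open>Termwise antiderivative after expanding \<open>(y - s)^2\<close>: the three
    summands differentiate to \<open>y^2 / w^5\<close>, \<open>- 2 * s * y / w^5\<close> and
    \<open>s^2 / w^5\<close>.\<close>
  define F where "F = (\<lambda>y. (y / w y) ^ 3 / (3 * a\<^sup>2) + 2 * s / 3 * (1 / w y) ^ 3 + s\<^sup>2 / a ^ 4 * (y / w y - (y / w y) ^ 3 / 3))"
  have F_deriv: "(F has_real_derivative f y) (at y)" for y
  proof -
    have q: "((\<lambda>y. y / w y) has_real_derivative a\<^sup>2 / w y ^ 3) (at y)"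
    proof -
      have "((\<lambda>y. y / w y) has_real_derivative (1 * w y - y * (y / w y)) / (w y * w y)) (at y)"
        by (rule DERIV_divide[OF DERIV_ident w_deriv]) (use w(1)[of y] in simp)
      moreover have "(1 * w y - y * (y / w y)) / (w y * w y) = ((w y)\<^sup>2 - y\<^sup>2) / w y ^ 3"
        using w(1)[of y] by (simp add: field_simps power2_eq_square power3_eq_cube)
      ultimately show ?thesis by (simp add: w(2))
    qed
    have i: "((\<lambda>y. 1 / w y) has_real_derivative - y / w y ^ 3) (at y)"
      using w(1)[of y] by (auto intro!: derivative_eq_intros w_deriv simp: power3_eq_cube)
    have q3: "((\<lambda>y. (y / w y) ^ 3) has_real_derivative 3 * (y / w y)\<^sup>2 * (a\<^sup>2 / w y ^ 3)) (at y)"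
      using DERIV_power[OF q, of 3] by (simp add: mult_ac)
    have i3: "((\<lambda>y. (1 / w y) ^ 3) has_real_derivative 3 * (1 / w y)\<^sup>2 * (- y / w y ^ 3)) (at y)"
      using DERIV_power[OF i, of 3] by (simp add: mult_ac)
    have "(F has_real_derivative
        3 * (y / w y)\<^sup>2 * (a\<^sup>2 / w y ^ 3) / (3 * a\<^sup>2) + 2 * s / 3 * (3 * (1 / w y)\<^sup>2 * (- y / w y ^ 3))
        + s\<^sup>2 / a ^ 4 * (a\<^sup>2 / w y ^ 3 - 3 * (y / w y)\<^sup>2 * (a\<^sup>2 / w y ^ 3) / 3)) (at y)"
      unfolding F_def
      by (rule DERIV_add[OF DERIV_add[OF DERIV_cdivide[OF q3] DERIV_cmult[OF i3]]
            DERIV_cmult[OF DERIV_diff[OF q DERIV_cdivide[OF q3]]]])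
    moreover have "3 * (y / w y)\<^sup>2 * (a\<^sup>2 / w y ^ 3) / (3 * a\<^sup>2) = y\<^sup>2 / w y ^ 5"
      using a w(1)[of y] by (simp add: power_divide power_def numeral_eq_Suc)
    moreover have "2 * s / 3 * (3 * (1 / w y)\<^sup>2 * (- y / w y ^ 3)) = - 2 * s * y / w y ^ 5"
      using w(1)[of y] by (simp add: power_divide power_def numeral_eq_Suc)
    moreover have "s\<^sup>2 / a ^ 4 * (a\<^sup>2 / w y ^ 3 - 3 * (y / w y)\<^sup>2 * (a\<^sup>2 / w y ^ 3) / 3) = s\<^sup>2 / w y ^ 5"
    proof -
      have "a\<^sup>2 / w y ^ 3 - 3 * (y / w y)\<^sup>2 * (a\<^sup>2 / w y ^ 3) / 3 = a\<^sup>2 * ((w y)\<^sup>2 - y\<^sup>2) / w y ^ 5"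
        using w(1)[of y] by (simp add: power_divide divide_simps) (simp add: power_def numeral_eq_Suc algebra_simps)
      also have "a\<^sup>2 * ((w y)\<^sup>2 - y\<^sup>2) = a ^ 4" unfolding w(2) by (simp add: power_def numeral_eq_Suc)
      finally have "a\<^sup>2 / w y ^ 3 - 3 * (y / w y)\<^sup>2 * (a\<^sup>2 / w y ^ 3) / 3 = a ^ 4 / w y ^ 5" .
      then show ?thesis using a by (simp only:) simp
    qed
    moreover have "f y = y\<^sup>2 / w y ^ 5 + - 2 * s * y / w y ^ 5 + s\<^sup>2 / w y ^ 5"
      by (simp add: f_def power2_diff add_divide_distrib diff_divide_distrib)
    ultimately show ?thesis by simp
  qed
  have F_lim: "(F \<longlongrightarrow> 1 / (3 * a\<^sup>2) + s\<^sup>2 / a ^ 4 * (1 - 1 / 3)) at_top"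
  proof -
    have "filterlim w at_top at_top"
    proof (rule filterlim_at_top_mono[OF filterlim_ident])
      have "y \<le> w y" for y unfolding w_def by (rule real_le_rsqrt) simp
      then show "\<forall>\<^sub>F y in at_top. y \<le> w y" by simp
    qed
    then have inv: "((\<lambda>y. inverse (w y)) \<longlongrightarrow> 0) at_top" by (rule tendsto_inverse_0_at_top)
    have "((\<lambda>y. sqrt (1 - (a * inverse (w y))\<^sup>2)) \<longlongrightarrow> sqrt (1 - (a * 0)\<^sup>2)) at_top"
      by (intro tendsto_intros inv)
    moreover have "\<forall>\<^sub>F y in at_top. sqrt (1 - (a * inverse (w y))\<^sup>2) = y / w y"
      using eventually_ge_at_top[of 0]
    proof eventually_elim
      case (elim y)
      have "1 - (a * inverse (w y))\<^sup>2 = ((w y)\<^sup>2 - a\<^sup>2) / (w y)\<^sup>2"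
        using w(1)[of y] by (simp add: field_simps)
      also have "\<dots> = (y / w y)\<^sup>2" by (simp add: w(2) power_divide)
      finally show ?case using elim w(1)[of y] by simp
    qed
    ultimately have quo: "((\<lambda>y. y / w y) \<longlongrightarrow> 1) at_top" by (simp add: tendsto_cong)
    have "(F \<longlongrightarrow> 1 ^ 3 / (3 * a\<^sup>2) + 2 * s / 3 * 0 ^ 3 + s\<^sup>2 / a ^ 4 * (1 - 1 ^ 3 / 3)) at_top"
      unfolding F_def using a inv by (intro tendsto_intros quo) (auto simp: inverse_eq_divide)
    then show ?thesis by simp
  qed
  have total: "1 / (3 * a\<^sup>2) + s\<^sup>2 / a ^ 4 * (1 - 1 / 3) - F s = (w s - s)\<^sup>2 / (3 * a ^ 4)"
  proof -
    define W where "W = w s"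
    have W: "W > 0" "a\<^sup>2 = W\<^sup>2 - s\<^sup>2" using w[of s] by (auto simp: W_def)
    have a4: "a ^ 4 = (a\<^sup>2)\<^sup>2" by simp
    have nz: "W\<^sup>2 - s\<^sup>2 \<noteq> 0" using a W(2) by auto
    show ?thesis
      unfolding F_def W_def[symmetric] a4 W(2) using nz W(1)
      by (simp add: divide_simps) algebra
  qed
  have "(\<integral>\<^sup>+y. ennreal ((max (- s - y) 0)\<^sup>2 / w y ^ 5) \<partial>lborel)
      = ennreal \<bar>- 1\<bar> * (\<integral>\<^sup>+y. ennreal ((max (- s - (0 + - 1 * y)) 0)\<^sup>2 / w (0 + - 1 * y) ^ 5) \<partial>lborel)"
    by (rule nn_integral_real_affine) auto
  also have "\<dots> = (\<integral>\<^sup>+y. ennreal (f y) * indicator {s..} y \<partial>lborel)"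
    by (auto intro!: nn_integral_cong simp: f_def w_def indicator_def)
  also have "\<dots> = ennreal (1 / (3 * a\<^sup>2) + s\<^sup>2 / a ^ 4 * (1 - 1 / 3) - F s)"
    by (rule nn_integral_FTC_atLeast[OF _ F_deriv _ F_lim])
       (use w(1) in \<open>auto simp: f_def less_imp_le\<close>)
  finally show ?thesis unfolding total by (simp add: w_def)
qed

text \<open>On the horizontal line at height \<open>y\<close> the kernel of width \<open>a\<close>
  becomes the kernel of width \<open>sqrt (a^2 + y^2)\<close>, whose integral is known by
  scaling.\<close>

lemma cubic_kernel_plane_integral:
  assumes a: "a > 0" and s: "s \<ge> 0"
  shows "(\<integral>\<^sup>+v. ennreal ((max (- s - snd v) 0)\<^sup>2 * cubic_kernel a (norm v)) \<partial>plane)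
    = line_mass * ennreal ((sqrt (a\<^sup>2 + s\<^sup>2) - s)\<^sup>2 / (3 * a ^ 4))"
proof -
  have k: "cubic_kernel a (norm (x, y)) = cubic_kernel (sqrt (a\<^sup>2 + y\<^sup>2)) x" for x y :: real
    using cubic_kernel_denominator_pos[OF a, of y] by (simp add: cubic_kernel_def norm_Pair algebra_simps)
  have inner: "(\<integral>\<^sup>+x. ennreal ((max (- s - y) 0)\<^sup>2 * cubic_kernel a (norm (x::real, y))) \<partial>lborel)
      = line_mass * ennreal ((max (- s - y) 0)\<^sup>2 / sqrt (a\<^sup>2 + y\<^sup>2) ^ 5)" for y :: real
  proof -
    have p: "sqrt (a\<^sup>2 + y\<^sup>2) > 0" using cubic_kernel_denominator_pos[OF a, of y] by simp
    have "(\<integral>\<^sup>+x. ennreal ((max (- s - y) 0)\<^sup>2 * cubic_kernel a (norm (x::real, y))) \<partial>lborel)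
        = ennreal ((max (- s - y) 0)\<^sup>2) * (\<integral>\<^sup>+x. ennreal (cubic_kernel (sqrt (a\<^sup>2 + y\<^sup>2)) x) \<partial>lborel)"
      unfolding k using cubic_kernel_pos[OF p]
      by (subst nn_integral_cmult[symmetric]) (auto intro!: nn_integral_cong ennreal_mult simp: less_imp_le)
    also have "\<dots> = line_mass * (ennreal ((max (- s - y) 0)\<^sup>2) * ennreal (1 / sqrt (a\<^sup>2 + y\<^sup>2) ^ 5))"
      unfolding cubic_kernel_line_integral[OF p] by (simp only: mult.left_commute)
    also have "ennreal ((max (- s - y) 0)\<^sup>2) * ennreal (1 / sqrt (a\<^sup>2 + y\<^sup>2) ^ 5)
        = ennreal ((max (- s - y) 0)\<^sup>2 / sqrt (a\<^sup>2 + y\<^sup>2) ^ 5)"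
      using p by (subst ennreal_mult[symmetric]) auto
    finally show ?thesis .
  qed
  have "(\<integral>\<^sup>+v. ennreal ((max (- s - snd v) 0)\<^sup>2 * cubic_kernel a (norm v)) \<partial>plane)
      = (\<integral>\<^sup>+y. line_mass * ennreal ((max (- s - y) 0)\<^sup>2 / sqrt (a\<^sup>2 + y\<^sup>2) ^ 5) \<partial>lborel)"
    by (subst nn_integral_lborel_pair(2)) (simp_all add: inner)
  also have "\<dots> = line_mass * ennreal ((sqrt (a\<^sup>2 + s\<^sup>2) - s)\<^sup>2 / (3 * a ^ 4))"
    unfolding cubic_kernel_half_line_integral[OF a s, symmetric] by (rule nn_integral_cmult) measurable
  finally show ?thesis .
qed

text \<open>
  The two kernels make the rear pressure drop at two very different scales of \<open>u\<close>, the wide one first and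
  by 1/100 of the drop due to the narrow one, which creates a second region of non-convexity.
\<close>

definition two_scale_density :: "real \<Rightarrow> real" where
  "two_scale_density r = cubic_kernel 1 r + 10 ^ 4 * cubic_kernel (10 ^ 3) r"

lemma two_scale_density_A2: "two_scale_density \<in> class_A2"
proof -
  define \<sigma>' where "\<sigma>' = (\<lambda>r::real. - 6 * r / (1\<^sup>2 + r\<^sup>2) ^ 4 + 10 ^ 4 * (- 6 * r / ((10 ^ 3)\<^sup>2 + r\<^sup>2) ^ 4))"
  define N where "N = (\<lambda>r::real. 1 / (1\<^sup>2 + r\<^sup>2) ^ 4 + 10 ^ 4 * (1 / ((10 ^ 3)\<^sup>2 + r\<^sup>2) ^ 4))"
  have quo: "\<sigma>' r / r = - 6 * N r" if "r > 0" for r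
  proof -
    have "\<sigma>' r = - 6 * N r * r" by (simp add: \<sigma>'_def N_def algebra_simps)
    then show ?thesis using that by simp
  qed
  have p: "1\<^sup>2 + r\<^sup>2 > (0::real)" "(10 ^ 3)\<^sup>2 + r\<^sup>2 > (0::real)" for r :: real
    by (intro cubic_kernel_denominator_pos; simp)+
  have N_pos: "N r > 0" for r unfolding N_def using p[of r] by (intro add_pos_pos) auto
  have N_dec: "N s < N r" if "0 \<le> r" "r < s" for r s
  proof -
    have "r\<^sup>2 < s\<^sup>2" using that by (intro power_strict_mono) auto
    then have lt: "1 / (A\<^sup>2 + s\<^sup>2) ^ 4 < 1 / (A\<^sup>2 + r\<^sup>2) ^ 4" if "A > 0" for A :: real
      using cubic_kernel_denominator_pos[OF that, of r] cubic_kernel_denominator_pos[OF that, of s]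
      by (intro divide_strict_left_mono power_strict_mono mult_pos_pos) auto
    show ?thesis unfolding N_def using lt[of 1] lt[of "10 ^ 3"] by simp
  qed
  have "continuous_on {0..} \<sigma>'" unfolding \<sigma>'_def
    using p by (intro continuous_intros) (auto simp: less_imp_neq[symmetric] dest: less_imp_neq)
  moreover have "(two_scale_density has_real_derivative \<sigma>' r) (at r within {0..})" for r
    unfolding two_scale_density_def[abs_def] \<sigma>'_def
    by (intro DERIV_add DERIV_cmult cubic_kernel_deriv) auto
  moreover have "\<sigma>' r / r < 0" if "r > 0" for r using quo[OF that] N_pos[of r] by simp
  moreover have "bdd_below ((\<lambda>r. \<sigma>' r / r) ` {0<..})"
    by (rule bdd_belowI[of _ "- 6 * N 0"]) (use quo N_dec[of 0] in \<open>auto intro: less_imp_le\<close>)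
  moreover have "strict_mono_on {0<..} (\<lambda>r. \<sigma>' r / r)"
    by (rule strict_mono_onI) (use quo N_dec in \<open>auto simp: less_imp_le\<close>)
  moreover have "set_integrable lborel {0..} (\<lambda>r. r\<^sup>2 * two_scale_density r * (2 * r))"
  proof -
    have "set_integrable lborel {0..} (\<lambda>r. r\<^sup>2 * cubic_kernel 1 r * (2 * r) + 10 ^ 4 * (r\<^sup>2 * cubic_kernel (10 ^ 3) r * (2 * r)))"
      by (intro set_integral_add set_integrable_mult_right cubic_kernel_third_moment) auto
    then show ?thesis by (simp add: two_scale_density_def algebra_simps)
  qed
  ultimately show ?thesis unfolding class_A2_def by blast
qed

text \<open>A multiple of the rear pressure with the sign reversed, for \<open>s = V * cosine u\<close>.\<close>

definition two_scale_drop :: "real \<Rightarrow> real" where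
  "two_scale_drop s = (sqrt (1\<^sup>2 + s\<^sup>2) - s)\<^sup>2 + (sqrt ((10 ^ 3)\<^sup>2 + s\<^sup>2) - s)\<^sup>2 / 10 ^ 8"

section \<open>Numerical bounds for the two-scale rear pressure\<close>

lemma hyperbola_gap_bounds:
  fixes a s :: real
  assumes "a \<ge> 0" "s \<ge> 0" shows "0 \<le> sqrt (a\<^sup>2 + s\<^sup>2) - s" "sqrt (a\<^sup>2 + s\<^sup>2) - s \<le> a"
proof -
  have "s \<le> sqrt (a\<^sup>2 + s\<^sup>2)" by (rule real_le_rsqrt) simp
  then show "0 \<le> sqrt (a\<^sup>2 + s\<^sup>2) - s" by simp
  have "sqrt (a\<^sup>2 + s\<^sup>2) \<le> a + s" using assms by (intro real_le_lsqrt) (auto simp: power2_sum)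
  then show "sqrt (a\<^sup>2 + s\<^sup>2) - s \<le> a" by simp
qed

lemma hyperbola_gap_antimono:
  fixes a s t :: real
  assumes "0 \<le> s" "s \<le> t" shows "sqrt (a\<^sup>2 + t\<^sup>2) - t \<le> sqrt (a\<^sup>2 + s\<^sup>2) - s"
proof -
  have r: "s \<le> sqrt (a\<^sup>2 + s\<^sup>2)" by (rule real_le_rsqrt) simp
  have "(t - s) * s \<le> (t - s) * sqrt (a\<^sup>2 + s\<^sup>2)" using assms r by (intro mult_left_mono) auto
  then have "a\<^sup>2 + t\<^sup>2 \<le> (sqrt (a\<^sup>2 + s\<^sup>2) + (t - s))\<^sup>2"
    by (simp add: power2_sum) (simp add: power2_eq_square algebra_simps)
  then have "sqrt (a\<^sup>2 + t\<^sup>2) \<le> sqrt (a\<^sup>2 + s\<^sup>2) + (t - s)" using assms r by (intro real_le_lsqrt) auto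
  then show ?thesis by simp
qed

lemma two_scale_drop_nonneg: "two_scale_drop s \<ge> 0"
  by (simp add: two_scale_drop_def)

lemma two_scale_drop_le: "s \<ge> 0 \<Longrightarrow> two_scale_drop s \<le> 101 / 100"
  using power_mono[OF hyperbola_gap_bounds(2,1), of 1 s 2] power_mono[OF hyperbola_gap_bounds(2,1), of "10 ^ 3" s 2]
  by (simp add: two_scale_drop_def)

text \<open>\<open>10 ^ 5\<close> is the value of \<open>V\<close> in the example, so this is the
  point \<open>u = 0\<close>, before either drop.\<close>

lemma two_scale_drop_at_0: "two_scale_drop (10 ^ 5) \<le> 1 / 10 ^ 6"
proof -
  have "sqrt (1\<^sup>2 + (10 ^ 5)\<^sup>2) \<le> 10 ^ 5 + (1 / 10 ^ 5 :: real)" "sqrt ((10 ^ 3)\<^sup>2 + (10 ^ 5)\<^sup>2) \<le> 10 ^ 5 + (5 :: real)"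
    by (rule real_le_lsqrt; simp add: power2_eq_square)+
  then have "sqrt (1\<^sup>2 + (10 ^ 5)\<^sup>2) - 10 ^ 5 \<le> (1 / 10 ^ 5 :: real)" "sqrt ((10 ^ 3)\<^sup>2 + (10 ^ 5)\<^sup>2) - 10 ^ 5 \<le> (5 :: real)"
    by simp_all
  from power_mono[OF this(1) hyperbola_gap_bounds(1), of 2] power_mono[OF this(2) hyperbola_gap_bounds(1), of 2]
  show ?thesis by (simp add: two_scale_drop_def power_divide)
qed

text \<open>For \<open>s\<close> up to half the width of a kernel, its drop has reached at least the
  fraction ((sqrt 5 - 1) / 2)^2, about 0.38, of the total; for the wide kernel the total is
  1/100.\<close>

lemma two_scale_drop_ge_wide:
  assumes "0 \<le> s" "s \<le> 500" shows "two_scale_drop s \<ge> 38 / 10 ^ 4"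
proof -
  have "1118 \<le> sqrt ((10 ^ 3)\<^sup>2 + 500\<^sup>2)" by (rule real_le_rsqrt) simp
  then have "618 \<le> sqrt ((10 ^ 3)\<^sup>2 + s\<^sup>2) - s" using hyperbola_gap_antimono[OF assms, of "10 ^ 3"] by simp
  from power_mono[OF this, of 2] have "38 / 10 ^ 4 \<le> (sqrt ((10 ^ 3)\<^sup>2 + s\<^sup>2) - s)\<^sup>2 / 10 ^ 8" by simp
  then show ?thesis unfolding two_scale_drop_def using zero_le_power2[of "sqrt (1\<^sup>2 + s\<^sup>2) - s"] by linarith
qed

lemma two_scale_drop_ge_narrow:
  assumes "0 \<le> s" "s \<le> 1 / 2" shows "two_scale_drop s \<ge> 38 / 100"
proof -
  have "1118 / 1000 \<le> sqrt (1\<^sup>2 + (1 / 2)\<^sup>2)" by (rule real_le_rsqrt) (simp add: power2_eq_square)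
  then have "618 / 1000 \<le> sqrt (1\<^sup>2 + s\<^sup>2) - s" using hyperbola_gap_antimono[OF assms, of 1] by simp
  from power_mono[OF this, of 2] have "38 / 100 \<le> (sqrt (1\<^sup>2 + s\<^sup>2) - s)\<^sup>2" by (simp add: power2_eq_square)
  then show ?thesis unfolding two_scale_drop_def
    using zero_le_power2[of "sqrt ((10 ^ 3)\<^sup>2 + s\<^sup>2) - s"] by (simp add: add_increasing2)
qed

text \<open>The narrow kernel has reached at most 0.104 here, and the wide one contributes at most
  its total of 0.01.\<close>

lemma two_scale_drop_le_middle:
  assumes "7 / 5 \<le> s" shows "two_scale_drop s \<le> 12 / 100"
proof -
  have "sqrt (1\<^sup>2 + (7 / 5)\<^sup>2) \<le> 1721 / 1000" by (rule real_le_lsqrt) (simp_all add: power2_eq_square)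
  then have "sqrt (1\<^sup>2 + s\<^sup>2) - s \<le> 321 / 1000" using hyperbola_gap_antimono[of "7 / 5" s 1] assms by simp
  from power_mono[OF this hyperbola_gap_bounds(1), of 2]
  have "(sqrt (1\<^sup>2 + s\<^sup>2) - s)\<^sup>2 \<le> 104 / 1000" using assms by (simp add: power2_eq_square)
  moreover have "(sqrt ((10 ^ 3)\<^sup>2 + s\<^sup>2) - s)\<^sup>2 / 10 ^ 8 \<le> 1 / 100"
    using power_mono[OF hyperbola_gap_bounds(2,1), of "10 ^ 3" s 2] assms by simp
  ultimately show ?thesis by (simp add: two_scale_drop_def)
qed

text \<open>The rear length 70000 lies in a gap, as \<open>?p\<close> is there above the chord from
  0 to 200000: 0.35 times 0.38 exceeds 0.12. It is not in the first gap, since the drop already made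
  at 200 forces a first slope that, kept up to 70000, would exceed the total drop: 0.0037 / 200
  times 70000 is 1.295, more than 1.01.\<close>

lemma two_scale_case_4b: "case_4b (flux_density two_scale_density (10 ^ 5)) \<noteq> {}"
proof -
  define V :: real where "V = 10 ^ 5"
  let ?\<rho> = "flux_density two_scale_density V"
  let ?p = "pressure ?\<rho> (- 1)"
  interpret density: radial_density two_scale_density
    by (rule class_A2_radial_density[OF two_scale_density_A2])
  interpret medium: moving_medium two_scale_density V by unfold_locales (simp add: V_def)
  interpret narrow: radial_density "cubic_kernel 1"
  proof
    show "cubic_kernel 1 s \<le> cubic_kernel 1 r" if "0 \<le> r" "r \<le> s" for r s
      using that cubic_kernel_denominator_pos[of 1 r] cubic_kernel_denominator_pos[of 1 s]
      by (auto simp: cubic_kernel_def intro!: divide_left_mono power_mono mult_pos_pos)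
    show "continuous_on {0..} (cubic_kernel 1)" by (rule DERIV_continuous_on) (rule cubic_kernel_deriv, simp)
    have "set_integrable lborel {0..} (\<lambda>r. (1 / 2) * (r\<^sup>2 * cubic_kernel 1 r * (2 * r)))"
      by (intro set_integrable_mult_right cubic_kernel_third_moment) simp
    then show "set_integrable lborel {0..} (\<lambda>r. r ^ 3 * cubic_kernel 1 r)"
      by (simp add: power2_eq_square power3_eq_cube mult_ac)
  qed (simp add: cubic_kernel_pos)
  have n: "density.A2 (- s) = enn2real (line_mass * ennreal (two_scale_drop s / 3))" if s: "s \<ge> 0" for s
  proof -
    have "density.A2 (- s) = enn2real (\<integral>\<^sup>+v. ennreal ((max (- s - snd v) 0)\<^sup>2 * two_scale_density (norm v)) \<partial>plane)"
      unfolding density.A2_def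
      by (rule integral_eq_nn_integral) (auto intro!: mult_nonneg_nonneg less_imp_le[OF density.pos])
    also have "(\<integral>\<^sup>+v. ennreal ((max (- s - snd v) 0)\<^sup>2 * two_scale_density (norm v)) \<partial>plane)
        = (\<integral>\<^sup>+v. ennreal ((max (- s - snd v) 0)\<^sup>2 * cubic_kernel 1 (norm v))
            + ennreal (10 ^ 4) * ennreal ((max (- s - snd v) 0)\<^sup>2 * cubic_kernel (10 ^ 3) (norm v)) \<partial>plane)"
    proof (rule nn_integral_cong)
      fix v :: "real \<times> real"
      have "cubic_kernel 1 (norm v) \<ge> 0" "cubic_kernel (10 ^ 3) (norm v) \<ge> 0" by (intro less_imp_le cubic_kernel_pos; simp)+
      then show "ennreal ((max (- s - snd v) 0)\<^sup>2 * two_scale_density (norm v))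
          = ennreal ((max (- s - snd v) 0)\<^sup>2 * cubic_kernel 1 (norm v))
            + ennreal (10 ^ 4) * ennreal ((max (- s - snd v) 0)\<^sup>2 * cubic_kernel (10 ^ 3) (norm v))"
        by (subst ennreal_mult[symmetric], simp, simp, subst ennreal_plus[symmetric])
           (auto simp: two_scale_density_def algebra_simps simp del: ennreal_plus)
    qed
    also have "\<dots> = line_mass * ennreal ((sqrt (1\<^sup>2 + s\<^sup>2) - s)\<^sup>2 / (3 * 1 ^ 4))
        + ennreal (10 ^ 4) * (line_mass * ennreal ((sqrt ((10 ^ 3)\<^sup>2 + s\<^sup>2) - s)\<^sup>2 / (3 * (10 ^ 3) ^ 4)))"
      using s by (subst nn_integral_add, measurable, subst nn_integral_cmult, measurable)
         (simp only: cubic_kernel_plane_integral zero_less_one zero_less_power zero_less_numeral)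
    also have "\<dots> = line_mass * (ennreal ((sqrt (1\<^sup>2 + s\<^sup>2) - s)\<^sup>2 / (3 * 1 ^ 4))
        + ennreal (10 ^ 4) * ennreal ((sqrt ((10 ^ 3)\<^sup>2 + s\<^sup>2) - s)\<^sup>2 / (3 * (10 ^ 3) ^ 4)))"
      by (simp only: distrib_left mult.left_commute)
    also have "ennreal ((sqrt (1\<^sup>2 + s\<^sup>2) - s)\<^sup>2 / (3 * 1 ^ 4))
        + ennreal (10 ^ 4) * ennreal ((sqrt ((10 ^ 3)\<^sup>2 + s\<^sup>2) - s)\<^sup>2 / (3 * (10 ^ 3) ^ 4))
        = ennreal (two_scale_drop s / 3)"
      by (subst ennreal_mult[symmetric], simp, simp, subst ennreal_plus[symmetric])
         (auto simp: two_scale_drop_def simp del: ennreal_plus)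
    finally show ?thesis .
  qed
  \<comment> \<open>Finiteness of \<open>line_mass\<close> is read off from the finite moment of the
    narrow kernel at \<open>s = 0\<close>.\<close>
  have "line_mass * ennreal (1 / 3) = (\<integral>\<^sup>+v. ennreal ((max (- 0 - snd v) 0)\<^sup>2 * cubic_kernel 1 (norm v)) \<partial>plane)"
    using cubic_kernel_plane_integral[of 1 0] by simp
  also have "\<dots> = ennreal (narrow.A2 (- 0))" unfolding narrow.A2_def
    by (intro nn_integral_eq_integral narrow.A2_integrable)
       (auto intro!: mult_nonneg_nonneg less_imp_le[OF cubic_kernel_pos])
  finally have "line_mass \<noteq> \<infinity>" by (auto simp: ennreal_top_mult)
  define k where "k = enn2real line_mass / 3"
  have p: "?p u = - k * two_scale_drop (V * cosine u)" for u
  proof -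
    have "?p u = - density.A2 (- (V * cosine u))"
      using medium.pressure_formula[of "- 1" u] by simp
    then show ?thesis using n[of "V * cosine u"] cosine_pos[of u] two_scale_drop_nonneg[of "V * cosine u"] medium.V_pos
      by (simp add: k_def enn2real_mult)
  qed
  \<comment> \<open>If \<open>k\<close> vanished, the pressure would be constant, against its strict
    decrease.\<close>
  have k: "k > 0"
  proof -
    interpret law: drag_law ?p "medium.drag_slope (- 1)" "- density.A2 V" "density.A2 V"
      by (rule medium.drag_law_pressure) simp
    have "?p 1 < ?p 0" by (rule law.p_strict_decreasing) auto
    then have "k \<noteq> 0" by (auto simp: p)
    then show ?thesis by (simp add: k_def less_le)
  qed
  obtain d1 c1 C1 w1 m d2 c2 C2 w2 us where "two_faces_star ?\<rho> d1 c1 C1 w1 m d2 c2 C2 w2 us"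
    using medium.two_faces_star_exists by metis
  then interpret two_faces_star ?\<rho> d1 c1 C1 w1 m d2 c2 C2 w2 us .
  \<comment> \<open>\<open>cosine u\<close> is at most \<open>1 / u\<close>; so
    \<open>u = 200\<close> gives \<open>s \<le> 500\<close> and \<open>u = 200000\<close> gives
    \<open>s \<le> 1 / 2\<close>.\<close>
  have le: "V * cosine u \<le> s" if "V / s \<le> u" "s > 0" for u s
  proof -
    have "V / s \<le> sqrt (1 + u\<^sup>2)" using that by (intro order_trans[OF that(1)] real_le_rsqrt) simp
    moreover have "sqrt (1 + u\<^sup>2) > 0" by (simp add: add_pos_nonneg)
    ultimately show ?thesis using that(2) by (simp add: cosine_def field_simps)
  qed
  have cpos: "V * cosine u \<ge> 0" for u using cosine_pos[of u] medium.V_pos by simp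
  have p0: "- k * (1 / 1000000) \<le> ?p 0" "?p 0 \<le> 0"
    using two_scale_drop_at_0[folded V_def] two_scale_drop_nonneg[of V] k
    by (auto simp: p cosine_0 intro!: mult_left_mono)
  have p1: "?p 200 \<le> - k * (38 / 10000)"

  proof -
    have "38 / 10 ^ 4 \<le> two_scale_drop (V * cosine 200)"
      by (rule two_scale_drop_ge_wide[OF cpos le]) (simp_all add: V_def)
    then show ?thesis using k by (simp add: p)
  qed
  have p2: "?p 200000 \<le> - k * (38 / 100)"

  proof -
    have "38 / 100 \<le> two_scale_drop (V * cosine 200000)"
      by (rule two_scale_drop_ge_narrow[OF cpos le]) (simp_all add: V_def)
    then show ?thesis using k by (simp add: p)
  qed
  have p3: "?p 70000 \<ge> - k * (12 / 100)"
  proof -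
    have "sqrt (1 + 70000\<^sup>2) \<le> (10 ^ 5 / (7 / 5) :: real)"
      by (rule real_le_lsqrt) (simp_all add: power2_eq_square)
    then have "7 / 5 \<le> V * cosine 70000" by (simp add: cosine_def V_def field_simps)
    then show ?thesis using two_scale_drop_le_middle k by (simp add: p)
  qed
  have p4: "?p u \<ge> - k * (101 / 100)" for u
    using two_scale_drop_le[OF cpos[of u]] k by (simp add: p)
  have "minus.q 70000 \<le> minus.q 0 + (minus.q 200000 - minus.q 0) / (200000 - 0) * (70000 - 0)"
    by (rule convex_on_chord_below_inside[OF minus.q_convex]) auto
  also have "\<dots> = 13 / 20 * ?p 0 + 7 / 20 * minus.q 200000" by (simp add: minus.q_0 field_simps)
  also have "\<dots> \<le> 7 / 20 * (- k * (38 / 100))" using minus.q_le_p[of 200000] p0(2) p2 by linarith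
  also have "\<dots> < - k * (12 / 100)" using k by simp
  also have "\<dots> \<le> ?p 70000" by (rule p3)
  finally have "minus.q 70000 < ?p 70000" .
  then have gap: "70000 \<in> gap_set ?\<rho> (- 1)" by (simp add: gap_sets)
  have "w2 \<le> 70000"
  proof (rule ccontr)
    assume n: "\<not> w2 \<le> 70000"
    have "?p 0 - minus.B * 200 \<le> ?p 200" using minus.q_le_p[of 200] minus.q_first[of 200] n by simp
    then have "minus.B * 200 \<ge> 37 / 10000 * k" using p0(1) p1 k by linarith
    moreover have "minus.B * 70000 \<le> minus.B * w2" using n minus.B_pos by simp
    moreover have "?p w2 = ?p 0 - minus.B * w2" using minus.q_first[of w2] minus.w_contact minus.w_pos by simp
    ultimately show False using p4[of w2] p0(2) k by linarith
  qed
  then show ?thesis using case_4b_nonempty[OF gap] unfolding V_def by blast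
qed

section \<open>Optimal bodies of all lengths\<close>

theorem mainTheorem1:
  shows "(\<forall>\<sigma> V. \<sigma> \<in> class_A2 \<longrightarrow> V > 0 \<longrightarrow>
    (let \<rho> = flux_density \<sigma> V;
         p_plus = pressure \<rho> 1; p_minus = pressure \<rho> (- 1);
         q_plus = pbar \<rho> 1; q_minus = pbar \<rho> (- 1);
         B_plus = slope_B \<rho> 1; B_minus = slope_B \<rho> (- 1);
         O_plus = gap_set \<rho> 1; O_minus = gap_set \<rho> (- 1);
         up = u0_plus \<rho>; um = u0_minus \<rho>; us = u_star \<rho>
     in
       convex_minorant p_plus q_plus \<and>
       (\<forall>g. convex_minorant p_plus g \<longrightarrow> (\<forall>u\<ge>0. g u \<le> q_plus u)) \<and>
       convex_minorant p_minus q_minus \<and>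
       (\<forall>g. convex_minorant p_minus g \<longrightarrow> (\<forall>u\<ge>0. g u \<le> q_minus u)) \<and>
       up > 0 \<and> O_plus = {0<..<up} \<and>
       um > 0 \<and> {0<..<um} \<in> components O_minus \<and>
       (q_plus has_real_derivative - B_plus) (at 0 within {0..}) \<and>
       (q_minus has_real_derivative - B_minus) (at 0 within {0..}) \<and>
       B_plus > B_minus \<and> B_minus > 0 \<and>
       (\<exists>!u. is_u_star \<rho> u) \<and>
       (\<forall>h>0.
          let hp = h_plus \<rho> h; hm = h_minus \<rho> h; R = minimal_resistance \<rho> h in
          (\<forall>z\<in>{0..h}. split_resistance \<rho> h z = q_plus z + q_minus (h - z)) \<and>
          (\<exists>!z. is_arg_min (split_resistance \<rho> h) (\<lambda>z. z \<in> {0..h}) z) \<and>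
          (h < up \<longrightarrow>
             hp = h \<and> hm = 0 \<and>
             (let t0 = 1 - h / up in
              attains_minimum \<rho> h
                (\<lambda>t. if t \<le> t0 then - h else - h + up * (t - t0)) (\<lambda>t. 0)) \<and>
             R = p_plus 0 - B_plus * h + p_minus 0) \<and>
          (up \<le> h \<and> h \<le> us \<longrightarrow>
             hp = h \<and> hm = 0 \<and>
             attains_minimum \<rho> h (\<lambda>t. - h + h * t) (\<lambda>t. 0) \<and>
             R = p_plus h + p_minus 0) \<and>
          (us < h \<and> h < us + um \<longrightarrow>
             hp = us \<and> hm = h - us \<and>
             (let t0 = 1 - hm / um in
              attains_minimum \<rho> h
                (\<lambda>t. - us + us * t)
                (\<lambda>t. if t \<le> t0 then - hm else - hm + um * (t - t0))) \<and>
             R = p_plus us + p_minus 0 - B_minus * (h - us)) \<and>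
          (us + um \<le> h \<longrightarrow>
             balanced \<rho> h hp hm \<and>
             (\<forall>a b. balanced \<rho> h a b \<longrightarrow> a = hp \<and> b = hm) \<and>
             R = p_plus hp + q_minus hm \<and>
             (hm \<notin> O_minus \<longrightarrow>
                attains_minimum \<rho> h (\<lambda>t. - hp + hp * t) (\<lambda>t. - hm + hm * t)) \<and>
             (hm \<in> O_minus \<longrightarrow>
                (\<exists>a b. {a<..<b} \<in> components O_minus \<and> hm \<in> {a<..<b} \<and>
                   {a<..<b} \<noteq> {0<..<um} \<and>
                   (let ti = (b - hm) / (b - a) in
                    attains_minimum \<rho> h
                      (\<lambda>t. - hp + hp * t)
                      (\<lambda>t. if t \<le> ti then - hm + a * t
                           else - hm + a * ti + b * (t - ti))))))) \<and>
       open (case_4b \<rho>) \<and>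
       case_4b \<rho> \<subseteq> {us + um<..} \<and>
       {us + um<..} - case_4b \<rho> \<noteq> {}))
   \<and> (\<exists>\<sigma> V. \<sigma> \<in> class_A2 \<and> V > 0 \<and> case_4b (flux_density \<sigma> V) \<noteq> {})"
proof (intro conjI allI impI)
  fix \<sigma> :: "real \<Rightarrow> real" and V :: real
  assume \<sigma>: "\<sigma> \<in> class_A2" and V: "V > 0"
  interpret radial_density \<sigma> by (rule class_A2_radial_density[OF \<sigma>])
  interpret medium: moving_medium \<sigma> V by unfold_locales (rule V)
  obtain d1 c1 C1 w1 m d2 c2 C2 w2 us where
    "two_faces_star (flux_density \<sigma> V) d1 c1 C1 w1 m d2 c2 C2 w2 us"
    by (rule medium.two_faces_star_exists)
  then interpret two_faces_star "flux_density \<sigma> V" d1 c1 C1 w1 m d2 c2 C2 w2 us .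
  let ?\<rho> = "flux_density \<sigma> V"
  have q: "pbar ?\<rho> 1 = plus.q" "pbar ?\<rho> (- 1) = minus.q" by (simp_all add: pbar_def)
  have bodies: "let hp = h_plus ?\<rho> h; hm = h_minus ?\<rho> h; R = minimal_resistance ?\<rho> h in
          (\<forall>z\<in>{0..h}. split_resistance ?\<rho> h z = plus.q z + minus.q (h - z)) \<and>
          (\<exists>!z. is_arg_min (split_resistance ?\<rho> h) (\<lambda>z. z \<in> {0..h}) z) \<and>
          (h < w1 \<longrightarrow>
             hp = h \<and> hm = 0 \<and>
             (let t0 = 1 - h / w1 in
              attains_minimum ?\<rho> h
                (\<lambda>t. if t \<le> t0 then - h else - h + w1 * (t - t0)) (\<lambda>t. 0)) \<and>
             R = pressure ?\<rho> 1 0 - plus.B * h + pressure ?\<rho> (- 1) 0) \<and>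
          (w1 \<le> h \<and> h \<le> us \<longrightarrow>
             hp = h \<and> hm = 0 \<and>
             attains_minimum ?\<rho> h (\<lambda>t. - h + h * t) (\<lambda>t. 0) \<and>
             R = pressure ?\<rho> 1 h + pressure ?\<rho> (- 1) 0) \<and>
          (us < h \<and> h < us + w2 \<longrightarrow>
             hp = us \<and> hm = h - us \<and>
             (let t0 = 1 - hm / w2 in
              attains_minimum ?\<rho> h
                (\<lambda>t. - us + us * t)
                (\<lambda>t. if t \<le> t0 then - hm else - hm + w2 * (t - t0))) \<and>
             R = pressure ?\<rho> 1 us + pressure ?\<rho> (- 1) 0 - minus.B * (h - us)) \<and>
          (us + w2 \<le> h \<longrightarrow>
             balanced ?\<rho> h hp hm \<and>
             (\<forall>a b. balanced ?\<rho> h a b \<longrightarrow> a = hp \<and> b = hm) \<and>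
             R = pressure ?\<rho> 1 hp + minus.q hm \<and>
             (hm \<notin> gap_set ?\<rho> (- 1) \<longrightarrow>
                attains_minimum ?\<rho> h (\<lambda>t. - hp + hp * t) (\<lambda>t. - hm + hm * t)) \<and>
             (hm \<in> gap_set ?\<rho> (- 1) \<longrightarrow>
                (\<exists>a b. {a<..<b} \<in> components (gap_set ?\<rho> (- 1)) \<and> hm \<in> {a<..<b} \<and>
                   {a<..<b} \<noteq> {0<..<w2} \<and>
                   (let ti = (b - hm) / (b - a) in
                    attains_minimum ?\<rho> h
                      (\<lambda>t. - hp + hp * t)
                      (\<lambda>t. if t \<le> ti then - hm + a * t
                           else - hm + a * ti + b * (t - ti))))))"
    if h: "h > 0" for h
    unfolding Let_def
  proof (intro conjI impI)
    show "\<forall>z\<in>{0..h}. split_resistance ?\<rho> h z = plus.q z + minus.q (h - z)"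
      using split_resistance_eq by (simp add: split_def)
    show "\<exists>!z. is_arg_min (split_resistance ?\<rho> h) (\<lambda>z. z \<in> {0..h}) z"
      by (rule arg_min_unique[OF h])
  next
    assume "h < w1"
    note c = trapezium_case[OF h this]
    show "h_plus ?\<rho> h = h" "h_minus ?\<rho> h = 0" using c by simp_all
    show "attains_minimum ?\<rho> h (\<lambda>t. if t \<le> 1 - h / w1 then - h else - h + w1 * (t - (1 - h / w1))) (\<lambda>t. 0)"
      by (rule c(3))
    show "minimal_resistance ?\<rho> h = pressure ?\<rho> 1 0 - plus.B * h + pressure ?\<rho> (- 1) 0" by (rule c(4))
  next
    assume "w1 \<le> h \<and> h \<le> us"
    then have a: "w1 \<le> h" "h \<le> us" by auto
    note c = triangle_case[OF a]
    show "h_plus ?\<rho> h = h" "h_minus ?\<rho> h = 0" using c by simp_all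
    show "attains_minimum ?\<rho> h (\<lambda>t. - h + h * t) (\<lambda>t. 0)" by (rule c(3))
    show "minimal_resistance ?\<rho> h = pressure ?\<rho> 1 h + pressure ?\<rho> (- 1) 0" by (rule c(4))
  next
    assume "us < h \<and> h < us + w2"
    then have a: "us < h" "h < us + w2" by auto
    note c = triangle_trapezium_case[OF a]
    show "h_plus ?\<rho> h = us" "h_minus ?\<rho> h = h - us" using c by simp_all
    show "attains_minimum ?\<rho> h (\<lambda>t. - us + us * t)
       (\<lambda>t. if t \<le> 1 - h_minus ?\<rho> h / w2 then - h_minus ?\<rho> h
            else - h_minus ?\<rho> h + w2 * (t - (1 - h_minus ?\<rho> h / w2)))"
      unfolding c(2) by (rule c(3))
    show "minimal_resistance ?\<rho> h = pressure ?\<rho> 1 us + pressure ?\<rho> (- 1) 0 - minus.B * (h - us)"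
      by (rule c(4))
  next
    assume a: "us + w2 \<le> h"
    note c = long_case[OF a]
    show "balanced ?\<rho> h (h_plus ?\<rho> h) (h_minus ?\<rho> h)" by (rule c(1))
    show "\<forall>a b. balanced ?\<rho> h a b \<longrightarrow> a = h_plus ?\<rho> h \<and> b = h_minus ?\<rho> h" using c(2) by blast
    show "minimal_resistance ?\<rho> h = pressure ?\<rho> 1 (h_plus ?\<rho> h) + minus.q (h_minus ?\<rho> h)" by (rule c(3))
    show "attains_minimum ?\<rho> h (\<lambda>t. - h_plus ?\<rho> h + h_plus ?\<rho> h * t)
      (\<lambda>t. - h_minus ?\<rho> h + h_minus ?\<rho> h * t)" if "h_minus ?\<rho> h \<notin> gap_set ?\<rho> (- 1)"
      by (rule c(4)[OF that])
    show "\<exists>a b. {a<..<b} \<in> components (gap_set ?\<rho> (- 1)) \<and> h_minus ?\<rho> h \<in> {a<..<b} \<and>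
        {a<..<b} \<noteq> {0<..<w2} \<and>
        attains_minimum ?\<rho> h (\<lambda>t. - h_plus ?\<rho> h + h_plus ?\<rho> h * t)
          (\<lambda>t. if t \<le> (b - h_minus ?\<rho> h) / (b - a) then - h_minus ?\<rho> h + a * t
               else - h_minus ?\<rho> h + a * ((b - h_minus ?\<rho> h) / (b - a))
                 + b * (t - (b - h_minus ?\<rho> h) / (b - a)))"
      if "h_minus ?\<rho> h \<in> gap_set ?\<rho> (- 1)"
      using c(5)[OF that] unfolding two_slope_profile_def Let_def .
  qed
  show "let \<rho> = flux_density \<sigma> V;
         p_plus = pressure \<rho> 1; p_minus = pressure \<rho> (- 1);
         q_plus = pbar \<rho> 1; q_minus = pbar \<rho> (- 1);
         B_plus = slope_B \<rho> 1; B_minus = slope_B \<rho> (- 1);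
         O_plus = gap_set \<rho> 1; O_minus = gap_set \<rho> (- 1);
         up = u0_plus \<rho>; um = u0_minus \<rho>; us = u_star \<rho>
     in
       convex_minorant p_plus q_plus \<and>
       (\<forall>g. convex_minorant p_plus g \<longrightarrow> (\<forall>u\<ge>0. g u \<le> q_plus u)) \<and>
       convex_minorant p_minus q_minus \<and>
       (\<forall>g. convex_minorant p_minus g \<longrightarrow> (\<forall>u\<ge>0. g u \<le> q_minus u)) \<and>
       up > 0 \<and> O_plus = {0<..<up} \<and>
       um > 0 \<and> {0<..<um} \<in> components O_minus \<and>
       (q_plus has_real_derivative - B_plus) (at 0 within {0..}) \<and>
       (q_minus has_real_derivative - B_minus) (at 0 within {0..}) \<and>
       B_plus > B_minus \<and> B_minus > 0 \<and>
       (\<exists>!u. is_u_star \<rho> u) \<and>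
       (\<forall>h>0.
          let hp = h_plus \<rho> h; hm = h_minus \<rho> h; R = minimal_resistance \<rho> h in
          (\<forall>z\<in>{0..h}. split_resistance \<rho> h z = q_plus z + q_minus (h - z)) \<and>
          (\<exists>!z. is_arg_min (split_resistance \<rho> h) (\<lambda>z. z \<in> {0..h}) z) \<and>
          (h < up \<longrightarrow>
             hp = h \<and> hm = 0 \<and>
             (let t0 = 1 - h / up in
              attains_minimum \<rho> h
                (\<lambda>t. if t \<le> t0 then - h else - h + up * (t - t0)) (\<lambda>t. 0)) \<and>
             R = p_plus 0 - B_plus * h + p_minus 0) \<and>
          (up \<le> h \<and> h \<le> us \<longrightarrow>
             hp = h \<and> hm = 0 \<and>
             attains_minimum \<rho> h (\<lambda>t. - h + h * t) (\<lambda>t. 0) \<and>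
             R = p_plus h + p_minus 0) \<and>
          (us < h \<and> h < us + um \<longrightarrow>
             hp = us \<and> hm = h - us \<and>
             (let t0 = 1 - hm / um in
              attains_minimum \<rho> h
                (\<lambda>t. - us + us * t)
                (\<lambda>t. if t \<le> t0 then - hm else - hm + um * (t - t0))) \<and>
             R = p_plus us + p_minus 0 - B_minus * (h - us)) \<and>
          (us + um \<le> h \<longrightarrow>
             balanced \<rho> h hp hm \<and>
             (\<forall>a b. balanced \<rho> h a b \<longrightarrow> a = hp \<and> b = hm) \<and>
             R = p_plus hp + q_minus hm \<and>
             (hm \<notin> O_minus \<longrightarrow>
                attains_minimum \<rho> h (\<lambda>t. - hp + hp * t) (\<lambda>t. - hm + hm * t)) \<and>
             (hm \<in> O_minus \<longrightarrow>
                (\<exists>a b. {a<..<b} \<in> components O_minus \<and> hm \<in> {a<..<b} \<and>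
                   {a<..<b} \<noteq> {0<..<um} \<and>
                   (let ti = (b - hm) / (b - a) in
                    attains_minimum \<rho> h
                      (\<lambda>t. - hp + hp * t)
                      (\<lambda>t. if t \<le> ti then - hm + a * t
                           else - hm + a * ti + b * (t - ti))))))) \<and>
       open (case_4b \<rho>) \<and>
       case_4b \<rho> \<subseteq> {us + um<..} \<and>
       {us + um<..} - case_4b \<rho> \<noteq> {}"
    unfolding Let_def[of ?\<rho>] Let_def[of "pressure ?\<rho> 1"] Let_def[of "pressure ?\<rho> (- 1)"]
      Let_def[of "pbar ?\<rho> 1"] Let_def[of "pbar ?\<rho> (- 1)"]
      Let_def[of "slope_B ?\<rho> 1"] Let_def[of "slope_B ?\<rho> (- 1)"]
      Let_def[of "gap_set ?\<rho> 1"] Let_def[of "gap_set ?\<rho> (- 1)"]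
      Let_def[of "u0_plus ?\<rho>"] Let_def[of "u0_minus ?\<rho>"] Let_def[of "u_star ?\<rho>"]
    unfolding u_star_eq u0_plus_eq u0_minus_eq slope_B_eq q
  proof (intro conjI)
    show "convex_minorant (pressure ?\<rho> 1) plus.q" by (rule plus.q_minorant)
    show "\<forall>g. convex_minorant (pressure ?\<rho> 1) g \<longrightarrow> (\<forall>u\<ge>0. g u \<le> plus.q u)"
      using plus.q_max by blast
    show "convex_minorant (pressure ?\<rho> (- 1)) minus.q" by (rule minus.q_minorant)
    show "\<forall>g. convex_minorant (pressure ?\<rho> (- 1)) g \<longrightarrow> (\<forall>u\<ge>0. g u \<le> minus.q u)"
      using minus.q_max by blast
    show "0 < w1" "0 < w2" by (rule plus.w_pos, rule minus.w_pos)
    show "gap_set ?\<rho> 1 = {0<..<w1}" unfolding gap_sets by (rule plus.gap_eq)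
    show "{0<..<w2} \<in> components (gap_set ?\<rho> (- 1))" by (rule first_component)
    show "(plus.q has_real_derivative - plus.B) (at 0 within {0..})" by (rule plus.q_deriv_0)
    show "(minus.q has_real_derivative - minus.B) (at 0 within {0..})" by (rule minus.q_deriv_0)
    show "minus.B < plus.B" "0 < minus.B" by (rule B_less, rule minus.B_pos)
    show "\<exists>!u. is_u_star ?\<rho> u" by (simp add: is_u_star_iff[OF us_gt us_slope])
    show "open (case_4b ?\<rho>)" by (rule open_case_4b)
    show "case_4b ?\<rho> \<subseteq> {us + w2<..}" by (rule case_4b_subset)
    show "{us + w2<..} - case_4b ?\<rho> \<noteq> {}" by (rule case_4b_complement)
  qed (intro allI impI bodies)
next
  show "\<exists>\<sigma> V. \<sigma> \<in> class_A2 \<and> V > 0 \<and> case_4b (flux_density \<sigma> V) \<noteq> {}"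
    using two_scale_density_A2 two_scale_case_4b
    by (intro exI[of _ two_scale_density] exI[of _ "10 ^ 5"]) simp
qed

end
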